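(* Assume that the system $y(t+1)=f(y(t),u(t),\sigma(t))$ satisfies the strong $h$-approximation conditions for every vector function $h=(q_1,\dots,q_j)$, $j=1,2,\dots$. Then there exists a function $\psi_2(\epsilon)$ with $\lim_{\epsilon\to0}\psi_2(\epsilon)=0$ such that, corresponding to any solution $\bar z(\cdot)$ of the differential inclusion $$\dot z(s)\in V_g(z(s)),\quad z(0)=z_0,\quad s\in[0,1],$$ and any $\epsilon>0$, there exists a control plan $\bar\pi\in\Pi$ such that the solution $z_\epsilon^{\bar\pi}(\cdot)$ of the hybrid system obtained with this control plan satisfies $$\max_{s\in[0,1]}E\,\|z_\epsilon^{\bar\pi}(s)-\bar z(s)\|\le\psi_2(\epsilon).$$
   Context: Discrete-time system. $Y\subset\mathbb R^m$ is compact, $\hat U$ and $S$ are compact metric spaces, $f:Y\times\hat U\times S\to\mathbb R^m$ is continuous, and $f(y,u,\sigma)\in Y$ for all $(y,u,\sigma)$. $\sigma(0),\sigma(1),\dots$ are i.i.d. random elements of $S$ on a common probability space; $\sigma$ denotes a random element with their common law. The system is $y(t+1)=f(y(t),u(t),\sigma(t))$, $y(0)=y_0\in Y$. A control plan (on the infinite horizon) is $\pi=\{\pi_t\}_{t\ge0}$ with $\pi_0\in\hat U$ and $\pi_t:S^t\to\hat U$ Borel measurable for $t\ge1$; $u(0)=\pi_0$, $u(t)=\pi_t(\sigma(0),\dots,\sigma(t-1))$; $(y^{\pi,y_0}(\cdot),u^{\pi,y_0}(\cdot))$ is the resulting trajectory. For the hybrid system with parameter $\epsilon$, the plans are considered on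 $t=0,1,\dots,\lfloor1/\epsilon\rfloor$ only; $\Pi$ is the set of all such plans. Strong $h$-approximation conditions. $q_1,q_2,\dots$ is a fixed sequence of Lipschitz continuous functions dense in the unit ball of $C(Y\times\hat U)$. For a given $h=(q_1,\dots,q_j):Y\times\hat U\to\mathbb R^j$ the conditions are: there is a monotone decreasing $\nu_h:[0,\infty)\to[0,\infty)$ with $\lim_{T\to\infty}\nu_h(T)=0$ such that for all $T$, all $y_0',y_0''\in Y$ and every control plan $\pi'$ there is a control plan $\pi''$ with $E\Big[\Big\|\frac1T\sum_{t=0}^{T}h(y^{\pi',y_0'}(t),u^{\pi',y_0'}(t))-\frac1T\sum_{t=0}^{T}h(y^{\pi'',y_0''}(t),u^{\pi'',y_0''}(t))\Big\|\Big]\le\nu_h(T)$. Hybrid system. For $\epsilon>0$ and $\pi\in\Pi$ (with $y_0$ fixed and suppressed in the notation), $z_\epsilon^{\pi}(\cdot)$ is the solution on $[0,1]$ of $\dot z_\epsilon(s)=g(z_\epsilon(s),y_\epsilon(s),u_\epsilon(s))$, $z_\epsilon(0)=z_0\in\mathbb R^n$, where $y_\epsilon(s)=y^{\pi,y_0}(t)$ and $u_\epsilon(s)=u^{\pi,y_0}(t)$ for $s\in[\epsilon t,\epsilon(t+1))$, $t=0,1,\dots,\lfloor1/\epsilon\rfloor$. The function $g:\mathbb R^n\times Y\times\hat U\to\mathbb R^n$ is continuous, and there is $C>0$ with $\|g(z_1,y,u)-g(z_2,y,u)\|\le C\|z_1-z_2\|$ for all $z_1,z_2\in Z$, $y\in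 Y$, $u\in\hat U$, where $Z\subset\mathbb R^n$ is a sufficiently large compact set: it contains in its interior all solutions of the hybrid system (for all $\epsilon$, all plans) and of the differential inclusion. Stationary measures and $V_g$. $W$ is the set of Borel probability measures $\gamma$ on $Y\times\hat U$ such that $\int_{Y\times\hat U}(E[\varphi(f(y,u,\sigma))]-\varphi(y))\gamma(dy,du)=0$ for all $\varphi\in C(Y)$, and $V_g(z)=\bigcup_{\gamma\in W}\big\{\int_{Y\times\hat U}g(z,y,u)\gamma(dy,du)\big\}$. A solution of the differential inclusion is an absolutely continuous (deterministic) function on $[0,1]$ with $z(0)=z_0$ satisfying the inclusion for almost all $s\in[0,1]$. *)

theory Defs
  imports "HOL-Probability.Probability"
begin

text \<open>
  Compact metric spaces are rendered as compact subsets of arbitrary metric spaces, carrying the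
  Borel sets of the ambient space restricted to them.
\<close>

abbreviation borel_on :: "'a::topological_space set \<Rightarrow> 'a measure" where
  "borel_on A \<equiv> restrict_space borel A"

text \<open>
  Control plans on the set \<open>I\<close> of times.  A point of \<open>S\<^sup>t\<close> is an extensional function on
  \<open>{..<t}\<close>; in particular \<open>S\<^sup>0\<close> is a singleton, so that \<open>\<pi> 0\<close> is just one element of \<open>U\<close>.
  Since \<open>S\<close> will be compact metric, the product sigma-algebra is the Borel sigma-algebra of \<open>S\<^sup>t\<close>.
\<close>

definition control_plans ::
  "'u::metric_space set \<Rightarrow> 's::metric_space set \<Rightarrow> nat set \<Rightarrow> (nat \<Rightarrow> (nat \<Rightarrow> 's) \<Rightarrow> 'u) set" where
  "control_plans U S I =
     {\<pi>. \<forall>t\<in>I. \<pi> t \<in> PiM {..<t} (\<lambda>_. borel_on S) \<rightarrow>\<^sub>M borel_on U}"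

text \<open>The plans of the hybrid system: only the times \<open>0, \<dots>, \<lfloor>1/\<epsilon>\<rfloor>\<close> matter.\<close>

definition hybrid_plans ::
  "'u::metric_space set \<Rightarrow> 's::metric_space set \<Rightarrow> real \<Rightarrow> (nat \<Rightarrow> (nat \<Rightarrow> 's) \<Rightarrow> 'u) set" where
  "hybrid_plans U S \<epsilon> = control_plans U S {..nat \<lfloor>1 / \<epsilon>\<rfloor>}"

text \<open>Below, \<open>w\<close> is one realization of the noise sequence.\<close>

definition control :: "(nat \<Rightarrow> (nat \<Rightarrow> 's) \<Rightarrow> 'u) \<Rightarrow> (nat \<Rightarrow> 's) \<Rightarrow> nat \<Rightarrow> 'u" where
  "control \<pi> w t = \<pi> t (restrict w {..<t})"

primrec state ::
  "('y \<times> 'u \<times> 's \<Rightarrow> 'y) \<Rightarrow> 'y \<Rightarrow> (nat \<Rightarrow> (nat \<Rightarrow> 's) \<Rightarrow> 'u) \<Rightarrow> (nat \<Rightarrow> 's) \<Rightarrow> nat \<Rightarrow> 'y" where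
  "state f y0 \<pi> w 0 = y0"
| "state f y0 \<pi> w (Suc t) = f (state f y0 \<pi> w t, control \<pi> w t, w t)"

text \<open>
  The strong approximation condition for \<open>h = (h 0, \<dots>, h (j - 1))\<close>; \<open>L2_set\<close> is the Euclidean
  norm on \<open>\<real>\<^sup>j\<close>.
\<close>

definition strong_approximation ::
  "'w measure \<Rightarrow> (nat \<Rightarrow> 'w \<Rightarrow> 's::metric_space) \<Rightarrow> 'y set \<Rightarrow> 'u::metric_space set \<Rightarrow> 's set \<Rightarrow>
   ('y \<times> 'u \<times> 's \<Rightarrow> 'y) \<Rightarrow> nat \<Rightarrow> (nat \<Rightarrow> 'y \<times> 'u \<Rightarrow> real) \<Rightarrow> bool" where
  "strong_approximation M \<sigma> Y U S f j h \<longleftrightarrow>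
    (\<exists>\<nu> :: real \<Rightarrow> real.
       antimono_on {0..} \<nu> \<and> (\<forall>T\<ge>0. 0 \<le> \<nu> T) \<and> (\<nu> \<longlongrightarrow> 0) at_top \<and>
       (\<forall>T::nat. T \<ge> 1 \<longrightarrow>
         (\<forall>y'\<in>Y. \<forall>y''\<in>Y. \<forall>\<pi>'\<in>control_plans U S UNIV. \<exists>\<pi>''\<in>control_plans U S UNIV.
           (\<integral>\<omega>. L2_set (\<lambda>i.
                 (1 / real T) * (\<Sum>t=0..T. h i (state f y' \<pi>' (\<lambda>k. \<sigma> k \<omega>) t,
                                               control \<pi>' (\<lambda>k. \<sigma> k \<omega>) t))
               - (1 / real T) * (\<Sum>t=0..T. h i (state f y'' \<pi>'' (\<lambda>k. \<sigma> k \<omega>) t,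
                                               control \<pi>'' (\<lambda>k. \<sigma> k \<omega>) t))) {..<j} \<partial>M)
           \<le> \<nu> (real T))))"

definition lipschitz_dense_sequence :: "'x::metric_space set \<Rightarrow> (nat \<Rightarrow> 'x \<Rightarrow> real) \<Rightarrow> bool" where
  "lipschitz_dense_sequence X q \<longleftrightarrow>
     (\<forall>i. (\<exists>L. L-lipschitz_on X (q i)) \<and> (\<forall>x\<in>X. \<bar>q i x\<bar> \<le> 1)) \<and>
     (\<forall>\<phi>. continuous_on X \<phi> \<and> (\<forall>x\<in>X. \<bar>\<phi> x\<bar> \<le> 1) \<longrightarrow>
        (\<forall>e>0. \<exists>i. \<forall>x\<in>X. \<bar>q i x - \<phi> x\<bar> < e))"

text \<open>\<open>X\<close> is a random element on \<open>M\<close> having the law of the noise.\<close>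

definition stationary_measures ::
  "'w measure \<Rightarrow> ('w \<Rightarrow> 's) \<Rightarrow> 'y::topological_space set \<Rightarrow> 'u::topological_space set \<Rightarrow>
   ('y \<times> 'u \<times> 's \<Rightarrow> 'y) \<Rightarrow> ('y \<times> 'u) measure set" where
  "stationary_measures M X Y U f =
     {\<gamma>. prob_space \<gamma> \<and> sets \<gamma> = sets (borel_on (Y \<times> U)) \<and>
         (\<forall>\<phi> :: 'y \<Rightarrow> real. continuous_on Y \<phi> \<longrightarrow>
            (\<integral>(y, u). (\<integral>\<omega>. \<phi> (f (y, u, X \<omega>)) \<partial>M) - \<phi> y \<partial>\<gamma>) = 0)}"

definition averaged_velocities ::
  "('y \<times> 'u) measure set \<Rightarrow> ('z::{banach, second_countable_topology} \<times> 'y \<times> 'u \<Rightarrow> 'z) \<Rightarrow> 'z \<Rightarrow> 'z set" where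
  "averaged_velocities W g z = (\<Union>\<gamma>\<in>W. {\<integral>(y, u). g (z, y, u) \<partial>\<gamma>})"

definition absolutely_continuous_fun_on :: "real set \<Rightarrow> (real \<Rightarrow> 'z::real_normed_vector) \<Rightarrow> bool" where
  "absolutely_continuous_fun_on A z \<longleftrightarrow>
     (\<forall>e>0. \<exists>d>0. \<forall>D. finite D \<and> (\<forall>(a, b)\<in>D. a \<le> b \<and> {a..b} \<subseteq> A) \<and>
        disjoint_family_on (\<lambda>(a, b). {a<..<b}) D \<and> (\<Sum>(a, b)\<in>D. b - a) < d \<longrightarrow>
        (\<Sum>(a, b)\<in>D. norm (z b - z a)) < e)"

text \<open>Caratheodory solutions on \<open>[0, 1]\<close> of \<open>z' s \<in> F s (z s)\<close>, \<open>z 0 = z0\<close>.\<close>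

definition inclusion_solution ::
  "(real \<Rightarrow> 'z \<Rightarrow> 'z set) \<Rightarrow> 'z::real_normed_vector \<Rightarrow> (real \<Rightarrow> 'z) \<Rightarrow> bool" where
  "inclusion_solution F z0 z \<longleftrightarrow>
     absolutely_continuous_fun_on {0..1} z \<and> z 0 = z0 \<and>
     (AE s in lborel. s \<in> {0..1} \<longrightarrow> (\<exists>v\<in>F s (z s). (z has_vector_derivative v) (at s)))"

text \<open>
  The right-hand side of the hybrid system is only piecewise continuous in \<open>s\<close>, so its equation is
  also understood almost everywhere.  For \<open>s \<ge> 0\<close>, \<open>nat \<lfloor>s / \<epsilon>\<rfloor>\<close> is the \<open>t\<close> with
  \<open>\<epsilon> * t \<le> s < \<epsilon> * (t + 1)\<close>.
\<close>

definition hybrid_solution ::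
  "('y \<times> 'u \<times> 's \<Rightarrow> 'y) \<Rightarrow> ('z \<times> 'y \<times> 'u \<Rightarrow> 'z) \<Rightarrow> 'y \<Rightarrow> 'z::real_normed_vector \<Rightarrow> real \<Rightarrow>
   (nat \<Rightarrow> (nat \<Rightarrow> 's) \<Rightarrow> 'u) \<Rightarrow> (nat \<Rightarrow> 's) \<Rightarrow> (real \<Rightarrow> 'z) \<Rightarrow> bool" where
  "hybrid_solution f g y0 z0 \<epsilon> \<pi> w z \<longleftrightarrow>
     inclusion_solution
       (\<lambda>s x. {g (x, state f y0 \<pi> w (nat \<lfloor>s / \<epsilon>\<rfloor>), control \<pi> w (nat \<lfloor>s / \<epsilon>\<rfloor>))}) z0 z"

end

theory Submission
  imports Defs
begin

text \<open>
  Blackwell's approachability argument. Time is cut into blocks of a fixed large number of steps, and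
  \<open>D\<close> denotes the difference between the Euler sum of \<open>g (zbar s, y, u)\<close> and \<open>zbar\<close> at the
  beginning of a block. In the block the plan nearly maximizes the expected average of \<open>- D \<bullet> g\<close>.
  Integrating the Bellman inequality of that control problem against a stationary measure shows that
  some initial state achieves at least the average over the measure, and the approximation condition
  carries this over to the actual state. Since the velocities of \<open>zbar\<close> are averages over stationary
  measures, the cross term in the expansion of the square of the norm of \<open>D\<close> is nearly nonpositive in
  expectation, so that \<open>D\<close> stays small in mean square. Gronwall's inequality then compares the
  hybrid trajectory with \<open>zbar\<close>.
\<close>

section \<open>Mean value inequalities for absolutely continuous functions\<close>

text \<open>Plans read only the noise, whereas Blackwell's strategy must react to \<open>D\<close>.
  Since \<open>D\<close> and the state at the start of a block are functions of past noise, the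
  reaction is a measurable index computed from the history, which picks one of countably many
  prepared continuations; equicontinuity in the initial state, uniform over plans, reduces this
  choice to a finite net. The estimate must also be uniform over all solutions \<open>zbar\<close>.
  Hence the block length \<open>L\<close> and the continuations are fixed before
  \<open>zbar\<close>, for all directions in a ball of radius \<open>2 * R\<close> and all points of
  \<open>Z\<close>, where \<open>R\<close> bounds \<open>g\<close>; only the plan assembled from
  them depends on \<open>zbar\<close>. Evaluating \<open>g\<close> along the deterministic
  \<open>zbar\<close> keeps the parameter of each block problem in a compact set, and the Lipschitz
  condition repairs the discrepancy. With \<open>h = \<epsilon> * L\<close>, a block adds at most
  \<open>h * (2 * e + O(h))\<close> to the mean square of \<open>D\<close>, and at most
  \<open>1 / h\<close> blocks fit into the unit interval. So \<open>e\<close> is fixed first, which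
  fixes \<open>L\<close>, and \<open>\<epsilon>\<close> comes last.\<close>

lemma additive_tagged_division_real:
  fixes \<phi> :: "real \<Rightarrow> real"
  assumes "a \<le> b" "p tagged_division_of {a..b}"
  shows "(\<Sum>(x, K)\<in>p. \<phi> (Sup K) - \<phi> (Inf K)) = \<phi> b - \<phi> a"
  using additive_tagged_division_1[OF assms, of \<phi>] by simp

lemma absolutely_continuous_fun_onE:
  assumes "absolutely_continuous_fun_on A z" "e > 0"
  obtains d where "d > 0" "\<And>D. finite D \<Longrightarrow> (\<And>a b. (a, b) \<in> D \<Longrightarrow> a \<le> b \<and> {a..b} \<subseteq> A) \<Longrightarrow>
    disjoint_family_on (\<lambda>(a, b). {a<..<b}) D \<Longrightarrow> (\<Sum>(a, b)\<in>D. b - a) < d \<Longrightarrow>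
    (\<Sum>(a, b)\<in>D. norm (z b - z a)) < e"
proof -
  from assms(1)[unfolded absolutely_continuous_fun_on_def, rule_format, OF assms(2)]
  obtain d where d: "d > 0" "\<And>D. finite D \<and> (\<forall>(a, b)\<in>D. a \<le> b \<and> {a..b} \<subseteq> A) \<and>
        disjoint_family_on (\<lambda>(a, b). {a<..<b}) D \<and> (\<Sum>(a, b)\<in>D. b - a) < d \<longrightarrow>
        (\<Sum>(a, b)\<in>D. norm (z b - z a)) < e" by blast
  show thesis
  proof (rule that[OF d(1)])
    fix D assume "finite D" "\<And>a b. (a, b) \<in> D \<Longrightarrow> a \<le> b \<and> {a..b} \<subseteq> A"
      "disjoint_family_on (\<lambda>(a, b). {a<..<b}) D" "(\<Sum>(a, b)\<in>D. b - a) < d"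
    then show "(\<Sum>(a, b)\<in>D. norm (z b - z a)) < e" by (intro d(2)[rule_format] conjI) auto
  qed
qed

text \<open>
  A gauge argument: on intervals tagged outside the exceptional null set the derivative bound is
  used, and the remaining intervals have small total length, so absolute continuity applies.
\<close>

lemma absolutely_continuous_mean_value_le:
  fixes \<phi> :: "real \<Rightarrow> real"
  assumes ac: "absolutely_continuous_fun_on {a..b} \<phi>" and "a \<le> b"
    and deriv: "AE s in lborel. s \<in> {a<..<b} \<longrightarrow> (\<exists>v\<le>c. (\<phi> has_vector_derivative v) (at s))"
  shows "\<phi> b - \<phi> a \<le> c * (b - a)"
proof -
  \<comment> \<open>The error has three sources: the slope \<open>c + e\<close> instead of
    \<open>c\<close>, increments below \<open>e\<close> over the badly tagged intervals, and at most
    \<open>\<bar>c\<bar> * e\<close> because those intervals are missing from the main sum.\<close>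
  have main: "\<phi> b - \<phi> a \<le> c * (b - a) + e * (2 + \<bar>c\<bar> + (b - a))" if e: "e > 0" for e
  proof -
    obtain d0 where d0: "d0 > 0" and acd: "\<And>D. finite D \<Longrightarrow> (\<And>a' b'. (a', b') \<in> D \<Longrightarrow> a' \<le> b' \<and> {a'..b'} \<subseteq> {a..b}) \<Longrightarrow>
        disjoint_family_on (\<lambda>(a, b). {a<..<b}) D \<Longrightarrow> (\<Sum>(a, b)\<in>D. b - a) < d0 \<Longrightarrow>
        (\<Sum>(a, b)\<in>D. norm (\<phi> b - \<phi> a)) < e"
      using absolutely_continuous_fun_onE[OF ac e] by (metis (no_types, lifting))
    define d where "d = min d0 e"
    have d: "d > 0" "d \<le> d0" "d \<le> e" using d0 e by (auto simp: d_def)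
    obtain N0 where N0: "N0 \<in> null_sets lborel"
      and N0d: "\<And>s. s \<in> {a<..<b} \<Longrightarrow> s \<notin> N0 \<Longrightarrow> \<exists>v\<le>c. (\<phi> has_vector_derivative v) (at s)"
    proof -
      obtain N0 where "N0 \<in> null_sets lborel"
        "{s\<in>space lborel. \<not> (s \<in> {a<..<b} \<longrightarrow> (\<exists>v\<le>c. (\<phi> has_vector_derivative v) (at s)))} \<subseteq> N0"
        using deriv unfolding eventually_ae_filter by blast
      then show thesis by (intro that[of N0]) auto
    qed
    \<comment> \<open>The endpoints join the null set because the derivative is controlled only in
      the open interval.\<close>
    define N where "N = N0 \<union> {a, b}"
    have N: "N \<in> null_sets lborel"
      unfolding N_def using N0 by (intro null_sets.Un) (auto intro!: finite_imp_null_set_lborel)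
    have Nd: "\<exists>v\<le>c. (\<phi> has_vector_derivative v) (at s)" if "s \<in> {a..b}" "s \<notin> N" for s
      using N0d[of s] that by (auto simp: N_def)
    obtain G where G: "open G" "N \<subseteq> G" "emeasure lborel (G - N) < d"
      using outer_regular_lborel[of N d] N d by (auto simp: null_sets_def)
    have Gd: "emeasure lborel G < d"
    proof -
      have "emeasure lborel G = emeasure lborel (G - N)"
        using N G by (intro emeasure_Diff_null_set[symmetric]) auto
      then show ?thesis using G by simp
    qed
    \<comment> \<open>Straddle estimate: differentiability at the tag alone controls the increment
      over every small interval containing the tag, by comparing both endpoints with it.\<close>
    have "\<exists>r>0. \<forall>u v. u \<le> s \<and> s \<le> v \<and> {u..v} \<subseteq> ball s r \<longrightarrow> \<phi> v - \<phi> u \<le> (c + e) * (v - u)"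
      if s: "s \<in> {a..b}" "s \<notin> N" for s
    proof -
      obtain v where v: "v \<le> c" "(\<phi> has_vector_derivative v) (at s)" using Nd[OF s] by auto
      have "(\<phi> has_derivative (\<lambda>x. x * v)) (at s)"
        using v(2) by (simp add: has_vector_derivative_def)
      then obtain r where r: "r > 0"
        and rb: "\<And>y. norm (y - s) < r \<Longrightarrow> norm (\<phi> y - \<phi> s - (y - s) * v) \<le> e * norm (y - s)"
        using e unfolding has_derivative_at_alt by metis
      have "\<phi> y' - \<phi> y \<le> (c + e) * (y' - y)"
        if y: "y \<le> s" "s \<le> y'" "{y..y'} \<subseteq> ball s r" for y y'
      proof -
        have "y \<in> {y..y'}" "y' \<in> {y..y'}" using y by auto
        then have "y \<in> ball s r" "y' \<in> ball s r" using y(3) by blast+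
        then have "\<bar>\<phi> y - \<phi> s - (y - s) * v\<bar> \<le> e * \<bar>y - s\<bar>" "\<bar>\<phi> y' - \<phi> s - (y' - s) * v\<bar> \<le> e * \<bar>y' - s\<bar>"
          using rb[of y] rb[of y'] by (auto simp: dist_real_def abs_minus_commute)
        then have "\<phi> y' - \<phi> s \<le> (y' - s) * v + e * (y' - s)" "\<phi> s - \<phi> y \<le> (s - y) * v + e * (s - y)"
          using y by (auto simp: abs_le_iff algebra_simps)
        moreover have "(y' - y) * v \<le> (y' - y) * c" using y v by (intro mult_left_mono) auto
        ultimately show ?thesis by (simp add: algebra_simps)
      qed
      then show ?thesis using r by auto
    qed
    then obtain r where r: "\<And>s. s \<in> {a..b} \<Longrightarrow> s \<notin> N \<Longrightarrow> r s > 0"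
      and rb: "\<And>s u v. s \<in> {a..b} \<Longrightarrow> s \<notin> N \<Longrightarrow> u \<le> s \<Longrightarrow> s \<le> v \<Longrightarrow> {u..v} \<subseteq> ball s (r s) \<Longrightarrow>
        \<phi> v - \<phi> u \<le> (c + e) * (v - u)"
      by metis
    \<comment> \<open>Intervals tagged in \<open>N\<close> are forced into the open set
      \<open>G\<close> of measure below \<open>d\<close>, which makes their total length
      small.\<close>
    define \<gamma> where "\<gamma> s = (if s \<in> N then G else if s \<in> {a..b} then ball s (r s) else UNIV)" for s
    have "gauge \<gamma>" using G r by (auto simp: gauge_def \<gamma>_def)
    then obtain p where p: "p tagged_division_of {a..b}" "\<gamma> fine p"
      by (rule fine_division_exists_real)
    have fin: "finite p" using p by auto
    have K: "\<exists>u v. K = {u..v} \<and> u \<le> x \<and> x \<le> v \<and> {u..v} \<subseteq> {a..b} \<and> {u..v} \<subseteq> \<gamma> x" if xK: "(x, K) \<in> p" for x K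
    proof -
      obtain u v where "K = cbox u v" using tagged_division_ofD(4)[OF p(1) xK] by blast
      moreover have "x \<in> K" "K \<subseteq> {a..b}" "K \<subseteq> \<gamma> x"
        using tagged_division_ofD(2,3)[OF p(1) xK] fineD[OF p(2) xK] by auto
      ultimately show ?thesis by (auto intro!: exI[of _ u] exI[of _ v])
    qed
    \<comment> \<open>Degenerate intervals contribute nothing and are left out; the others have
      nonempty disjoint interiors, so passing to endpoints by \<open>\<iota>\<close> is injective
      and sums can be reindexed.\<close>
    define B where "B = {(x, K)\<in>p. x \<in> N \<and> Inf K < Sup K}"
    define \<iota> where "\<iota> = (\<lambda>(x::real, K::real set). (Inf K, Sup K))"
    define D where "D = \<iota> ` B"
    have finB: "finite B" by (rule finite_subset[OF _ fin]) (auto simp: B_def)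
    have disj: "{Inf K<..<Sup K} \<inter> {Inf K'<..<Sup K'} = {}"
      if "(x, K) \<in> B" "(x', K') \<in> B" "(x, K) \<noteq> (x', K')" for x K x' K'
    proof -
      have "(x, K) \<in> p" "(x', K') \<in> p" using that by (auto simp: B_def)
      then have "interior K \<inter> interior K' = {}" using tagged_division_ofD(5)[OF p(1)] that(3) by blast
      moreover obtain u v where "K = {u..v}" "u \<le> v" using K[OF \<open>(x, K) \<in> p\<close>] by auto
      moreover obtain u' v' where "K' = {u'..v'}" "u' \<le> v'" using K[OF \<open>(x', K') \<in> p\<close>] by auto
      ultimately show ?thesis by simp
    qed
    have inj: "inj_on \<iota> B"
    proof (rule inj_onI, clarify)
      fix x K x' K' assume h: "(x, K) \<in> B" "(x', K') \<in> B" "\<iota> (x, K) = \<iota> (x', K')"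
      show "x = x' \<and> K = K'"
      proof (rule ccontr)
        assume "\<not> (x = x' \<and> K = K')"
        then have "{Inf K<..<Sup K} \<inter> {Inf K'<..<Sup K'} = {}" using disj[OF h(1,2)] by auto
        moreover have "Inf K < Sup K" using h by (auto simp: B_def)
        ultimately show False using h(3) by (auto simp: \<iota>_def)
      qed
    qed
    have disjD: "disjoint_family_on (\<lambda>(a, b). {a<..<b}) D"
      unfolding disjoint_family_on_def
    proof (intro ballI impI)
      fix i j assume "i \<in> D" "j \<in> D" "i \<noteq> j"
      then obtain x K x' K' where "(x, K) \<in> B" "(x', K') \<in> B" and ij: "i = (Inf K, Sup K)" "j = (Inf K', Sup K')"
        by (auto simp: D_def \<iota>_def)
      then have "{Inf K<..<Sup K} \<inter> {Inf K'<..<Sup K'} = {}" using \<open>i \<noteq> j\<close> by (intro disj) auto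
      then show "(\<lambda>(a, b). {a<..<b}) i \<inter> (\<lambda>(a, b). {a<..<b}) j = {}" using ij by simp
    qed
    have DK: "a' < b' \<and> {a'..b'} \<subseteq> {a..b} \<and> {a'<..<b'} \<subseteq> G" if "(a', b') \<in> D" for a' b'
    proof -
      obtain x K where xK: "(x, K) \<in> B" "a' = Inf K" "b' = Sup K" using \<open>(a', b') \<in> D\<close> by (auto simp: D_def \<iota>_def)
      then have "(x, K) \<in> p" "x \<in> N" "Inf K < Sup K" by (auto simp: B_def)
      moreover obtain u v where "K = {u..v}" "u \<le> v" "{u..v} \<subseteq> {a..b}" "{u..v} \<subseteq> \<gamma> x"
        using K[OF \<open>(x, K) \<in> p\<close>] by auto
      ultimately show ?thesis using xK greaterThanLessThan_subseteq_atLeastAtMost_iff[of u v u v]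
        by (auto simp: \<gamma>_def subset_eq)
    qed
    have "ennreal (\<Sum>(a, b)\<in>D. b - a) = (\<Sum>(a, b)\<in>D. ennreal (b - a))"
      using DK by (subst sum_ennreal[symmetric]) (auto simp: case_prod_beta less_imp_le)
    also have "\<dots> = (\<Sum>d\<in>D. emeasure lborel ((\<lambda>(a, b). {a<..<b}) d))"
      using DK by (intro sum.cong) (auto simp: less_imp_le)
    also have "\<dots> = emeasure lborel (\<Union>d\<in>D. (\<lambda>(a, b). {a<..<b}) d)"
      using disjD finB by (intro sum_emeasure) (auto simp: D_def)
    also have "\<dots> \<le> emeasure lborel G"
      using DK G by (intro emeasure_mono) auto
    also have "\<dots> < d" by (rule Gd)
    finally have lenD: "(\<Sum>(a, b)\<in>D. b - a) < d"
      by (simp add: ennreal_less_iff d(1) DK less_imp_le sum_nonneg case_prod_beta)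
    have "(\<Sum>(a, b)\<in>D. norm (\<phi> b - \<phi> a)) < e"
      using finB DK lenD d by (intro acd disjD) (auto simp: D_def less_imp_le subset_eq)
    then have B1: "(\<Sum>(x, K)\<in>B. \<bar>\<phi> (Sup K) - \<phi> (Inf K)\<bar>) < e"
      unfolding D_def using inj by (subst (asm) sum.reindex) (auto simp: \<iota>_def case_prod_beta)
    have B2: "(\<Sum>(x, K)\<in>B. Sup K - Inf K) < d"
      using lenD unfolding D_def using inj by (subst (asm) sum.reindex) (auto simp: \<iota>_def case_prod_beta)
    have B3: "0 \<le> (\<Sum>(x, K)\<in>B. Sup K - Inf K)" by (intro sum_nonneg) (auto simp: B_def)
    have Bp: "B \<subseteq> p" by (auto simp: B_def)
    have "\<phi> b - \<phi> a = (\<Sum>(x, K)\<in>p. \<phi> (Sup K) - \<phi> (Inf K))"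
      using additive_tagged_division_real[OF \<open>a \<le> b\<close> p(1), of \<phi>] by simp
    also have "\<dots> = (\<Sum>(x, K)\<in>p - B. \<phi> (Sup K) - \<phi> (Inf K)) + (\<Sum>(x, K)\<in>B. \<phi> (Sup K) - \<phi> (Inf K))"
      using Bp fin by (subst sum.subset_diff) auto
    also have "(\<Sum>(x, K)\<in>B. \<phi> (Sup K) - \<phi> (Inf K)) \<le> (\<Sum>(x, K)\<in>B. \<bar>\<phi> (Sup K) - \<phi> (Inf K)\<bar>)"
      by (intro sum_mono) auto
    also have "(\<Sum>(x, K)\<in>p - B. \<phi> (Sup K) - \<phi> (Inf K)) \<le> (\<Sum>(x, K)\<in>p - B. (c + e) * (Sup K - Inf K))"
    proof (intro sum_mono, clarify)
      fix x K assume xK: "(x, K) \<in> p" "(x, K) \<notin> B"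
      obtain u v where uv: "K = {u..v}" "u \<le> x" "x \<le> v" "{u..v} \<subseteq> {a..b}" "{u..v} \<subseteq> \<gamma> x" using K[OF xK(1)] by auto
      show "\<phi> (Sup K) - \<phi> (Inf K) \<le> (c + e) * (Sup K - Inf K)"
      proof (cases "x \<in> N")
        case True
        then have "u = v" using xK uv by (auto simp: B_def)
        then show ?thesis using uv by simp
      next
        case False
        moreover have "x \<in> {a..b}" using uv by auto
        ultimately have "{u..v} \<subseteq> ball x (r x)" using uv by (auto simp: \<gamma>_def)
        then show ?thesis using rb[OF \<open>x \<in> {a..b}\<close> False] uv by auto
      qed
    qed
    also have "(\<Sum>(x, K)\<in>p - B. (c + e) * (Sup K - Inf K)) =
        (c + e) * ((\<Sum>(x, K)\<in>p. Sup K - Inf K) - (\<Sum>(x, K)\<in>B. Sup K - Inf K))"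
      using Bp fin by (simp add: sum_diff case_prod_beta sum_distrib_left algebra_simps sum_subtractf)
    also have "(\<Sum>(x, K)\<in>p. Sup K - Inf K) = b - a"
      using additive_tagged_division_real[OF \<open>a \<le> b\<close> p(1), of "\<lambda>x. x"] by simp
    finally have *: "\<phi> b - \<phi> a \<le> (c + e) * (b - a - (\<Sum>(x, K)\<in>B. Sup K - Inf K)) + e"
      using B1 by linarith
    define l where "l = (\<Sum>(x, K)\<in>B. Sup K - Inf K)"
    have l: "0 \<le> l" "l \<le> e" using B2 B3 d by (auto simp: l_def)
    have "- (c * l) \<le> \<bar>c\<bar> * l" using l by (metis abs_ge_minus_self abs_mult abs_of_nonneg)
    also have "\<dots> \<le> \<bar>c\<bar> * e" using l by (intro mult_left_mono) auto
    finally have "- (c * l) \<le> \<bar>c\<bar> * e" .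
    moreover have "0 \<le> e * l" using l e by auto
    moreover have "\<phi> b - \<phi> a \<le> c * (b - a) - c * l + e * (b - a) - e * l + e"
      using * unfolding l_def[symmetric] by (simp add: algebra_simps)
    ultimately show ?thesis using e by (simp add: algebra_simps)
  qed
  show ?thesis
  proof (rule field_le_epsilon)
    fix e :: real assume "e > 0"
    have K: "2 + \<bar>c\<bar> + (b - a) > 0" using \<open>a \<le> b\<close> by linarith
    then show "\<phi> b - \<phi> a \<le> c * (b - a) + e"
      using main[of "e / (2 + \<bar>c\<bar> + (b - a))"] \<open>e > 0\<close> by simp
  qed
qed

lemma absolutely_continuous_fun_on_subset:
  assumes "absolutely_continuous_fun_on A z" "B \<subseteq> A"
  shows "absolutely_continuous_fun_on B z"
  unfolding absolutely_continuous_fun_on_def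
proof (intro allI impI)
  fix e :: real assume "e > 0"
  with assms(1) obtain d where d: "d > 0" "\<And>D. finite D \<Longrightarrow> (\<And>a b. (a, b) \<in> D \<Longrightarrow> a \<le> b \<and> {a..b} \<subseteq> A) \<Longrightarrow>
    disjoint_family_on (\<lambda>(a, b). {a<..<b}) D \<Longrightarrow> (\<Sum>(a, b)\<in>D. b - a) < d \<Longrightarrow>
    (\<Sum>(a, b)\<in>D. norm (z b - z a)) < e" by (rule absolutely_continuous_fun_onE) blast
  show "\<exists>d>0. \<forall>D. finite D \<and> (\<forall>(a, b)\<in>D. a \<le> b \<and> {a..b} \<subseteq> B) \<and>
        disjoint_family_on (\<lambda>(a, b). {a<..<b}) D \<and> (\<Sum>(a, b)\<in>D. b - a) < d \<longrightarrow>
        (\<Sum>(a, b)\<in>D. norm (z b - z a)) < e"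
    using d(1) by (intro exI[of _ d] conjI allI impI d(2)) (use assms(2) in \<open>fastforce+\<close>)
qed

text \<open>Pairing with \<open>l\<close> and subtracting a linear function reduces vector estimates
  to the scalar one: where \<open>z\<close> has derivative \<open>w\<close>, this function has
  derivative \<open>l \<bullet> (w - v)\<close>.\<close>

lemma absolutely_continuous_fun_on_inner_diff_linear:
  fixes z :: "real \<Rightarrow> 'z::real_inner"
  assumes ac: "absolutely_continuous_fun_on A z"
  shows "absolutely_continuous_fun_on A (\<lambda>s. l \<bullet> (z s - s *\<^sub>R v))"
  unfolding absolutely_continuous_fun_on_def
proof (intro allI impI)
  fix e :: real assume e: "e > 0"
  \<comment> \<open>Adding 1 keeps the divisors below positive even if \<open>l\<close> or
    \<open>v\<close> vanishes.\<close>
  define m where "m = norm l + 1"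
  define n where "n = norm v + 1"
  have m: "m > 0" and n: "n > 0" by (auto simp: m_def n_def add_nonneg_pos)
  obtain d0 where d0: "d0 > 0" and dd: "\<And>D. finite D \<Longrightarrow> (\<And>a b. (a, b) \<in> D \<Longrightarrow> a \<le> b \<and> {a..b} \<subseteq> A) \<Longrightarrow>
        disjoint_family_on (\<lambda>(a, b). {a<..<b}) D \<Longrightarrow> (\<Sum>(a, b)\<in>D. b - a) < d0 \<Longrightarrow>
        (\<Sum>(a, b)\<in>D. norm (z b - z a)) < e / (2 * m)"
    by (rule absolutely_continuous_fun_onE[OF ac, of "e / (2 * m)"]) (use e m in auto)
  show "\<exists>d>0. \<forall>D. finite D \<and> (\<forall>(a, b)\<in>D. a \<le> b \<and> {a..b} \<subseteq> A) \<and>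
        disjoint_family_on (\<lambda>(a, b). {a<..<b}) D \<and> (\<Sum>(a, b)\<in>D. b - a) < d \<longrightarrow>
        (\<Sum>(a, b)\<in>D. norm (l \<bullet> (z b - b *\<^sub>R v) - l \<bullet> (z a - a *\<^sub>R v))) < e"
  proof (intro exI[of _ "min d0 (e / (2 * (m * n)))"] conjI allI impI)
    show "0 < min d0 (e / (2 * (m * n)))" using d0 e m n by auto
    fix D assume D: "finite D \<and> (\<forall>(a, b)\<in>D. a \<le> b \<and> {a..b} \<subseteq> A) \<and>
        disjoint_family_on (\<lambda>(a, b). {a<..<b}) D \<and> (\<Sum>(a, b)\<in>D. b - a) < min d0 (e / (2 * (m * n)))"
    have z: "(\<Sum>(a, b)\<in>D. norm (z b - z a)) < e / (2 * m)" using D by (intro dd) auto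
    have "(\<Sum>(a, b)\<in>D. norm (l \<bullet> (z b - b *\<^sub>R v) - l \<bullet> (z a - a *\<^sub>R v))) \<le>
      (\<Sum>(a, b)\<in>D. m * norm (z b - z a) + m * n * (b - a))"
    proof (intro sum_mono, clarify)
      fix a b assume "(a, b) \<in> D"
      then have ab: "a \<le> b" using D by auto
      have "norm (l \<bullet> (z b - b *\<^sub>R v) - l \<bullet> (z a - a *\<^sub>R v)) = \<bar>l \<bullet> ((z b - z a) - (b - a) *\<^sub>R v)\<bar>"
        by (simp add: inner_diff_right algebra_simps)
      also have "\<dots> \<le> norm l * norm ((z b - z a) - (b - a) *\<^sub>R v)" by (rule Cauchy_Schwarz_ineq2)
      also have "\<dots> \<le> m * (norm (z b - z a) + (b - a) * n)"
      proof (intro mult_mono)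
        have "norm ((z b - z a) - (b - a) *\<^sub>R v) \<le> norm (z b - z a) + norm ((b - a) *\<^sub>R v)" by (rule norm_triangle_ineq4)
        also have "norm ((b - a) *\<^sub>R v) \<le> (b - a) * n" using ab by (simp add: n_def mult_left_mono)
        finally show "norm ((z b - z a) - (b - a) *\<^sub>R v) \<le> norm (z b - z a) + (b - a) * n" by simp
      qed (auto simp: m_def)
      finally show "norm (l \<bullet> (z b - b *\<^sub>R v) - l \<bullet> (z a - a *\<^sub>R v)) \<le> m * norm (z b - z a) + m * n * (b - a)"
        by (simp add: algebra_simps)
    qed
    also have "\<dots> = m * (\<Sum>(a, b)\<in>D. norm (z b - z a)) + m * n * (\<Sum>(a, b)\<in>D. b - a)"
      by (simp add: sum.distrib sum_distrib_left case_prod_beta)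
    also have "\<dots> < m * (e / (2 * m)) + m * n * (e / (2 * (m * n)))"
      using z D m n by (intro add_strict_mono mult_strict_left_mono) auto
    also have "\<dots> = e" using m n by simp
    finally show "(\<Sum>(a, b)\<in>D. norm (l \<bullet> (z b - b *\<^sub>R v) - l \<bullet> (z a - a *\<^sub>R v))) < e" .
  qed
qed

text \<open>A one-sided bound in a single direction survives integration in time, so velocities
  never have to be chosen measurably in \<open>s\<close> or integrated as a vector function.\<close>

lemma absolutely_continuous_inner_mean_value:
  fixes z :: "real \<Rightarrow> 'z::real_inner"
  assumes ac: "absolutely_continuous_fun_on A z" and "{a..b} \<subseteq> A" "a \<le> b"
    and deriv: "AE s in lborel. s \<in> {a<..<b} \<longrightarrow> (\<exists>v. l \<bullet> (v - v0) \<le> c \<and> (z has_vector_derivative v) (at s))"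
  shows "l \<bullet> (z b - z a - (b - a) *\<^sub>R v0) \<le> c * (b - a)"
proof -
  have "absolutely_continuous_fun_on {a..b} (\<lambda>s. l \<bullet> (z s - s *\<^sub>R v0))"
    by (rule absolutely_continuous_fun_on_subset[OF absolutely_continuous_fun_on_inner_diff_linear[OF ac] assms(2)])
  moreover have "AE s in lborel. s \<in> {a<..<b} \<longrightarrow>
      (\<exists>v\<le>c. ((\<lambda>s. l \<bullet> (z s - s *\<^sub>R v0)) has_vector_derivative v) (at s))"
    using deriv
  proof eventually_elim
    case (elim s)
    show ?case
    proof
      assume "s \<in> {a<..<b}"
      then obtain v where v: "l \<bullet> (v - v0) \<le> c" "(z has_vector_derivative v) (at s)" using elim by auto
      have "((\<lambda>s. l \<bullet> (z s - s *\<^sub>R v0)) has_vector_derivative l \<bullet> (v - v0)) (at s)"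
        by (intro bounded_linear.has_vector_derivative[OF bounded_linear_inner_right])
          (auto intro!: derivative_eq_intros v(2))
      then show "\<exists>v\<le>c. ((\<lambda>s. l \<bullet> (z s - s *\<^sub>R v0)) has_vector_derivative v) (at s)" using v by blast
    qed
  qed
  ultimately have "l \<bullet> (z b - b *\<^sub>R v0) - l \<bullet> (z a - a *\<^sub>R v0) \<le> c * (b - a)"
    using \<open>a \<le> b\<close> by (intro absolutely_continuous_mean_value_le)
  then show ?thesis by (simp add: inner_diff_right algebra_simps)
qed

lemma absolutely_continuous_norm_mean_value:
  fixes z :: "real \<Rightarrow> 'z::real_inner"
  assumes ac: "absolutely_continuous_fun_on A z" and ab: "{a..b} \<subseteq> A" "a \<le> b" and c: "c \<ge> 0"
    and deriv: "AE s in lborel. s \<in> {a<..<b} \<longrightarrow> (\<exists>v. norm (v - v0) \<le> c \<and> (z has_vector_derivative v) (at s))"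
  shows "norm (z b - z a - (b - a) *\<^sub>R v0) \<le> c * (b - a)"
proof -
  \<comment> \<open>The direction is the error vector itself: pairing it with itself gives its
    squared norm, and Cauchy-Schwarz bounds the other side.\<close>
  define d where "d = z b - z a - (b - a) *\<^sub>R v0"
  have "d \<bullet> (z b - z a - (b - a) *\<^sub>R v0) \<le> (norm d * c) * (b - a)"
  proof (rule absolutely_continuous_inner_mean_value[OF ac ab])
    show "AE s in lborel. s \<in> {a<..<b} \<longrightarrow> (\<exists>v. d \<bullet> (v - v0) \<le> norm d * c \<and> (z has_vector_derivative v) (at s))"
      using deriv
    proof eventually_elim
      case (elim s)
      have "d \<bullet> (v - v0) \<le> norm d * c" if "norm (v - v0) \<le> c" for v
        by (rule order_trans[OF norm_cauchy_schwarz]) (intro mult_left_mono that norm_ge_zero)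
      then show ?case using elim by blast
    qed
  qed
  then have "norm d * norm d \<le> norm d * (c * (b - a))"
    unfolding d_def[symmetric] by (simp add: power2_norm_eq_inner[symmetric] power2_eq_square mult.assoc)
  then have "norm d \<le> c * (b - a) \<or> norm d = 0" by (auto simp: mult_le_cancel_left)
  then show ?thesis using c ab unfolding d_def by auto
qed

text \<open>Settles the case without stationary measures: the unit interval has positive measure, so
  the inclusion with empty right-hand side has no solution and the theorem holds vacuously.\<close>

lemma empty_inclusion_has_no_solution:
  assumes "inclusion_solution (\<lambda>_ _. {}) z0 z"
  shows False
proof -
  have "AE s in lborel. s \<notin> {0..1::real}" using assms by (auto simp: inclusion_solution_def)
  then have "emeasure lborel {0..1::real} = 0" by (subst (asm) AE_iff_measurable[of "{0..1}"]) auto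
  then show False by simp
qed

section \<open>Discrete Gronwall inequality and assembly of the error function\<close>

text \<open>The bound is linear in the values of \<open>A\<close> with nonnegative coefficients, so
  it can be applied to each noise sequence separately and integrated afterwards, when only the means
  of \<open>A\<close> are known to be small.\<close>

lemma discrete_gronwall:
  fixes x A :: "nat \<Rightarrow> real"
  assumes c: "c \<ge> 0" and x: "\<And>k. k \<le> N \<Longrightarrow> x k \<le> A k + c * (\<Sum>i<k. x i)"
    and A: "\<And>k. k \<le> N \<Longrightarrow> 0 \<le> A k" and k: "k \<le> N"
  shows "x k \<le> A k + c * ((1 + c) ^ k * (\<Sum>i<k. A i))"
proof -
  \<comment> \<open>The partial sums obey a plain one-step recursion, unlike \<open>x\<close>
    itself.\<close>
  have S: "(\<Sum>i<k. x i) \<le> (1 + c) ^ k * (\<Sum>i<k. A i)" if "k \<le> N" for k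
    using that
  proof (induction k)
    case 0
    then show ?case by simp
  next
    case (Suc k)
    have "(\<Sum>i<Suc k. x i) \<le> (\<Sum>i<k. x i) + (A k + c * (\<Sum>i<k. x i))"
      using x[of k] Suc.prems by simp
    also have "\<dots> = (1 + c) * (\<Sum>i<k. x i) + A k" by (simp add: algebra_simps)
    also have "\<dots> \<le> (1 + c) * ((1 + c) ^ k * (\<Sum>i<k. A i)) + (1 + c) ^ Suc k * A k"
    proof (intro add_mono mult_left_mono Suc.IH)
      show "A k \<le> (1 + c) ^ Suc k * A k"
        using mult_right_mono[OF one_le_power[of "1 + c" "Suc k"] A[of k]] c Suc.prems by simp
    qed (use c Suc.prems in auto)
    also have "\<dots> = (1 + c) ^ Suc k * (\<Sum>i<Suc k. A i)" by (simp add: algebra_simps)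
    finally show ?case .
  qed
  have "x k \<le> A k + c * (\<Sum>i<k. x i)" by (rule x[OF k])
  also have "\<dots> \<le> A k + c * ((1 + c) ^ k * (\<Sum>i<k. A i))"
    using S[OF k] c by (intro add_left_mono mult_left_mono)
  finally show ?thesis .
qed

text \<open>The infimum of the admissible bounds is the natural envelope; it need not be admissible
  itself, so \<open>\<epsilon>\<close> is added, which disappears in the limit.\<close>

lemma limit_envelope:
  fixes good :: "real \<Rightarrow> real \<Rightarrow> bool"
  assumes ex: "\<And>\<epsilon>. \<epsilon> > 0 \<Longrightarrow> \<exists>b\<ge>0. good \<epsilon> b"
    and lim: "\<And>\<eta>. \<eta> > 0 \<Longrightarrow> \<exists>\<epsilon>0>0. \<forall>\<epsilon>. 0 < \<epsilon> \<and> \<epsilon> < \<epsilon>0 \<longrightarrow> good \<epsilon> \<eta>"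
    and mono: "\<And>\<epsilon> b b'. good \<epsilon> b \<Longrightarrow> b \<le> b' \<Longrightarrow> good \<epsilon> b'"
  shows "\<exists>\<psi>. (\<psi> \<longlongrightarrow> 0) (at_right 0) \<and> (\<forall>\<epsilon>>0. good \<epsilon> (\<psi> \<epsilon>))"
proof -
  define I where "I \<epsilon> = Inf {b. 0 \<le> b \<and> good \<epsilon> b}" for \<epsilon>
  have bdd: "bdd_below {b. 0 \<le> b \<and> good \<epsilon> b}" for \<epsilon> by (auto intro: bdd_belowI[of _ 0])
  have I0: "0 \<le> I \<epsilon>" if "\<epsilon> > 0" for \<epsilon>
    unfolding I_def using ex[OF that] by (intro cInf_greatest) auto
  have "good \<epsilon> (I \<epsilon> + \<epsilon>)" if "\<epsilon> > 0" for \<epsilon>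
  proof -
    have "Inf {b. 0 \<le> b \<and> good \<epsilon> b} < I \<epsilon> + \<epsilon>" using that by (simp add: I_def)
    moreover have "{b. 0 \<le> b \<and> good \<epsilon> b} \<noteq> {}" using ex[OF \<open>\<epsilon> > 0\<close>] by auto
    ultimately obtain b where "good \<epsilon> b" "b < I \<epsilon> + \<epsilon>" by (metis (no_types, lifting) cInf_lessD mem_Collect_eq)
    then show ?thesis using mono by force
  qed
  moreover have "((\<lambda>\<epsilon>. I \<epsilon> + \<epsilon>) \<longlongrightarrow> 0) (at_right 0)"
  proof (rule tendstoI)
    fix e :: real assume e: "e > 0"
    then obtain \<epsilon>0 where \<epsilon>0: "\<epsilon>0 > 0" "\<And>\<epsilon>. 0 < \<epsilon> \<Longrightarrow> \<epsilon> < \<epsilon>0 \<Longrightarrow> good \<epsilon> (e / 2)"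
      using lim[of "e / 2"] by auto
    have "\<forall>\<^sub>F \<epsilon> in at_right 0. \<epsilon> \<in> {0<..<min \<epsilon>0 (e / 2)}"
      by (rule eventually_at_right_real) (use e \<epsilon>0 in auto)
    then show "\<forall>\<^sub>F \<epsilon> in at_right 0. dist (I \<epsilon> + \<epsilon>) 0 < e"
    proof eventually_elim
      case (elim \<epsilon>)
      then have "I \<epsilon> \<le> e / 2" unfolding I_def using e \<epsilon>0 by (intro cInf_lower bdd) auto
      then show ?case using I0[of \<epsilon>] elim by (auto simp: dist_real_def)
    qed
  qed
  ultimately show ?thesis by blast
qed

section \<open>Measurability and selection\<close>

lemma compact_finite_net:
  fixes K :: "'a::metric_space set"
  assumes "compact K" "r > 0"
  obtains k where "finite k" "k \<subseteq> K" "K \<subseteq> (\<Union>x\<in>k. ball x r)"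
proof -
  have "K \<subseteq> (\<Union>x\<in>K. ball x r)" using assms(2) by force
  then obtain k where "k \<subseteq> K" "finite k" "K \<subseteq> (\<Union>x\<in>k. ball x r)"
    by (rule compactE_image[OF assms(1), rotated]) auto
  then show thesis by (intro that)
qed

text \<open>
  Without second countability of the two spaces, the Borel sigma-algebra of the product is not the
  product sigma-algebra in general; compactness supplies countably many rectangles.
\<close>

lemma measurable_Pair_compact:
  fixes A :: "'a::metric_space set" and B :: "'b::metric_space set"
  assumes "compact A" "compact B"
    and a: "a \<in> M \<rightarrow>\<^sub>M borel_on A" and b: "b \<in> M \<rightarrow>\<^sub>M borel_on B"
  shows "(\<lambda>x. (a x, b x)) \<in> M \<rightarrow>\<^sub>M borel_on (A \<times> B)"
proof (rule measurable_restrict_space2)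
  have aA: "a x \<in> A" and bB: "b x \<in> B" if "x \<in> space M" for x
    using measurable_space[OF a that] measurable_space[OF b that] by (auto simp: space_restrict_space)
  show "(\<lambda>x. (a x, b x)) \<in> space M \<rightarrow> A \<times> B" using aA bB by auto
  have a': "a \<in> borel_measurable M" and b': "b \<in> borel_measurable M"
    using a b by (auto simp: measurable_restrict_space2_iff)
  define r :: "nat \<Rightarrow> real" where "r n = 1 / real (Suc n)" for n
  have r: "r n > 0" for n by (simp add: r_def)
  have "\<exists>k. finite k \<and> k \<subseteq> A \<and> A \<subseteq> (\<Union>x\<in>k. ball x (r n))" for n
    using compact_finite_net[OF assms(1) r[of n]] by metis
  then obtain kA where kA: "\<And>n. finite (kA n)" "\<And>n. A \<subseteq> (\<Union>x\<in>kA n. ball x (r n))" by metis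
  have "\<exists>k. finite k \<and> k \<subseteq> B \<and> B \<subseteq> (\<Union>x\<in>k. ball x (r n))" for n
    using compact_finite_net[OF assms(2) r[of n]] by metis
  then obtain kB where kB: "\<And>n. finite (kB n)" "\<And>n. B \<subseteq> (\<Union>x\<in>kB n. ball x (r n))" by metis
  show "(\<lambda>x. (a x, b x)) \<in> borel_measurable M"
  proof (rule borel_measurableI)
    fix W :: "('a \<times> 'b) set" assume W: "open W"
    define I where "I = (SIGMA n:UNIV. {p \<in> kA n \<times> kB n. ball (fst p) (r n) \<times> ball (snd p) (r n) \<subseteq> W})"
    have "countable (SIGMA n:UNIV. kA n \<times> kB n)"
      by (intro countable_SIGMA countableI_type countable_finite finite_cartesian_product kA kB)
    then have "countable I" by (rule countable_subset[rotated]) (auto simp: I_def)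
    define R where "R = (\<lambda>(n, x, y). (a -` ball x (r n) \<inter> space M) \<inter> (b -` ball y (r n) \<inter> space M))"
    have "(\<lambda>x. (a x, b x)) -` W \<inter> space M = (\<Union>i\<in>I. R i)"
    proof (intro equalityI subsetI)
      fix x assume x: "x \<in> (\<lambda>x. (a x, b x)) -` W \<inter> space M"
      then have xW: "(a x, b x) \<in> W" and xM: "x \<in> space M" by auto
      obtain V1 V2 where V: "open V1" "open V2" "(a x, b x) \<in> V1 \<times> V2" "V1 \<times> V2 \<subseteq> W"
        using open_prod_elim[OF W xW] by metis
      obtain e1 where e1: "e1 > 0" "ball (a x) e1 \<subseteq> V1" using V by (meson mem_Sigma_iff openE)
      obtain e2 where e2: "e2 > 0" "ball (b x) e2 \<subseteq> V2" using V by (meson mem_Sigma_iff openE)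
      \<comment> \<open>Half of the smaller radius: a ball of radius \<open>r n\<close> containing
        the point then lies in the ball of radius \<open>e1\<close> or \<open>e2\<close> around the
        point.\<close>
      obtain n where n: "r n < min e1 e2 / 2"
        using reals_Archimedean[of "min e1 e2 / 2"] e1 e2 by (auto simp: r_def inverse_eq_divide)
      obtain p where p: "p \<in> kA n" "a x \<in> ball p (r n)" using kA(2)[of n] aA[OF xM] by auto
      obtain q where q: "q \<in> kB n" "b x \<in> ball q (r n)" using kB(2)[of n] bB[OF xM] by auto
      have "ball p (r n) \<subseteq> V1"
      proof
        fix y assume "y \<in> ball p (r n)"
        then have "dist (a x) y < e1" using p n dist_triangle2[of "a x" y p] by (auto simp: dist_commute)
        then show "y \<in> V1" using e1 by auto
      qed
      moreover have "ball q (r n) \<subseteq> V2"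
      proof
        fix y assume "y \<in> ball q (r n)"
        then have "dist (b x) y < e2" using q n dist_triangle2[of "b x" y q] by (auto simp: dist_commute)
        then show "y \<in> V2" using e2 by auto
      qed
      ultimately have "(n, p, q) \<in> I" using V p q by (auto simp: I_def)
      then show "x \<in> (\<Union>i\<in>I. R i)" using p q xM by (auto simp: R_def intro!: bexI[of _ "(n, p, q)"])
    next
      fix x assume "x \<in> (\<Union>i\<in>I. R i)"
      then show "x \<in> (\<lambda>x. (a x, b x)) -` W \<inter> space M" by (fastforce simp: R_def I_def)
    qed
    also have "\<dots> \<in> sets M"
    proof (rule sets.countable_UN''[OF \<open>countable I\<close>])
      show "R i \<in> sets M" for i
        unfolding R_def by (cases i) (auto intro!: sets.Int measurable_sets[OF a'] measurable_sets[OF b'])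
    qed
    finally show "(\<lambda>x. (a x, b x)) -` W \<inter> space M \<in> sets M" .
  qed
qed

text \<open>Points of one small ball can share a parameter at the cost \<open>e\<close> of
  equicontinuity, and finitely many balls cover \<open>X\<close>. The selection returns a natural
  number, decoded by \<open>\<rho>\<close>, because the parameters will be plans, which carry no
  sigma-algebra here.\<close>

lemma finite_measurable_selection:
  fixes J :: "'a::metric_space \<Rightarrow> 'p \<Rightarrow> real"
  assumes X: "compact X"
    and equi: "\<exists>r>0. \<forall>x\<in>X. \<forall>x'\<in>X. dist x x' < r \<longrightarrow> (\<forall>p\<in>A. \<bar>J x p - J x' p\<bar> \<le> e)"
    and ex: "\<And>x. x \<in> X \<Longrightarrow> \<exists>p\<in>A. c \<le> J x p" and A: "A \<noteq> {}"
  obtains idx :: "'a \<Rightarrow> nat" and \<rho> where "idx \<in> borel \<rightarrow>\<^sub>M count_space UNIV"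
    "\<And>i. \<rho> i \<in> A" "\<And>x. x \<in> X \<Longrightarrow> c - e \<le> J x (\<rho> (idx x))"
proof -
  obtain r where r: "r > 0" and rJ: "\<And>x x' p. x \<in> X \<Longrightarrow> x' \<in> X \<Longrightarrow> dist x x' < r \<Longrightarrow> p \<in> A \<Longrightarrow> \<bar>J x p - J x' p\<bar> \<le> e"
    using equi by auto
  obtain k where k: "finite k" "k \<subseteq> X" "X \<subseteq> (\<Union>x\<in>k. ball x r)" using compact_finite_net[OF X r] .
  obtain xs where xs: "set xs = k" using finite_list[OF k(1)] by auto
  obtain a where a: "a \<in> A" using A by auto
  have "\<forall>x. \<exists>p. p \<in> A \<and> (x \<in> X \<longrightarrow> c \<le> J x p)" using ex a by blast
  then obtain sel where sel: "\<And>x. sel x \<in> A" "\<And>x. x \<in> X \<Longrightarrow> c \<le> J x (sel x)" by metis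
  \<comment> \<open>The first disjunct caps the search, as \<open>xs ! i\<close> is unspecified
    beyond the end of the list; for points of \<open>X\<close> a ball is found earlier.\<close>
  define idx where "idx x = (LEAST i. length xs \<le> i \<or> x \<in> ball (xs ! i) r)" for x
  have 1: "idx \<in> borel \<rightarrow>\<^sub>M count_space UNIV"
  proof -
    have "(\<lambda>x. x \<in> ball (xs ! i) r) \<in> borel \<rightarrow>\<^sub>M count_space UNIV" for i
      using pred_sets2[of "ball (xs ! i) r" borel "\<lambda>x. x" borel] by simp
    then show ?thesis unfolding idx_def by (intro measurable_Least pred_intros_logic(5)) auto
  qed
  show thesis
  proof (rule that[OF 1, of "\<lambda>i. sel (xs ! i)"])
    show "sel (xs ! i) \<in> A" for i by (rule sel)
    fix x assume x: "x \<in> X"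
    then obtain y where y: "y \<in> set xs" "x \<in> ball y r" using k xs by auto
    then obtain i where i: "i < length xs" "y = xs ! i" by (auto simp: in_set_conv_nth)
    have le: "idx x \<le> i" unfolding idx_def by (rule Least_le) (use i y in auto)
    have "length xs \<le> idx x \<or> x \<in> ball (xs ! idx x) r" unfolding idx_def
      by (rule LeastI[of _ i]) (use i y in auto)
    then have h: "x \<in> ball (xs ! idx x) r" "xs ! idx x \<in> X" using le i k xs by auto
    have "c \<le> J (xs ! idx x) (sel (xs ! idx x))" by (rule sel(2)[OF h(2)])
    moreover have "\<bar>J (xs ! idx x) (sel (xs ! idx x)) - J x (sel (xs ! idx x))\<bar> \<le> e"
      using h by (intro rJ x sel) auto
    ultimately show "c - e \<le> J x (sel (xs ! idx x))" by linarith
  qed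
qed

text \<open>Stands in for conditional expectation given the first \<open>n\<close> noise values:
  \<open>comb_seq n w w'\<close> keeps these from \<open>w\<close> and continues with an independent
  copy \<open>w'\<close>, without changing the law.\<close>

lemma (in sequence_space) integral_comb_seq:
  fixes F :: "(nat \<Rightarrow> 'a) \<Rightarrow> real"
  assumes F [measurable]: "F \<in> borel_measurable S" and B: "\<And>w. w \<in> space S \<Longrightarrow> \<bar>F w\<bar> \<le> B"
  shows "integrable S (\<lambda>w. \<integral>w'. F (comb_seq n w w') \<partial>S)"
    and "integral\<^sup>L S F = (\<integral>w. \<integral>w'. F (comb_seq n w w') \<partial>S \<partial>S)"
proof -
  interpret PP: pair_prob_space S S ..
  have sp: "comb_seq n w w' \<in> space S" if "w \<in> space S" "w' \<in> space S" for w w'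
    using that by (auto simp: space_PiM PiE_iff comb_seq_def)
  have int: "integrable (S \<Otimes>\<^sub>M S) (\<lambda>p. F (comb_seq n (fst p) (snd p)))"
    by (rule PP.integrable_const_bound[where B = B]) (auto simp: space_pair_measure B sp)
  show "integrable S (\<lambda>w. \<integral>w'. F (comb_seq n w w') \<partial>S)"
    using PP.integrable_fst'[OF int] by simp
  have "integral\<^sup>L S F = integral\<^sup>L (distr (S \<Otimes>\<^sub>M S) S (\<lambda>(w, w'). comb_seq n w w')) F"
    by (simp add: PiM_comb_seq)
  also have "\<dots> = (\<integral>p. F (comb_seq n (fst p) (snd p)) \<partial>(S \<Otimes>\<^sub>M S))"
    by (subst integral_distr[OF measurable_comb_seq F]) (simp add: case_prod_beta)
  also have "\<dots> = (\<integral>w. \<integral>w'. F (comb_seq n w w') \<partial>S \<partial>S)"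
    using PP.integral_fst'[OF int] by simp
  finally show "integral\<^sup>L S F = (\<integral>w. \<integral>w'. F (comb_seq n w w') \<partial>S \<partial>S)" .
qed

section \<open>Controlled systems and concatenation of plans\<close>

text \<open>Everything is done for the canonical noise sequence with product law \<open>P\<close>;
  the given probability space returns only in the theorem, by a change of variables.\<close>

locale controlled_system =
  fixes Y :: "'y::metric_space set" and U :: "'u::metric_space set" and S :: "'s::metric_space set"
    and f :: "'y \<times> 'u \<times> 's \<Rightarrow> 'y" and \<mu> :: "'s measure"
  assumes compact_Y: "compact Y" and compact_U: "compact U" and compact_S: "compact S"
    and U_nonempty: "U \<noteq> {}"
    and f_cont: "continuous_on (Y \<times> U \<times> S) f"
    and f_invariant: "\<And>y u s. y \<in> Y \<Longrightarrow> u \<in> U \<Longrightarrow> s \<in> S \<Longrightarrow> f (y, u, s) \<in> Y"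
    and prob_mu: "prob_space \<mu>" and sets_mu: "sets \<mu> = sets (borel_on S)"
begin

abbreviation "plans \<equiv> control_plans U S UNIV"
abbreviation "history I \<equiv> PiM I (\<lambda>_::nat. borel_on S)"
abbreviation "P \<equiv> PiM UNIV (\<lambda>_::nat. \<mu>)"

lemma space_mu: "space \<mu> = S"
  using sets_eq_imp_space_eq[OF sets_mu] by (simp add: space_restrict_space)

lemma noise_space: "sequence_space \<mu>"
  unfolding sequence_space_def product_prob_space_def product_sigma_finite_def product_prob_space_axioms_def
  using prob_mu prob_space_imp_sigma_finite by auto

lemmas integral_P_split = sequence_space.integral_comb_seq[OF noise_space]

lemma distr_P_component: "distr P \<mu> (\<lambda>w. w k) = \<mu>"
  using product_prob_space.PiM_component[OF sequence_space.axioms[OF noise_space], of k] by simp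

lemma prob_P: "prob_space P"
  by (intro prob_space_PiM prob_mu)

lemma space_P: "space P = {w. \<forall>k. w k \<in> S}"
  by (auto simp: space_PiM space_mu PiE_iff)

lemma space_history: "space (history I) = (\<Pi>\<^sub>E i\<in>I. S)"
  by (simp add: space_PiM space_restrict_space)

lemma sets_P: "sets P = sets (history UNIV)"
  by (intro sets_PiM_cong) (auto simp: sets_mu)

lemma measurable_P: "measurable P N = measurable (history UNIV) N"
  by (intro measurable_cong_sets sets_P refl)

lemma plan_measurable: "\<pi> \<in> plans \<Longrightarrow> \<pi> t \<in> history {..<t} \<rightarrow>\<^sub>M borel_on U"
  by (auto simp: control_plans_def)

text \<open>The index set is left open since the same facts serve the whole noise sequence and the
  finite histories that a plan may read.\<close>

lemma control_measurable:
  assumes "\<pi> \<in> plans" "{..<t} \<subseteq> I"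
  shows "(\<lambda>w. control \<pi> w t) \<in> history I \<rightarrow>\<^sub>M borel_on U"
  unfolding control_def
  by (rule measurable_compose[OF measurable_restrict_subset[OF assms(2)] plan_measurable[OF assms(1)]])

lemma control_in: "\<pi> \<in> plans \<Longrightarrow> (\<And>k. k < t \<Longrightarrow> w k \<in> S) \<Longrightarrow> control \<pi> w t \<in> U"
  using measurable_space[OF plan_measurable[of \<pi> t], of "restrict w {..<t}"]
  by (auto simp: control_def space_history space_restrict_space)

lemma state_in: "\<pi> \<in> plans \<Longrightarrow> y \<in> Y \<Longrightarrow> (\<And>k. k < t \<Longrightarrow> w k \<in> S) \<Longrightarrow> state f y \<pi> w t \<in> Y"
  by (induction t) (auto intro!: f_invariant control_in)

lemma state_measurable:
  assumes "\<pi> \<in> plans" "y \<in> Y" "{..<t} \<subseteq> I"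
  shows "(\<lambda>w. state f y \<pi> w t) \<in> history I \<rightarrow>\<^sub>M borel_on Y"
  using assms(3)
proof (induction t)
  case 0
  then show ?case using assms by (auto intro!: measurable_const simp: space_restrict_space)
next
  case (Suc t)
  have sub: "{..<t} \<subseteq> I" "t \<in> I" using Suc by auto
  have "(\<lambda>w. (state f y \<pi> w t, control \<pi> w t, w t)) \<in> history I \<rightarrow>\<^sub>M borel_on (Y \<times> U \<times> S)"
    by (intro measurable_Pair_compact compact_Times compact_Y compact_U compact_S Suc.IH sub
        control_measurable assms measurable_component_singleton)
  moreover have "f \<in> borel_on (Y \<times> U \<times> S) \<rightarrow>\<^sub>M borel_on Y"
    by (intro measurable_restrict_space2 borel_measurable_continuous_on_restrict f_cont)
      (auto simp: space_restrict_space f_invariant)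
  ultimately have "(\<lambda>w. f (state f y \<pi> w t, control \<pi> w t, w t)) \<in> history I \<rightarrow>\<^sub>M borel_on Y"
    by (rule measurable_compose)
  then show ?case by simp
qed

lemma trajectory_measurable:
  fixes \<phi> :: "'y \<times> 'u \<Rightarrow> 'b::topological_space"
  assumes "\<pi> \<in> plans" "y \<in> Y" "{..<t} \<subseteq> I" "continuous_on (Y \<times> U) \<phi>"
  shows "(\<lambda>w. \<phi> (state f y \<pi> w t, control \<pi> w t)) \<in> borel_measurable (history I)"
  by (rule measurable_compose[OF measurable_Pair_compact[OF compact_Y compact_U
      state_measurable[OF assms(1-3)] control_measurable[OF assms(1,3)]]
      borel_measurable_continuous_on_restrict[OF assms(4)]])

lemma control_cong: "(\<And>k. k < t \<Longrightarrow> w k = w' k) \<Longrightarrow> control \<pi> w t = control \<pi> w' t"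
  unfolding control_def by (intro arg_cong[of _ _ "\<pi> t"] restrict_ext) auto

lemma state_cong: "(\<And>k. k < t \<Longrightarrow> w k = w' k) \<Longrightarrow> state f y \<pi> w t = state f y \<pi> w' t"
proof (induction t)
  case (Suc t)
  then show ?case using control_cong[of t w w' \<pi>] by simp
qed simp

text \<open>Feedback in open-loop form: at time \<open>n\<close> the history selects an index, and
  the plan with this index runs as from time 0 on the shifted noise. Since the index ranges over a
  countable type, measurability can be checked for each continuation separately.\<close>

definition concat_plan ::
  "nat \<Rightarrow> (nat \<Rightarrow> (nat \<Rightarrow> 's) \<Rightarrow> 'u) \<Rightarrow> ((nat \<Rightarrow> 's) \<Rightarrow> nat) \<Rightarrow> (nat \<Rightarrow> nat \<Rightarrow> (nat \<Rightarrow> 's) \<Rightarrow> 'u) \<Rightarrow>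
    nat \<Rightarrow> (nat \<Rightarrow> 's) \<Rightarrow> 'u" where
  "concat_plan n \<pi> idx \<rho> t v =
    (if t < n then \<pi> t v
     else \<rho> (idx (restrict v {..<n})) (t - n) (restrict (\<lambda>i. v (n + i)) {..<t - n}))"

lemma concat_plan_in:
  assumes "\<pi> \<in> plans" "\<And>i. \<rho> i \<in> plans" "idx \<in> history {..<n} \<rightarrow>\<^sub>M count_space UNIV"
  shows "concat_plan n \<pi> idx \<rho> \<in> plans"
  unfolding control_plans_def
proof (intro CollectI ballI)
  fix t :: nat
  show "concat_plan n \<pi> idx \<rho> t \<in> history {..<t} \<rightarrow>\<^sub>M borel_on U"
  proof (cases "t < n")
    case True
    then have "concat_plan n \<pi> idx \<rho> t = \<pi> t" by (auto simp: concat_plan_def)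
    then show ?thesis using plan_measurable[OF assms(1)] by simp
  next
    case False
    have idx: "(\<lambda>v. idx (restrict v {..<n})) \<in> history {..<t} \<rightarrow>\<^sub>M count_space UNIV"
      using False by (intro measurable_compose[OF measurable_restrict_subset assms(3)]) auto
    have sh: "(\<lambda>v. restrict (\<lambda>i. v (n + i)) {..<t - n}) \<in> history {..<t} \<rightarrow>\<^sub>M history {..<t - n}"
      by (intro measurable_restrict measurable_component_singleton) auto
    have "(\<lambda>v. \<rho> (idx (restrict v {..<n})) (t - n) (restrict (\<lambda>i. v (n + i)) {..<t - n})) \<in>
        history {..<t} \<rightarrow>\<^sub>M borel_on U"
      by (rule measurable_compose_countable[OF _ idx])
        (rule measurable_compose[OF sh plan_measurable[OF assms(2)]])
    moreover have "concat_plan n \<pi> idx \<rho> t =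
        (\<lambda>v. \<rho> (idx (restrict v {..<n})) (t - n) (restrict (\<lambda>i. v (n + i)) {..<t - n}))"
      using False by (auto simp: concat_plan_def)
    ultimately show ?thesis by simp
  qed
qed

lemma control_concat_less: "t < n \<Longrightarrow> control (concat_plan n \<pi> idx \<rho>) w t = control \<pi> w t"
  by (simp add: control_def concat_plan_def)

lemma state_concat_le: "t \<le> n \<Longrightarrow> state f y (concat_plan n \<pi> idx \<rho>) w t = state f y \<pi> w t"
  by (induction t) (auto simp: control_concat_less)

lemma control_concat_add:
  "control (concat_plan n \<pi> idx \<rho>) w (n + t) = control (\<rho> (idx (restrict w {..<n}))) (\<lambda>i. w (n + i)) t"
proof -
  have 1: "restrict (restrict w {..<n + t}) {..<n} = restrict w {..<n}"
    by (auto simp: restrict_def fun_eq_iff)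
  have 2: "restrict (\<lambda>i. restrict w {..<n + t} (n + i)) {..<t} = restrict (\<lambda>i. w (n + i)) {..<t}"
    by (auto simp: restrict_def fun_eq_iff)
  show ?thesis unfolding control_def concat_plan_def 1 by (simp only: 2 add_diff_cancel_left') simp
qed

lemma state_concat_add:
  "state f y (concat_plan n \<pi> idx \<rho>) w (n + t) =
    state f (state f y \<pi> w n) (\<rho> (idx (restrict w {..<n}))) (\<lambda>i. w (n + i)) t"
proof -
  define \<rho>' where "\<rho>' = \<rho> (idx (restrict w {..<n}))"
  show ?thesis unfolding \<rho>'_def[symmetric]
    by (induction t) (simp_all add: state_concat_le control_concat_add \<rho>'_def[symmetric])
qed

section \<open>Expected rewards and their dependence on the initial state\<close>

definition total_reward :: "nat \<Rightarrow> ('y \<times> 'u \<Rightarrow> real) \<Rightarrow> 'y \<Rightarrow> (nat \<Rightarrow> (nat \<Rightarrow> 's) \<Rightarrow> 'u) \<Rightarrow> real" where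
  "total_reward k \<phi> y \<pi> = (\<integral>w. (\<Sum>t<k. \<phi> (state f y \<pi> w t, control \<pi> w t)) \<partial>P)"

lemma trajectory_in:
  assumes "\<pi> \<in> plans" "y \<in> Y" "w \<in> space P"
  shows "(state f y \<pi> w t, control \<pi> w t) \<in> Y \<times> U"
  using assms by (auto simp: space_P intro!: state_in control_in)

lemma trajectory_integrable:
  fixes \<phi> :: "'y \<times> 'u \<Rightarrow> real"
  assumes "\<pi> \<in> plans" "y \<in> Y" "continuous_on (Y \<times> U) \<phi>"
  shows "integrable P (\<lambda>w. \<phi> (state f y \<pi> w t, control \<pi> w t))"
proof -
  interpret prob_space P by (rule prob_P)
  have "compact (\<phi> ` (Y \<times> U))" by (intro compact_continuous_image assms compact_Times compact_Y compact_U)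
  then obtain B where B: "\<And>x. x \<in> Y \<times> U \<Longrightarrow> norm (\<phi> x) \<le> B"
    unfolding bounded_iff by (meson bounded_iff compact_imp_bounded imageI)
  show ?thesis
  proof (rule integrable_const_bound)
    show "AE w in P. norm (\<phi> (state f y \<pi> w t, control \<pi> w t)) \<le> B"
      using trajectory_in[OF assms(1,2)] by (intro AE_I2 B) blast
    show "(\<lambda>w. \<phi> (state f y \<pi> w t, control \<pi> w t)) \<in> borel_measurable P"
      unfolding measurable_P by (rule trajectory_measurable) (use assms in auto)
  qed
qed

text \<open>Reward, state and plan may all differ between the two sides, so that perturbations of
  the reward, of the initial state and of both at once are instances.\<close>

lemma total_reward_mono:
  assumes "\<pi> \<in> plans" "y \<in> Y" "continuous_on (Y \<times> U) \<phi>"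
    "\<pi>' \<in> plans" "y' \<in> Y" "continuous_on (Y \<times> U) \<phi>'"
    and le: "\<And>w t. w \<in> space P \<Longrightarrow> t < k \<Longrightarrow>
      \<phi> (state f y \<pi> w t, control \<pi> w t) \<le> \<phi>' (state f y' \<pi>' w t, control \<pi>' w t) + e"
  shows "total_reward k \<phi> y \<pi> \<le> total_reward k \<phi>' y' \<pi>' + real k * e"
proof -
  interpret prob_space P by (rule prob_P)
  have "total_reward k \<phi> y \<pi> \<le> (\<integral>w. (\<Sum>t<k. \<phi>' (state f y' \<pi>' w t, control \<pi>' w t)) + real k * e \<partial>P)"
    unfolding total_reward_def
  proof (rule integral_mono)
    show "integrable P (\<lambda>w. \<Sum>t<k. \<phi> (state f y \<pi> w t, control \<pi> w t))"
      by (intro Bochner_Integration.integrable_sum trajectory_integrable assms)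
    have "integrable P (\<lambda>w. \<Sum>t<k. \<phi>' (state f y' \<pi>' w t, control \<pi>' w t))"
      by (intro Bochner_Integration.integrable_sum trajectory_integrable assms)
    then show "integrable P (\<lambda>w. (\<Sum>t<k. \<phi>' (state f y' \<pi>' w t, control \<pi>' w t)) + real k * e)"
      by (intro Bochner_Integration.integrable_add integrable_const)
    fix w assume "w \<in> space P"
    then have "(\<Sum>t<k. \<phi> (state f y \<pi> w t, control \<pi> w t)) \<le> (\<Sum>t<k. \<phi>' (state f y' \<pi>' w t, control \<pi>' w t) + e)"
      by (intro sum_mono le) auto
    then show "(\<Sum>t<k. \<phi> (state f y \<pi> w t, control \<pi> w t)) \<le>
        (\<Sum>t<k. \<phi>' (state f y' \<pi>' w t, control \<pi>' w t)) + real k * e" by (simp add: sum.distrib)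
  qed
  also have "\<dots> = total_reward k \<phi>' y' \<pi>' + real k * e"
    unfolding total_reward_def
    by (subst Bochner_Integration.integral_add)
      (auto intro!: Bochner_Integration.integrable_sum trajectory_integrable assms simp: prob_space)
  finally show ?thesis .
qed

text \<open>The radius is uniform over plans and noise because plans are open-loop: from either
  initial state the same controls and the same noise are applied, so the uniform continuity of
  \<open>f\<close> can be iterated. Discontinuity of the plans does no harm.\<close>

lemma state_equicontinuous:
  assumes "d > 0"
  shows "\<exists>r>0. \<forall>y\<in>Y. \<forall>y'\<in>Y. dist y y' < r \<longrightarrow> (\<forall>\<pi>\<in>plans. \<forall>w\<in>space P. \<forall>t<k.
    dist (state f y \<pi> w t) (state f y' \<pi> w t) < d)"
proof -
  have uc: "uniformly_continuous_on (Y \<times> U \<times> S) f"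
    by (intro compact_uniformly_continuous f_cont compact_Times compact_Y compact_U compact_S)
  have one: "\<exists>r>0. \<forall>y\<in>Y. \<forall>y'\<in>Y. dist y y' < r \<longrightarrow> (\<forall>\<pi>\<in>plans. \<forall>w\<in>space P.
    dist (state f y \<pi> w t) (state f y' \<pi> w t) < d)" if "d > 0" for t d
    using that
  proof (induction t arbitrary: d)
    case 0
    then show ?case by auto
  next
    case (Suc t)
    obtain d' where d': "d' > 0"
      "\<And>x x'. x \<in> Y \<times> U \<times> S \<Longrightarrow> x' \<in> Y \<times> U \<times> S \<Longrightarrow> dist x' x < d' \<Longrightarrow> dist (f x') (f x) < d"
      using uc Suc.prems unfolding uniformly_continuous_on_def by meson
    obtain r where r: "r > 0" "\<And>y y' \<pi> w. y \<in> Y \<Longrightarrow> y' \<in> Y \<Longrightarrow> dist y y' < r \<Longrightarrow> \<pi> \<in> plans \<Longrightarrow> w \<in> space P \<Longrightarrow>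
      dist (state f y \<pi> w t) (state f y' \<pi> w t) < d'" using Suc.IH[OF d'(1)] by blast
    have "dist (state f y \<pi> w (Suc t)) (state f y' \<pi> w (Suc t)) < d"
      if h: "y \<in> Y" "y' \<in> Y" "dist y y' < r" "\<pi> \<in> plans" "w \<in> space P" for y y' \<pi> w
    proof -
      have "(state f y \<pi> w t, control \<pi> w t) \<in> Y \<times> U" "(state f y' \<pi> w t, control \<pi> w t) \<in> Y \<times> U"
        by (rule trajectory_in; use h in simp)+
      moreover have "w t \<in> S" using h by (auto simp: space_P)
      ultimately show ?thesis using r(2)[OF h] by (auto intro!: d'(2) simp: dist_Pair_Pair)
    qed
    then show ?case using r(1) by blast
  qed
  show ?thesis
  proof (induction k)
    case 0
    then show ?case by (auto intro: exI[of _ 1])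
  next
    case (Suc k)
    then obtain r where "r > 0" and r: "\<forall>y\<in>Y. \<forall>y'\<in>Y. dist y y' < r \<longrightarrow> (\<forall>\<pi>\<in>plans. \<forall>w\<in>space P. \<forall>t<k.
      dist (state f y \<pi> w t) (state f y' \<pi> w t) < d)" by auto
    obtain r' where "r' > 0" and r': "\<forall>y\<in>Y. \<forall>y'\<in>Y. dist y y' < r' \<longrightarrow> (\<forall>\<pi>\<in>plans. \<forall>w\<in>space P.
      dist (state f y \<pi> w k) (state f y' \<pi> w k) < d)" using one[OF assms, of k] by auto
    show ?case using \<open>r > 0\<close> \<open>r' > 0\<close> r r' by (intro exI[of _ "min r r'"]) (auto simp: less_Suc_eq)
  qed
qed

lemma total_reward_equicontinuous:
  assumes \<phi>: "continuous_on (Y \<times> U) \<phi>" and "e > 0"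
  shows "\<exists>r>0. \<forall>y\<in>Y. \<forall>y'\<in>Y. dist y y' < r \<longrightarrow> (\<forall>\<pi>\<in>plans.
    \<bar>total_reward k \<phi> y \<pi> - total_reward k \<phi> y' \<pi>\<bar> \<le> e)"
proof -
  have "uniformly_continuous_on (Y \<times> U) \<phi>"
    by (intro compact_uniformly_continuous \<phi> compact_Times compact_Y compact_U)
  \<comment> \<open>Dividing by \<open>real k + 1\<close> also covers \<open>k = 0\<close>.\<close>
  moreover have "e / (real k + 1) > 0" using \<open>e > 0\<close> by simp
  ultimately obtain d where d: "d > 0"
    "\<And>x x'. x \<in> Y \<times> U \<Longrightarrow> x' \<in> Y \<times> U \<Longrightarrow> dist x' x < d \<Longrightarrow> dist (\<phi> x') (\<phi> x) < e / (real k + 1)"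
    unfolding uniformly_continuous_on_def by meson
  obtain r where r: "r > 0" "\<forall>y\<in>Y. \<forall>y'\<in>Y. dist y y' < r \<longrightarrow> (\<forall>\<pi>\<in>plans. \<forall>w\<in>space P. \<forall>t<k.
      dist (state f y \<pi> w t) (state f y' \<pi> w t) < d)" using state_equicontinuous[OF d(1), of k] by blast
  have one: "total_reward k \<phi> y \<pi> \<le> total_reward k \<phi> y' \<pi> + e"
    if h: "y \<in> Y" "y' \<in> Y" "dist y y' < r" "\<pi> \<in> plans" for y y' \<pi>
  proof -
    have "total_reward k \<phi> y \<pi> \<le> total_reward k \<phi> y' \<pi> + real k * (e / (real k + 1))"
    proof (intro total_reward_mono \<phi> h)
      fix w t assume w: "w \<in> space P" "t < k"
      have "dist (\<phi> (state f y \<pi> w t, control \<pi> w t)) (\<phi> (state f y' \<pi> w t, control \<pi> w t)) < e / (real k + 1)"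
        using r(2) h w by (intro d(2) trajectory_in) (auto simp: dist_Pair_Pair)
      then show "\<phi> (state f y \<pi> w t, control \<pi> w t) \<le> \<phi> (state f y' \<pi> w t, control \<pi> w t) + e / (real k + 1)"
        by (auto simp: dist_real_def)
    qed
    also have "real k * (e / (real k + 1)) \<le> e" using \<open>e > 0\<close> by (simp add: field_simps)
    finally show ?thesis by simp
  qed
  have "\<bar>total_reward k \<phi> y \<pi> - total_reward k \<phi> y' \<pi>\<bar> \<le> e"
    if h: "y \<in> Y" "y' \<in> Y" "dist y y' < r" "\<pi> \<in> plans" for y y' \<pi>
    using one[OF h] one[OF h(2,1) _ h(4)] h(3) by (simp add: dist_commute abs_le_iff)
  then show ?thesis using r(1) by blast
qed

subsection \<open>Value functions and stationary measures\<close>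

lemma constant_plan: "u \<in> U \<Longrightarrow> (\<lambda>t v. u) \<in> plans"
  by (auto simp: control_plans_def space_restrict_space)

lemma plans_nonempty: "plans \<noteq> {}"
  using constant_plan U_nonempty by blast

lemma continuous_bounded:
  fixes \<phi> :: "'y \<times> 'u \<Rightarrow> 'b::real_normed_vector"
  assumes "continuous_on (Y \<times> U) \<phi>"
  obtains B where "B \<ge> 0" "\<And>x. x \<in> Y \<times> U \<Longrightarrow> norm (\<phi> x) \<le> B"
proof -
  have "compact (\<phi> ` (Y \<times> U))" by (intro compact_continuous_image assms compact_Times compact_Y compact_U)
  then obtain B where B: "\<And>x. x \<in> Y \<times> U \<Longrightarrow> norm (\<phi> x) \<le> B"
    by (meson bounded_iff compact_imp_bounded imageI)
  show thesis by (rule that[of "max 0 B"]) (use B in \<open>auto simp: le_max_iff_disj\<close>)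
qed

lemma total_reward_bound:
  assumes "\<pi> \<in> plans" "y \<in> Y" "continuous_on (Y \<times> U) \<phi>" and B: "\<And>x. x \<in> Y \<times> U \<Longrightarrow> \<bar>\<phi> x\<bar> \<le> B"
  shows "\<bar>total_reward k \<phi> y \<pi>\<bar> \<le> real k * B"
proof -
  have c0: "continuous_on (Y \<times> U) (\<lambda>_. 0 :: real)" by simp
  have z: "total_reward k (\<lambda>_. 0) y \<pi> = 0" by (simp add: total_reward_def)
  have "total_reward k \<phi> y \<pi> \<le> total_reward k (\<lambda>_. 0) y \<pi> + real k * B"
    using B trajectory_in[OF assms(1,2)] by (intro total_reward_mono assms c0) (force simp: abs_le_iff)
  moreover have "total_reward k (\<lambda>_. 0) y \<pi> \<le> total_reward k \<phi> y \<pi> + real k * B"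
  proof (intro total_reward_mono assms c0)
    fix w t assume "w \<in> space P"
    then have "\<bar>\<phi> (state f y \<pi> w t, control \<pi> w t)\<bar> \<le> B" by (intro B trajectory_in assms)
    then show "0 \<le> \<phi> (state f y \<pi> w t, control \<pi> w t) + B" by linarith
  qed
  ultimately show ?thesis using z by (simp add: abs_le_iff)
qed

definition value_fun :: "nat \<Rightarrow> ('y \<times> 'u \<Rightarrow> real) \<Rightarrow> 'y \<Rightarrow> real" where
  "value_fun k \<phi> y = (SUP \<pi>\<in>plans. total_reward k \<phi> y \<pi>)"

lemma total_reward_le_value_fun:
  assumes "\<pi> \<in> plans" "y \<in> Y" "continuous_on (Y \<times> U) \<phi>"
  shows "total_reward k \<phi> y \<pi> \<le> value_fun k \<phi> y"
proof -
  obtain B where B: "B \<ge> 0" "\<And>x. x \<in> Y \<times> U \<Longrightarrow> norm (\<phi> x) \<le> B" by (rule continuous_bounded[OF assms(3)]) blast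
  have "bdd_above (total_reward k \<phi> y ` plans)"
    unfolding bdd_above_def
  proof (intro exI ballI, elim imageE, hypsubst)
    fix \<pi> assume "\<pi> \<in> plans"
    then have "\<bar>total_reward k \<phi> y \<pi>\<bar> \<le> real k * B" using B by (intro total_reward_bound assms) auto
    then show "total_reward k \<phi> y \<pi> \<le> real k * B" by linarith
  qed
  then show ?thesis unfolding value_fun_def by (rule cSUP_upper[OF assms(1)])
qed

lemma value_fun_approx:
  assumes "e > 0"
  shows "\<exists>\<pi>\<in>plans. value_fun k \<phi> y - e \<le> total_reward k \<phi> y \<pi>"
proof (rule ccontr)
  assume "\<not> ?thesis"
  then have "value_fun k \<phi> y \<le> value_fun k \<phi> y - e"
    unfolding value_fun_def by (intro cSUP_least plans_nonempty) (force simp: not_le less_imp_le)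
  then show False using assms by simp
qed

lemma value_fun_equicontinuous:
  assumes "continuous_on (Y \<times> U) \<phi>" "e > 0"
  shows "\<exists>r>0. \<forall>y\<in>Y. \<forall>y'\<in>Y. dist y y' < r \<longrightarrow> \<bar>value_fun k \<phi> y - value_fun k \<phi> y'\<bar> \<le> e"
proof -
  obtain r where r: "r > 0" and rJ: "\<And>y y' \<pi>. y \<in> Y \<Longrightarrow> y' \<in> Y \<Longrightarrow> dist y y' < r \<Longrightarrow> \<pi> \<in> plans \<Longrightarrow>
    \<bar>total_reward k \<phi> y \<pi> - total_reward k \<phi> y' \<pi>\<bar> \<le> e"
    using total_reward_equicontinuous[OF assms, of k] by blast
  have "value_fun k \<phi> y \<le> value_fun k \<phi> y' + e" if "y \<in> Y" "y' \<in> Y" "dist y y' < r" for y y'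
  proof -
    have "total_reward k \<phi> y \<pi> \<le> value_fun k \<phi> y' + e" if "\<pi> \<in> plans" for \<pi>
      using rJ[OF \<open>y \<in> Y\<close> \<open>y' \<in> Y\<close> \<open>dist y y' < r\<close> that] total_reward_le_value_fun[OF that \<open>y' \<in> Y\<close> assms(1), of k]
      by linarith
    then show ?thesis unfolding value_fun_def[of k \<phi> y] by (intro cSUP_least plans_nonempty)
  qed
  then have "\<bar>value_fun k \<phi> y - value_fun k \<phi> y'\<bar> \<le> e" if "y \<in> Y" "y' \<in> Y" "dist y y' < r" for y y'
    using that by (fastforce simp: abs_le_iff dist_commute)
  then show ?thesis using r by blast
qed

lemma value_fun_continuous:
  assumes "continuous_on (Y \<times> U) \<phi>"
  shows "continuous_on Y (value_fun k \<phi>)"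
  unfolding continuous_on_iff
proof (intro ballI allI impI)
  fix y and e :: real assume "y \<in> Y" "e > 0"
  then obtain r where "r > 0" and r: "\<forall>y\<in>Y. \<forall>y'\<in>Y. dist y y' < r \<longrightarrow> \<bar>value_fun k \<phi> y - value_fun k \<phi> y'\<bar> \<le> e / 2"
    using value_fun_equicontinuous[OF assms, of "e / 2"] by (meson half_gt_zero)
  show "\<exists>d>0. \<forall>x'\<in>Y. dist x' y < d \<longrightarrow> dist (value_fun k \<phi> x') (value_fun k \<phi> y) < e"
    using \<open>r > 0\<close> r \<open>y \<in> Y\<close> \<open>e > 0\<close> by (intro exI[of _ r]) (fastforce simp: dist_real_def)
qed

section \<open>One-step expectations and dynamic programming\<close>

lemma expected_next_integrable:
  assumes "continuous_on Y \<psi>" "y \<in> Y" "u \<in> U"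
  shows "integrable \<mu> (\<lambda>s. \<psi> (f (y, u, s)) :: real)"
proof -
  interpret prob_space \<mu> by (rule prob_mu)
  have "compact (\<psi> ` Y)" by (intro compact_continuous_image assms compact_Y)
  then obtain B where B: "\<And>x. x \<in> Y \<Longrightarrow> norm (\<psi> x) \<le> B" by (meson bounded_iff compact_imp_bounded imageI)
  show ?thesis
  proof (rule integrable_const_bound)
    show "AE s in \<mu>. norm (\<psi> (f (y, u, s))) \<le> B"
      using assms by (intro AE_I2 B f_invariant) (auto simp: space_mu)
    have "continuous_on S (\<lambda>s. f (y, u, s))"
      by (rule continuous_on_compose2[OF f_cont]) (use assms in \<open>auto intro!: continuous_intros\<close>)
    then have "continuous_on S (\<lambda>s. \<psi> (f (y, u, s)))"
      by (rule continuous_on_compose2[OF assms(1)]) (use assms f_invariant in auto)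
    then show "(\<lambda>s. \<psi> (f (y, u, s))) \<in> borel_measurable \<mu>"
      using measurable_cong_sets[OF sets_mu refl] borel_measurable_continuous_on_restrict by blast
  qed
qed

lemma expected_next_continuous:
  assumes \<psi>: "continuous_on Y \<psi>"
  shows "continuous_on (Y \<times> U) (\<lambda>(y, u). \<integral>s. \<psi> (f (y, u, s)) \<partial>\<mu> :: real)"
proof -
  interpret prob_space \<mu> by (rule prob_mu)
  have "uniformly_continuous_on (Y \<times> U \<times> S) (\<lambda>x. \<psi> (f x))"
    by (intro compact_uniformly_continuous continuous_on_compose2[OF \<psi> f_cont] compact_Times compact_Y compact_U compact_S)
      (auto simp: f_invariant)
  note uc = this[unfolded uniformly_continuous_on_def, rule_format]
  show ?thesis unfolding continuous_on_iff
  proof (intro ballI allI impI)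
    fix x and e :: real assume x: "x \<in> Y \<times> U" and "e > 0"
    obtain d where d: "d > 0" and dd: "\<And>x x'. x \<in> Y \<times> U \<times> S \<Longrightarrow> x' \<in> Y \<times> U \<times> S \<Longrightarrow> dist x' x < d \<Longrightarrow>
      dist (\<psi> (f x')) (\<psi> (f x)) < e / 2" using uc[of "e / 2"] \<open>e > 0\<close> by (meson half_gt_zero)
    have "\<bar>(\<integral>s. \<psi> (f (fst x', snd x', s)) \<partial>\<mu>) - (\<integral>s. \<psi> (f (fst x, snd x, s)) \<partial>\<mu>)\<bar> \<le> e / 2"
      if x': "x' \<in> Y \<times> U" "dist x' x < d" for x'
    proof -
      have i: "integrable \<mu> (\<lambda>s. \<psi> (f (fst x', snd x', s)))" "integrable \<mu> (\<lambda>s. \<psi> (f (fst x, snd x, s)))"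
        using x x' by (auto intro!: expected_next_integrable \<psi>)
      have "\<bar>(\<integral>s. \<psi> (f (fst x', snd x', s)) \<partial>\<mu>) - (\<integral>s. \<psi> (f (fst x, snd x, s)) \<partial>\<mu>)\<bar> =
        \<bar>\<integral>s. \<psi> (f (fst x', snd x', s)) - \<psi> (f (fst x, snd x, s)) \<partial>\<mu>\<bar>" using i by simp
      also have "\<dots> \<le> (\<integral>s. \<bar>\<psi> (f (fst x', snd x', s)) - \<psi> (f (fst x, snd x, s))\<bar> \<partial>\<mu>)"
        by (rule integral_abs_bound)
      also have "\<dots> \<le> (\<integral>s. e / 2 \<partial>\<mu>)"
      proof (rule integral_mono)
        fix s assume s: "s \<in> space \<mu>"
        have "dist (fst x', snd x', s) (fst x, snd x, s) = dist x' x"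
          by (cases x; cases x') (simp add: dist_Pair_Pair)
        then have "dist (\<psi> (f (fst x', snd x', s))) (\<psi> (f (fst x, snd x, s))) < e / 2"
          using x x' s by (intro dd) (auto simp: space_mu)
        then show "\<bar>\<psi> (f (fst x', snd x', s)) - \<psi> (f (fst x, snd x, s))\<bar> \<le> e / 2" by (simp add: dist_real_def)
      qed (use i in auto)
      finally show ?thesis by (simp add: prob_space)
    qed
    then show "\<exists>d>0. \<forall>x'\<in>Y \<times> U. dist x' x < d \<longrightarrow>
        dist (case x' of (y, u) \<Rightarrow> \<integral>s. \<psi> (f (y, u, s)) \<partial>\<mu>) (case x of (y, u) \<Rightarrow> \<integral>s. \<psi> (f (y, u, s)) \<partial>\<mu>) < e"
      using d \<open>e > 0\<close> by (intro exI[of _ d]) (fastforce simp: dist_real_def case_prod_beta)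
  qed
qed

text \<open>One step of dynamic programming, for the plan that plays \<open>u\<close> and lets the
  next state choose the continuation. Integrability of the continuation reward comes from Fubini's
  theorem, as it is an integral over the later noise.\<close>

lemma total_reward_concat_one:
  assumes "y \<in> Y" "u \<in> U" and \<phi>: "continuous_on (Y \<times> U) \<phi>"
    and idx: "idx \<in> borel \<rightarrow>\<^sub>M count_space UNIV" and \<rho>: "\<And>i. \<rho> i \<in> plans"
  defines "\<pi> \<equiv> concat_plan 1 (\<lambda>t v. u) (\<lambda>v. idx (f (y, u, v 0))) \<rho>"
  shows "\<pi> \<in> plans"
    and "integrable P (\<lambda>w. total_reward k \<phi> (f (y, u, w 0)) (\<rho> (idx (f (y, u, w 0)))))"
    and "total_reward (Suc k) \<phi> y \<pi> =
      \<phi> (y, u) + (\<integral>w. total_reward k \<phi> (f (y, u, w 0)) (\<rho> (idx (f (y, u, w 0)))) \<partial>P)"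
proof -
  interpret PP: prob_space P by (rule prob_P)
  have c: "(\<lambda>t v. u) \<in> plans" by (rule constant_plan[OF assms(2)])
  have "(\<lambda>v. state f y (\<lambda>t v. u) v 1) \<in> history {..<1} \<rightarrow>\<^sub>M borel_on Y"
    by (rule state_measurable[OF c assms(1)]) simp
  then have "(\<lambda>v. f (y, u, v 0)) \<in> history {..<1} \<rightarrow>\<^sub>M borel"
    by (simp add: measurable_restrict_space2_iff control_def)
  then have "(\<lambda>v. idx (f (y, u, v 0))) \<in> history {..<1} \<rightarrow>\<^sub>M count_space UNIV"
    by (rule measurable_compose[OF _ idx])
  then show \<pi>: "\<pi> \<in> plans" unfolding \<pi>_def by (intro concat_plan_in c \<rho>)
  define G where "G w = (\<Sum>t<Suc k. \<phi> (state f y \<pi> w t, control \<pi> w t))" for w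
  obtain B where B: "B \<ge> 0" "\<And>x. x \<in> Y \<times> U \<Longrightarrow> norm (\<phi> x) \<le> B" by (rule continuous_bounded[OF \<phi>]) blast
  have Gb: "\<bar>G w\<bar> \<le> real (Suc k) * B" if "w \<in> space P" for w
  proof -
    have "\<bar>G w\<bar> \<le> (\<Sum>t<Suc k. \<bar>\<phi> (state f y \<pi> w t, control \<pi> w t)\<bar>)" unfolding G_def by (rule sum_abs)
    also have "\<dots> \<le> (\<Sum>t<Suc k. B)"
      using B(2)[OF trajectory_in[OF \<pi> assms(1) that]] by (intro sum_mono) auto
    finally show ?thesis by simp
  qed
  have Gm: "G \<in> borel_measurable P"
    unfolding G_def measurable_P by (intro borel_measurable_sum trajectory_measurable \<pi> assms) auto
  \<comment> \<open>With one noise value split off, the trajectory after time 1 is that of the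
    chosen continuation under the fresh noise \<open>w'\<close>.\<close>
  have Gw: "G (comb_seq 1 w w') = \<phi> (y, u) + (\<Sum>t<k. \<phi> (state f (f (y, u, w 0)) (\<rho> (idx (f (y, u, w 0)))) w' t,
      control (\<rho> (idx (f (y, u, w 0)))) w' t))" for w w'
  proof -
    have sh: "(\<lambda>i. comb_seq 1 w w' (1 + i)) = w'" by (auto simp: comb_seq_def fun_eq_iff)
    have s0: "state f y \<pi> (comb_seq 1 w w') 0 = y" "control \<pi> (comb_seq 1 w w') 0 = u"
      unfolding \<pi>_def by (simp, simp add: control_concat_less) (simp add: control_def)
    have i: "idx (f (y, u, restrict (comb_seq 1 w w') {..<1} 0)) = idx (f (y, u, w 0))"
      by (simp add: comb_seq_def)
    have st: "state f y (\<lambda>t v. u) (comb_seq 1 w w') 1 = f (y, u, w 0)" by (simp add: control_def comb_seq_def)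
    have s1: "state f y \<pi> (comb_seq 1 w w') (Suc t) = state f (f (y, u, w 0)) (\<rho> (idx (f (y, u, w 0)))) w' t"
      "control \<pi> (comb_seq 1 w w') (Suc t) = control (\<rho> (idx (f (y, u, w 0)))) w' t" for t
      using state_concat_add[where n = 1 and t = t and y = y and \<pi> = "\<lambda>t v. u" and w = "comb_seq 1 w w'"
          and idx = "\<lambda>v. idx (f (y, u, v 0))" and \<rho> = \<rho>]
        control_concat_add[where n = 1 and t = t and \<pi> = "\<lambda>t v. u" and w = "comb_seq 1 w w'"
          and idx = "\<lambda>v. idx (f (y, u, v 0))" and \<rho> = \<rho>]
      unfolding \<pi>_def[symmetric] i sh st by (simp_all only: plus_1_eq_Suc)
    show ?thesis unfolding G_def sum.lessThan_Suc_shift s0 s1 ..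
  qed
  have nx: "f (y, u, w 0) \<in> Y" if "w \<in> space P" for w
    using that assms(1,2) by (intro f_invariant) (auto simp: space_P)
  have inner: "(\<integral>w'. G (comb_seq 1 w w') \<partial>P) = \<phi> (y, u) + total_reward k \<phi> (f (y, u, w 0)) (\<rho> (idx (f (y, u, w 0))))"
    if "w \<in> space P" for w
    unfolding Gw total_reward_def
    by (subst Bochner_Integration.integral_add)
      (auto intro!: Bochner_Integration.integrable_sum trajectory_integrable \<rho> nx that \<phi> simp: PP.prob_space)
  have "integrable P (\<lambda>w. \<integral>w'. G (comb_seq 1 w w') \<partial>P)"
    by (rule integral_P_split(1)[OF Gm Gb])
  then have "integrable P (\<lambda>w. \<phi> (y, u) + total_reward k \<phi> (f (y, u, w 0)) (\<rho> (idx (f (y, u, w 0)))))"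
    by (subst (asm) Bochner_Integration.integrable_cong[OF refl inner]) auto
  from Bochner_Integration.integrable_diff[OF this PP.integrable_const[of "\<phi> (y, u)"]]
  show I: "integrable P (\<lambda>w. total_reward k \<phi> (f (y, u, w 0)) (\<rho> (idx (f (y, u, w 0)))))" by simp
  have "total_reward (Suc k) \<phi> y \<pi> = integral\<^sup>L P G" unfolding total_reward_def G_def ..
  also have "\<dots> = (\<integral>w. \<integral>w'. G (comb_seq 1 w w') \<partial>P \<partial>P)" using integral_P_split(2)[OF Gm Gb] .
  also have "\<dots> = (\<integral>w. \<phi> (y, u) + total_reward k \<phi> (f (y, u, w 0)) (\<rho> (idx (f (y, u, w 0)))) \<partial>P)"
    by (rule Bochner_Integration.integral_cong[OF refl inner])
  also have "\<dots> = \<phi> (y, u) + (\<integral>w. total_reward k \<phi> (f (y, u, w 0)) (\<rho> (idx (f (y, u, w 0)))) \<partial>P)"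
    using I by (simp add: PP.prob_space)
  finally show "total_reward (Suc k) \<phi> y \<pi> =
      \<phi> (y, u) + (\<integral>w. total_reward k \<phi> (f (y, u, w 0)) (\<rho> (idx (f (y, u, w 0)))) \<partial>P)" .
qed

text \<open>Playing \<open>u\<close> and then an \<open>e\<close>-optimal continuation, chosen
  measurably from the next state, is an admissible plan, so its reward cannot exceed the
  value.\<close>

lemma bellman_inequality:
  assumes "y \<in> Y" "u \<in> U" and \<phi>: "continuous_on (Y \<times> U) \<phi>"
  shows "\<phi> (y, u) + (\<integral>s. value_fun k \<phi> (f (y, u, s)) \<partial>\<mu>) \<le> value_fun (Suc k) \<phi> y"
proof (rule field_le_epsilon)
  fix e :: real assume "e > 0"
  interpret PP: prob_space P by (rule prob_P)
  \<comment> \<open>With the value subtracted, the threshold in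
    \<open>finite_measurable_selection\<close> is the constant \<open>- (e / 2)\<close> for all
    states. Reward and value may each vary by \<open>e / 4\<close>.\<close>
  have equi: "\<exists>r>0. \<forall>x\<in>Y. \<forall>x'\<in>Y. dist x x' < r \<longrightarrow>
      (\<forall>\<pi>\<in>plans. \<bar>(total_reward k \<phi> x \<pi> - value_fun k \<phi> x) - (total_reward k \<phi> x' \<pi> - value_fun k \<phi> x')\<bar> \<le> e / 2)"
  proof -
    have e4: "e / 4 > 0" using \<open>e > 0\<close> by simp
    obtain r1 where "r1 > 0" and r1: "\<And>y y' \<pi>. y \<in> Y \<Longrightarrow> y' \<in> Y \<Longrightarrow> dist y y' < r1 \<Longrightarrow> \<pi> \<in> plans \<Longrightarrow>
      \<bar>total_reward k \<phi> y \<pi> - total_reward k \<phi> y' \<pi>\<bar> \<le> e / 4"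
      using total_reward_equicontinuous[OF \<phi> e4, of k] by blast
    obtain r2 where "r2 > 0" and r2: "\<And>y y'. y \<in> Y \<Longrightarrow> y' \<in> Y \<Longrightarrow> dist y y' < r2 \<Longrightarrow>
      \<bar>value_fun k \<phi> y - value_fun k \<phi> y'\<bar> \<le> e / 4"
      using value_fun_equicontinuous[OF \<phi> e4, of k] by blast
    show ?thesis
    proof (intro exI[of _ "min r1 r2"] conjI ballI impI)
      fix x x' \<pi> assume h: "x \<in> Y" "x' \<in> Y" "dist x x' < min r1 r2" "\<pi> \<in> plans"
      then have "\<bar>total_reward k \<phi> x \<pi> - total_reward k \<phi> x' \<pi>\<bar> \<le> e / 4"
        "\<bar>value_fun k \<phi> x - value_fun k \<phi> x'\<bar> \<le> e / 4" using r1 r2 by auto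
      then show "\<bar>(total_reward k \<phi> x \<pi> - value_fun k \<phi> x) - (total_reward k \<phi> x' \<pi> - value_fun k \<phi> x')\<bar> \<le> e / 2"
        by linarith
    qed (use \<open>r1 > 0\<close> \<open>r2 > 0\<close> in auto)
  qed
  have ex: "\<exists>\<pi>\<in>plans. - (e / 2) \<le> total_reward k \<phi> x \<pi> - value_fun k \<phi> x" for x
    using value_fun_approx[OF half_gt_zero[OF \<open>e > 0\<close>], of k \<phi> x] by (auto simp: algebra_simps)
  obtain idx :: "'y \<Rightarrow> nat" and \<rho> where idx: "idx \<in> borel \<rightarrow>\<^sub>M count_space UNIV" and \<rho>: "\<And>i. \<rho> i \<in> plans"
    and opt: "\<And>x. x \<in> Y \<Longrightarrow> - (e / 2) - e / 2 \<le> total_reward k \<phi> x (\<rho> (idx x)) - value_fun k \<phi> x"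
    by (rule finite_measurable_selection[where J = "\<lambda>x \<pi>. total_reward k \<phi> x \<pi> - value_fun k \<phi> x", OF compact_Y equi ex plans_nonempty]) blast
  note c1 = total_reward_concat_one(1)[where \<rho> = \<rho>, OF assms idx \<rho>]
  note c = total_reward_concat_one(2,3)[where \<rho> = \<rho> and k = k, OF assms idx \<rho>]
  have nx: "f (y, u, w 0) \<in> Y" if "w \<in> space P" for w
    using that assms(1,2) by (intro f_invariant) (auto simp: space_P)
  have vi: "integrable \<mu> (\<lambda>s. value_fun k \<phi> (f (y, u, s)))"
    by (intro expected_next_integrable value_fun_continuous assms)
  note comp = distr_P_component
  have m0: "(\<lambda>w. w 0) \<in> P \<rightarrow>\<^sub>M \<mu>" by (rule measurable_component_singleton) simp
  have vi': "integrable P (\<lambda>w. value_fun k \<phi> (f (y, u, w 0)))"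
    using integrable_distr_eq[OF m0 borel_measurable_integrable[OF vi]] vi
    by (simp add: comp)
  have "(\<integral>s. value_fun k \<phi> (f (y, u, s)) \<partial>\<mu>) = (\<integral>w. value_fun k \<phi> (f (y, u, w 0)) \<partial>P)"
    using integral_distr[OF m0 borel_measurable_integrable[OF vi]]
    by (simp add: comp)
  also have "\<dots> \<le> (\<integral>w. total_reward k \<phi> (f (y, u, w 0)) (\<rho> (idx (f (y, u, w 0)))) + e \<partial>P)"
    using opt[OF nx] by (intro integral_mono vi' Bochner_Integration.integrable_add c(1)) (auto simp: algebra_simps)
  also have "\<dots> = (\<integral>w. total_reward k \<phi> (f (y, u, w 0)) (\<rho> (idx (f (y, u, w 0)))) \<partial>P) + e"
    using c(1) by (simp add: PP.prob_space)
  finally have "\<phi> (y, u) + (\<integral>s. value_fun k \<phi> (f (y, u, s)) \<partial>\<mu>) \<le>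
      total_reward (Suc k) \<phi> y (concat_plan 1 (\<lambda>t v. u) (\<lambda>v. idx (f (y, u, v 0))) \<rho>) + e"
    unfolding c(2) by simp
  also have "\<dots> \<le> value_fun (Suc k) \<phi> y + e"
    using total_reward_le_value_fun[OF c1 assms(1) \<phi>] by simp
  finally show "\<phi> (y, u) + (\<integral>s. value_fun k \<phi> (f (y, u, s)) \<partial>\<mu>) \<le> value_fun (Suc k) \<phi> y + e" .
qed

section \<open>Stationary measures and attainable mean rewards\<close>

definition stationary :: "('y \<times> 'u) measure \<Rightarrow> bool" where
  "stationary \<gamma> \<longleftrightarrow> prob_space \<gamma> \<and> sets \<gamma> = sets (borel_on (Y \<times> U)) \<and>
     (\<forall>\<psi> :: 'y \<Rightarrow> real. continuous_on Y \<psi> \<longrightarrow>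
        (\<integral>(y, u). (\<integral>s. \<psi> (f (y, u, s)) \<partial>\<mu>) - \<psi> y \<partial>\<gamma>) = 0)"

lemma stationary_space: "stationary \<gamma> \<Longrightarrow> space \<gamma> = Y \<times> U"
  unfolding stationary_def using sets_eq_imp_space_eq[of \<gamma> "borel_on (Y \<times> U)"] by (simp add: space_restrict_space)

lemma stationary_integrable:
  fixes \<phi> :: "'y \<times> 'u \<Rightarrow> 'b::{banach, second_countable_topology}"
  assumes \<gamma>: "stationary \<gamma>" and \<phi>: "continuous_on (Y \<times> U) \<phi>"
  shows "integrable \<gamma> \<phi>"
proof -
  interpret prob_space \<gamma> using \<gamma> by (simp add: stationary_def)
  obtain B where B: "\<And>x. x \<in> Y \<times> U \<Longrightarrow> norm (\<phi> x) \<le> B" using continuous_bounded[OF \<phi>] by metis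
  show ?thesis
  proof (rule integrable_const_bound)
    show "AE x in \<gamma>. norm (\<phi> x) \<le> B" by (intro AE_I2 B) (simp add: stationary_space[OF \<gamma>])
    have "sets \<gamma> = sets (borel_on (Y \<times> U))" using \<gamma> by (simp add: stationary_def)
    then show "\<phi> \<in> borel_measurable \<gamma>"
      using borel_measurable_continuous_on_restrict[OF \<phi>] measurable_cong_sets[of \<gamma> "borel_on (Y \<times> U)" borel borel] by blast
  qed
qed

text \<open>This replaces a disintegration of \<open>\<gamma>\<close> into a randomized feedback.\<close>

lemma stationary_value_bound:
  assumes \<gamma>: "stationary \<gamma>" and \<phi>: "continuous_on (Y \<times> U) \<phi>"
  shows "real k * (\<integral>x. \<phi> x \<partial>\<gamma>) \<le> (\<integral>x. value_fun k \<phi> (fst x) \<partial>\<gamma>)"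
proof (induction k)
  case 0
  have "0 = value_fun 0 \<phi> y" for y
    unfolding value_fun_def total_reward_def using plans_nonempty by simp
  then show ?case by (simp flip: \<open>\<And>y. 0 = value_fun 0 \<phi> y\<close>)
next
  case (Suc k)
  define F where "F x = (\<integral>s. value_fun k \<phi> (f (fst x, snd x, s)) \<partial>\<mu>)" for x
  have v: "continuous_on (Y \<times> U) (\<lambda>x. value_fun k \<phi> (fst x))" for k
    by (rule continuous_on_compose2[OF value_fun_continuous[OF \<phi>] continuous_on_fst[OF continuous_on_id]]) auto
  have F: "continuous_on (Y \<times> U) F"
    using expected_next_continuous[OF value_fun_continuous[OF \<phi>, of k]] by (simp only: F_def[abs_def] case_prod_unfold)
  have st: "(\<integral>x. F x - value_fun k \<phi> (fst x) \<partial>\<gamma>) = 0"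
    using \<gamma>[unfolded stationary_def, THEN conjunct2, THEN conjunct2, rule_format, OF value_fun_continuous[OF \<phi>, of k]]
    by (simp only: F_def case_prod_unfold)
  have int: "integrable \<gamma> \<phi>" "integrable \<gamma> F" "\<And>k. integrable \<gamma> (\<lambda>x. value_fun k \<phi> (fst x))"
    by (intro stationary_integrable \<gamma> \<phi> F v)+
  \<comment> \<open>The inserted middle integral vanishes: it is the stationarity condition for the
    test function \<open>value_fun k \<phi>\<close>, admissible because value functions are
    continuous.\<close>
  have "(\<integral>x. \<phi> x \<partial>\<gamma>) + (\<integral>x. F x - value_fun k \<phi> (fst x) \<partial>\<gamma>) + (\<integral>x. value_fun k \<phi> (fst x) \<partial>\<gamma>) =
      (\<integral>x. \<phi> x + F x \<partial>\<gamma>)" using int by simp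
  also have "\<dots> \<le> (\<integral>x. value_fun (Suc k) \<phi> (fst x) \<partial>\<gamma>)"
    using bellman_inequality[OF _ _ \<phi>, of _ _ k] stationary_space[OF \<gamma>]
    by (intro integral_mono Bochner_Integration.integrable_add int) (auto simp: F_def)
  finally show ?case using st Suc by (simp add: algebra_simps)
qed

text \<open>The maximum of the value function dominates its mean over \<open>\<gamma>\<close>, so a
  maximizing state does as well as the measure. This state need not be the current one, hence the
  later use of the approximation conditions.\<close>

lemma stationary_reward_attained:
  assumes \<gamma>: "stationary \<gamma>" and \<phi>: "continuous_on (Y \<times> U) \<phi>" and "e > 0"
  obtains y \<pi> where "y \<in> Y" "\<pi> \<in> plans" "real k * (\<integral>x. \<phi> x \<partial>\<gamma>) - e \<le> total_reward k \<phi> y \<pi>"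
proof -
  interpret prob_space \<gamma> using \<gamma> by (simp add: stationary_def)
  have "Y \<noteq> {}" using stationary_space[OF \<gamma>] not_empty by auto
  then obtain y where y: "y \<in> Y" "\<And>y'. y' \<in> Y \<Longrightarrow> value_fun k \<phi> y' \<le> value_fun k \<phi> y"
    using continuous_attains_sup[OF compact_Y _ value_fun_continuous[OF \<phi>]] by blast
  have v: "continuous_on (Y \<times> U) (\<lambda>x. value_fun k \<phi> (fst x))"
    by (rule continuous_on_compose2[OF value_fun_continuous[OF \<phi>] continuous_on_fst[OF continuous_on_id]]) auto
  have "real k * (\<integral>x. \<phi> x \<partial>\<gamma>) \<le> (\<integral>x. value_fun k \<phi> (fst x) \<partial>\<gamma>)" by (rule stationary_value_bound[OF \<gamma> \<phi>])
  also have "\<dots> \<le> (\<integral>x. value_fun k \<phi> y \<partial>\<gamma>)"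
    using y stationary_space[OF \<gamma>] by (intro integral_mono stationary_integrable \<gamma> v) auto
  finally have "real k * (\<integral>x. \<phi> x \<partial>\<gamma>) \<le> value_fun k \<phi> y" by (simp add: prob_space)
  moreover obtain \<pi> where "\<pi> \<in> plans" "value_fun k \<phi> y - e \<le> total_reward k \<phi> y \<pi>"
    using value_fun_approx[OF \<open>e > 0\<close>] by blast
  ultimately show thesis using y by (intro that[of y \<pi>]) auto
qed

subsection \<open>Approachability\<close>

lemma total_reward_scale: "total_reward k (\<lambda>x. c * \<phi> x) y \<pi> = c * total_reward k \<phi> y \<pi>"
  by (simp add: total_reward_def flip: sum_distrib_left)

text \<open>
  Only this one-sided consequence of the strong approximation conditions, about expectations
  and not about expected distances, is needed.
\<close>

definition reward_transfer :: "(nat \<Rightarrow> 'y \<times> 'u \<Rightarrow> real) \<Rightarrow> nat \<Rightarrow> (real \<Rightarrow> real) \<Rightarrow> bool" where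
  "reward_transfer q j \<nu> \<longleftrightarrow> (\<nu> \<longlongrightarrow> 0) at_top \<and>
    (\<forall>T\<ge>1. \<forall>y'\<in>Y. \<forall>y''\<in>Y. \<forall>\<pi>'\<in>plans. \<exists>\<pi>''\<in>plans. \<forall>i<j.
      total_reward (Suc T) (q i) y' \<pi>' \<le> total_reward (Suc T) (q i) y'' \<pi>'' + real T * \<nu> (real T))"

lemma reward_transferD:
  assumes "reward_transfer q j \<nu>" "T \<ge> 1" "y' \<in> Y" "y'' \<in> Y" "\<pi>' \<in> plans"
  obtains \<pi>'' where "\<pi>'' \<in> plans" "\<And>i. i < j \<Longrightarrow>
      total_reward (Suc T) (q i) y' \<pi>' \<le> total_reward (Suc T) (q i) y'' \<pi>'' + real T * \<nu> (real T)"
  using assms unfolding reward_transfer_def by blast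

section \<open>Plans that match all stationary measures, uniformly in a compact parameter\<close>

text \<open>Uniformity in \<open>p\<close> comes from a finite net of \<open>K\<close>: its reward
  functions are approximated by finitely many members of \<open>q\<close>, so one index
  \<open>j\<close>, one \<open>\<nu>\<close> and one horizon serve all parameters. The plan may
  still depend on \<open>\<gamma>\<close>.\<close>

lemma uniform_reward:
  fixes \<Phi> :: "'p::metric_space \<Rightarrow> 'y \<times> 'u \<Rightarrow> real"
  assumes q: "lipschitz_dense_sequence (Y \<times> U) q"
    and tr: "\<And>j. j \<ge> 1 \<Longrightarrow> \<exists>\<nu>. reward_transfer q j \<nu>"
    and K: "compact K" and \<Phi>: "continuous_on (K \<times> Y \<times> U) (\<lambda>(p, x). \<Phi> p x)" and e: "e > 0"
  shows "\<exists>L\<ge>1. \<forall>p\<in>K. \<forall>\<gamma>. stationary \<gamma> \<longrightarrow> (\<forall>y\<in>Y. \<exists>\<pi>\<in>plans.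
    real L * ((\<integral>x. \<Phi> p x \<partial>\<gamma>) - e) \<le> total_reward L (\<Phi> p) y \<pi>)"
proof -
  have \<Phi>c: "continuous_on (Y \<times> U) (\<Phi> p)" if "p \<in> K" for p
    using continuous_on_compose2[OF \<Phi> continuous_on_Pair[OF continuous_on_const continuous_on_id], of p "Y \<times> U"] that
    by auto
  have cpt: "compact (K \<times> Y \<times> U)" by (intro compact_Times K compact_Y compact_U)
  have "compact ((\<lambda>(p, x). \<Phi> p x) ` (K \<times> Y \<times> U))" by (intro compact_continuous_image \<Phi> cpt)
  then obtain Q0 where Q0: "\<And>p x. p \<in> K \<Longrightarrow> x \<in> Y \<times> U \<Longrightarrow> \<bar>\<Phi> p x\<bar> \<le> Q0"
    by (force dest!: compact_imp_bounded simp: bounded_iff)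
  \<comment> \<open>The sequence \<open>q\<close> is dense only in the unit ball, so rewards are
    divided by \<open>Q\<close> before they are approximated.\<close>
  define Q where "Q = max 1 Q0"
  have Q: "Q \<ge> 1" "\<And>p x. p \<in> K \<Longrightarrow> x \<in> Y \<times> U \<Longrightarrow> \<bar>\<Phi> p x\<bar> \<le> Q"
    using Q0 by (auto simp: Q_def le_max_iff_disj)
  have e8: "e / 8 > 0" using e by simp
  have "uniformly_continuous_on (K \<times> Y \<times> U) (\<lambda>(p, x). \<Phi> p x)" by (intro compact_uniformly_continuous \<Phi> cpt)
  from this[unfolded uniformly_continuous_on_def, rule_format, OF e8]
  obtain r where r: "r > 0" and rr: "\<And>a b. a \<in> K \<times> Y \<times> U \<Longrightarrow> b \<in> K \<times> Y \<times> U \<Longrightarrow> dist b a < r \<Longrightarrow>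
    dist (case b of (p, x) \<Rightarrow> \<Phi> p x) (case a of (p, x) \<Rightarrow> \<Phi> p x) < e / 8" by blast
  have near: "\<bar>\<Phi> p' x - \<Phi> p x\<bar> \<le> e / 8" if "p \<in> K" "p' \<in> K" "dist p' p < r" "x \<in> Y \<times> U" for p p' x
    using rr[of "(p, x)" "(p', x)"] that by (auto simp: dist_Pair_Pair dist_real_def)
  obtain k where k: "finite k" "k \<subseteq> K" "K \<subseteq> (\<Union>p\<in>k. ball p r)" using compact_finite_net[OF K r] .
  have qd: "\<exists>i. \<forall>x\<in>Y \<times> U. \<bar>q i x - \<phi> x\<bar> < d"
    if "continuous_on (Y \<times> U) \<phi>" "\<And>x. x \<in> Y \<times> U \<Longrightarrow> \<bar>\<phi> x\<bar> \<le> 1" "d > 0" for \<phi> d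
    using q that unfolding lipschitz_dense_sequence_def by blast
  have qc: "continuous_on (Y \<times> U) (q i)" for i
    using q lipschitz_on_continuous_on unfolding lipschitz_dense_sequence_def by metis
  have "\<exists>i. \<forall>x\<in>Y \<times> U. \<bar>Q * q i x - \<Phi> p x\<bar> \<le> e / 8" if p: "p \<in> K" for p
  proof -
    have "\<exists>i. \<forall>x\<in>Y \<times> U. \<bar>q i x - \<Phi> p x / Q\<bar> < e / 8 / Q"
      using Q e by (intro qd continuous_on_divide \<Phi>c p continuous_on_const) (auto simp: p)
    then obtain i where i: "\<And>x. x \<in> Y \<times> U \<Longrightarrow> \<bar>q i x - \<Phi> p x / Q\<bar> < e / 8 / Q" by blast
    have "\<bar>Q * q i x - \<Phi> p x\<bar> \<le> e / 8" if "x \<in> Y \<times> U" for x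
    proof -
      have "\<bar>Q * q i x - \<Phi> p x\<bar> = \<bar>Q * (q i x - \<Phi> p x / Q)\<bar>" using Q by (simp add: algebra_simps)
      also have "\<dots> = Q * \<bar>q i x - \<Phi> p x / Q\<bar>" using Q by (simp add: abs_mult)
      also have "\<dots> \<le> Q * (e / 8 / Q)" using i[OF that] Q by (intro mult_left_mono) auto
      finally show ?thesis using Q by simp
    qed
    then show ?thesis by blast
  qed
  then obtain n where n: "\<And>p x. p \<in> K \<Longrightarrow> x \<in> Y \<times> U \<Longrightarrow> \<bar>Q * q (n p) x - \<Phi> p x\<bar> \<le> e / 8" by metis
  \<comment> \<open>Inserting 0 keeps the maximum meaningful for an empty net.\<close>
  define j where "j = Suc (Max (insert 0 (n ` k)))"
  have nj: "n p < j" if "p \<in> k" for p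
    using that k by (auto simp: j_def less_Suc_eq_le intro!: Max_ge)
  obtain \<nu> where \<nu>: "reward_transfer q j \<nu>" using tr[of j] by (auto simp: j_def)
  then have "((\<lambda>T. \<nu> (real T)) \<longlonglongrightarrow> 0)"
    unfolding reward_transfer_def by (auto intro: filterlim_compose filterlim_real_sequentially)
  moreover have "e / (4 * Q) > 0" using e Q by simp
  ultimately have "\<forall>\<^sub>F T in sequentially. \<nu> (real T) < e / (4 * Q)" by (rule order_tendstoD)
  then have "\<forall>\<^sub>F T in sequentially. \<nu> (real T) < e / (4 * Q) \<and> T \<ge> 1"
    using eventually_ge_at_top by (rule eventually_conj)
  then obtain T :: nat where T: "\<nu> (real T) < e / (4 * Q)" "T \<ge> 1"
    by (auto dest: eventually_happens)
  \<comment> \<open>The sums in the approximation conditions run over \<open>t = 0, ..., T\<close>,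
    which are \<open>T + 1\<close> steps, although they are divided by \<open>T\<close>.\<close>
  define L where "L = Suc T"
  have T\<nu>: "Q * (real T * \<nu> (real T)) \<le> real L * (e / 4)"
  proof -
    have "Q * (real T * \<nu> (real T)) = real T * (Q * \<nu> (real T))" by simp
    also have "\<dots> \<le> real T * (Q * (e / (4 * Q)))" using T Q by (intro mult_left_mono) auto
    also have "\<dots> = real T * (e / 4)" using Q by simp
    also have "\<dots> \<le> real L * (e / 4)" using e by (simp add: L_def)
    finally show ?thesis .
  qed
  show ?thesis
  proof (intro exI[of _ L] conjI ballI allI impI)
    show "1 \<le> L" by (simp add: L_def)
    fix p \<gamma> y assume p: "p \<in> K" and \<gamma>: "stationary \<gamma>" and y: "y \<in> Y"
    obtain p' where p': "p' \<in> k" "dist p' p < r" using k p by auto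
    have p'K: "p' \<in> K" using p' k by auto
    have ap: "\<bar>Q * q (n p') x - \<Phi> p x\<bar> \<le> e / 4" if x: "x \<in> Y \<times> U" for x
      using n[OF p'K x] near[OF p p'K p'(2) x] by linarith
    have Lpos: "real L * (e / 4) > 0" using e by (simp add: L_def)
    obtain y' \<pi>' where y': "y' \<in> Y" "\<pi>' \<in> plans"
      and r1: "real L * (\<integral>x. \<Phi> p x \<partial>\<gamma>) - real L * (e / 4) \<le> total_reward L (\<Phi> p) y' \<pi>'"
      by (rule stationary_reward_attained[OF \<gamma> \<Phi>c[OF p] Lpos])
    obtain \<pi>'' where \<pi>'': "\<pi>'' \<in> plans"
      and r2: "total_reward L (q (n p')) y' \<pi>' \<le> total_reward L (q (n p')) y \<pi>'' + real T * \<nu> (real T)"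
      using reward_transferD[OF \<nu> T(2) y'(1) y y'(2)] nj[OF p'(1)] unfolding L_def by metis
    have qc': "continuous_on (Y \<times> U) (\<lambda>x. Q * q (n p') x)" by (intro continuous_intros qc)
    have r3: "total_reward L (\<Phi> p) y' \<pi>' \<le> total_reward L (\<lambda>x. Q * q (n p') x) y' \<pi>' + real L * (e / 4)"
    proof (intro total_reward_mono y' \<Phi>c p qc')
      fix w t assume "w \<in> space P"
      from ap[OF trajectory_in[OF y'(2,1) this, of t]]
      show "\<Phi> p (state f y' \<pi>' w t, control \<pi>' w t) \<le> Q * q (n p') (state f y' \<pi>' w t, control \<pi>' w t) + e / 4"
        by linarith
    qed
    have r4: "total_reward L (\<lambda>x. Q * q (n p') x) y \<pi>'' \<le> total_reward L (\<Phi> p) y \<pi>'' + real L * (e / 4)"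
    proof (intro total_reward_mono y \<pi>'' \<Phi>c p qc')
      fix w t assume "w \<in> space P"
      from ap[OF trajectory_in[OF \<pi>'' y this, of t]]
      show "Q * q (n p') (state f y \<pi>'' w t, control \<pi>'' w t) \<le> \<Phi> p (state f y \<pi>'' w t, control \<pi>'' w t) + e / 4"
        by linarith
    qed
    \<comment> \<open>Four losses of \<open>real L * (e / 4)\<close> add up: near-optimality, the
      transfer to the state \<open>y\<close>, and two approximations by
      \<open>Q * q (n p')\<close>.\<close>
    have "Q * total_reward L (q (n p')) y' \<pi>' \<le> Q * (total_reward L (q (n p')) y \<pi>'' + real T * \<nu> (real T))"
      using r2 Q by (intro mult_left_mono) auto
    then have "real L * ((\<integral>x. \<Phi> p x \<partial>\<gamma>) - e) \<le> total_reward L (\<Phi> p) y \<pi>''"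
      using r1 r3 r4 T\<nu> unfolding total_reward_scale by (simp add: algebra_simps)
    then show "\<exists>\<pi>\<in>plans. real L * ((\<integral>x. \<Phi> p x \<partial>\<gamma>) - e) \<le> total_reward L (\<Phi> p) y \<pi>" using \<pi>'' by blast
  qed
qed

text \<open>Comparing with the supremum \<open>c p\<close> over stationary measures frees the plan
  from \<open>\<gamma>\<close>: a measure whose mean is within \<open>a\<close> of the supremum
  stands for all of them. Subtracting \<open>real L * c p\<close> also gives the measurable
  selection a constant threshold.\<close>

lemma uniform_reward_selection:
  fixes \<Phi> :: "'p::metric_space \<Rightarrow> 'y \<times> 'u \<Rightarrow> real"
  assumes q: "lipschitz_dense_sequence (Y \<times> U) q"
    and tr: "\<And>j. j \<ge> 1 \<Longrightarrow> \<exists>\<nu>. reward_transfer q j \<nu>"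
    and K: "compact K" and \<Phi>: "continuous_on (K \<times> Y \<times> U) (\<lambda>(p, x). \<Phi> p x)" and e: "e > 0"
    and W: "\<exists>\<gamma>. stationary \<gamma>"
  obtains L and idx :: "'p \<times> 'y \<Rightarrow> nat" and \<rho> where "L \<ge> 1" "idx \<in> borel \<rightarrow>\<^sub>M count_space UNIV"
    "\<And>i. \<rho> i \<in> plans" "\<And>p y \<gamma>. p \<in> K \<Longrightarrow> y \<in> Y \<Longrightarrow> stationary \<gamma> \<Longrightarrow>
      real L * ((\<integral>x. \<Phi> p x \<partial>\<gamma>) - e) \<le> total_reward L (\<Phi> p) y (\<rho> (idx (p, y)))"
proof -
  \<comment> \<open>Of the four quarters of \<open>e\<close>, the existence of a plan takes two, one
    for the horizon estimate and one for approximating the supremum; the other two pay for replacing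
    \<open>(p, y)\<close> by a nearby pair in the selection.\<close>
  define a where "a = e / 4"
  have a: "a > 0" using e by (simp add: a_def)
  have \<Phi>c: "continuous_on (Y \<times> U) (\<Phi> p)" if "p \<in> K" for p
    using continuous_on_compose2[OF \<Phi> continuous_on_Pair[OF continuous_on_const continuous_on_id], of p "Y \<times> U"] that
    by auto
  have cpt: "compact (K \<times> Y \<times> U)" by (intro compact_Times K compact_Y compact_U)
  obtain L where L: "L \<ge> 1" and LJ: "\<And>p \<gamma> y. p \<in> K \<Longrightarrow> stationary \<gamma> \<Longrightarrow> y \<in> Y \<Longrightarrow> \<exists>\<pi>\<in>plans.
    real L * ((\<integral>x. \<Phi> p x \<partial>\<gamma>) - a) \<le> total_reward L (\<Phi> p) y \<pi>"
    using uniform_reward[OF q tr K \<Phi> a] by blast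
  have Lpos: "real L > 0" using L by simp
  define c where "c p = (SUP \<gamma>\<in>Collect stationary. \<integral>x. \<Phi> p x \<partial>\<gamma>)" for p
  have bdd: "bdd_above ((\<lambda>\<gamma>. \<integral>x. \<Phi> p x \<partial>\<gamma>) ` Collect stationary)" if p: "p \<in> K" for p
  proof -
    obtain B where B: "\<And>x. x \<in> Y \<times> U \<Longrightarrow> norm (\<Phi> p x) \<le> B" using continuous_bounded[OF \<Phi>c[OF p]] by metis
    have "(\<integral>x. \<Phi> p x \<partial>\<gamma>) \<le> B" if \<gamma>: "stationary \<gamma>" for \<gamma>
    proof -
      interpret g: prob_space \<gamma> using \<gamma> by (simp add: stationary_def)
      have "(\<integral>x. \<Phi> p x \<partial>\<gamma>) \<le> (\<integral>x. B \<partial>\<gamma>)"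
        using B by (intro integral_mono stationary_integrable[OF \<gamma>] \<Phi>c p continuous_on_const)
          (force simp: stationary_space[OF \<gamma>] abs_le_iff)
      then show ?thesis by (simp add: g.prob_space)
    qed
    then show ?thesis by (auto simp: bdd_above_def)
  qed
  have cup: "(\<integral>x. \<Phi> p x \<partial>\<gamma>) \<le> c p" if "p \<in> K" "stationary \<gamma>" for p \<gamma>
    unfolding c_def using bdd[OF that(1)] that(2) by (intro cSUP_upper) auto
  have cle: "c p \<le> b" if "\<And>\<gamma>. stationary \<gamma> \<Longrightarrow> (\<integral>x. \<Phi> p x \<partial>\<gamma>) \<le> b" for p b
    unfolding c_def using W that by (intro cSUP_least) auto
  have ex: "\<exists>\<pi>\<in>plans. - (real L * (2 * a)) \<le> total_reward L (\<Phi> (fst x)) (snd x) \<pi> - real L * c (fst x)"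
    if x: "x \<in> K \<times> Y" for x
  proof (rule ccontr)
    assume neg: "\<not> ?thesis"
    have "c (fst x) \<le> c (fst x) - a"
    proof (rule cle)
      fix \<gamma> assume \<gamma>: "stationary \<gamma>"
      obtain \<pi> where \<pi>: "\<pi> \<in> plans" "real L * ((\<integral>z. \<Phi> (fst x) z \<partial>\<gamma>) - a) \<le> total_reward L (\<Phi> (fst x)) (snd x) \<pi>"
        using LJ[of "fst x" \<gamma> "snd x"] x \<gamma> by auto
      then have "total_reward L (\<Phi> (fst x)) (snd x) \<pi> < real L * (c (fst x) - 2 * a)"
        using neg by (auto simp: not_le algebra_simps)
      with \<pi>(2) have "real L * ((\<integral>z. \<Phi> (fst x) z \<partial>\<gamma>) - a) < real L * (c (fst x) - 2 * a)" by linarith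
      then have "(\<integral>z. \<Phi> (fst x) z \<partial>\<gamma>) - a < c (fst x) - 2 * a" using Lpos by (simp only: mult_less_cancel_left_pos)
      then show "(\<integral>z. \<Phi> (fst x) z \<partial>\<gamma>) \<le> c (fst x) - a" by simp
    qed
    then show False using a by simp
  qed
  have equi: "\<exists>r>0. \<forall>x\<in>K \<times> Y. \<forall>x'\<in>K \<times> Y. dist x x' < r \<longrightarrow> (\<forall>\<pi>\<in>plans.
      \<bar>(total_reward L (\<Phi> (fst x)) (snd x) \<pi> - real L * c (fst x)) -
        (total_reward L (\<Phi> (fst x')) (snd x') \<pi> - real L * c (fst x'))\<bar> \<le> real L * (2 * a))"
  proof -
    have "uniformly_continuous_on (K \<times> Y \<times> U) (\<lambda>(p, x). \<Phi> p x)" by (intro compact_uniformly_continuous \<Phi> cpt)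
    from this[unfolded uniformly_continuous_on_def, rule_format, OF a]
    obtain r where r: "r > 0" and rr: "\<And>a' b. a' \<in> K \<times> Y \<times> U \<Longrightarrow> b \<in> K \<times> Y \<times> U \<Longrightarrow> dist b a' < r \<Longrightarrow>
      dist (case b of (p, x) \<Rightarrow> \<Phi> p x) (case a' of (p, x) \<Rightarrow> \<Phi> p x) < a" by blast
    have near: "\<Phi> p (y, u) \<le> \<Phi> p' (y', u) + a"
      if "p \<in> K" "p' \<in> K" "dist p p' < r / 2" "(y, u) \<in> Y \<times> U" "(y', u) \<in> Y \<times> U" "dist y y' < r / 2" for p p' y y' u
    proof -
      have "dist (p, y, u) (p', y', u) \<le> dist p p' + dist y y'"
        by (simp add: dist_Pair_Pair sqrt_sum_squares_le_sum)
      then have "dist (p, y, u) (p', y', u) < r" using that by linarith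
      then show ?thesis using rr[of "(p', y', u)" "(p, y, u)"] that by (auto simp: dist_real_def)
    qed
    have r2: "r / 2 > 0" using r by simp
    obtain r' where "r' > 0" and r': "\<forall>y\<in>Y. \<forall>y'\<in>Y. dist y y' < r' \<longrightarrow> (\<forall>\<pi>\<in>plans. \<forall>w\<in>space P. \<forall>t<L.
      dist (state f y \<pi> w t) (state f y' \<pi> w t) < r / 2)" using state_equicontinuous[OF r2, of L] by blast
    have cl: "c p \<le> c p' + a" if h: "p \<in> K" "p' \<in> K" "dist p p' < r / 2" for p p'
    proof (rule cle)
      fix \<gamma> assume \<gamma>: "stationary \<gamma>"
      interpret g: prob_space \<gamma> using \<gamma> by (simp add: stationary_def)
      have "(\<integral>x. \<Phi> p x \<partial>\<gamma>) \<le> (\<integral>x. \<Phi> p' x + a \<partial>\<gamma>)"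
        using near[OF h] r by (intro integral_mono stationary_integrable[OF \<gamma>] continuous_on_add \<Phi>c h continuous_on_const)
          (auto simp: stationary_space[OF \<gamma>])
      also have "\<dots> = (\<integral>x. \<Phi> p' x \<partial>\<gamma>) + a"
        using stationary_integrable[OF \<gamma> \<Phi>c[OF h(2)]] by (simp add: g.prob_space)
      finally show "(\<integral>x. \<Phi> p x \<partial>\<gamma>) \<le> c p' + a" using cup[OF h(2) \<gamma>] by linarith
    qed
    have tl: "total_reward L (\<Phi> p) y \<pi> \<le> total_reward L (\<Phi> p') y' \<pi> + real L * a"
      if h: "p \<in> K" "p' \<in> K" "dist p p' < r / 2" "y \<in> Y" "y' \<in> Y" "dist y y' < r'" "\<pi> \<in> plans" for p p' y y' \<pi>
    proof (intro total_reward_mono h \<Phi>c)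
      fix w t assume w: "w \<in> space P" "t < L"
      show "\<Phi> p (state f y \<pi> w t, control \<pi> w t) \<le> \<Phi> p' (state f y' \<pi> w t, control \<pi> w t) + a"
        using r' h w by (intro near trajectory_in) auto
    qed
    have Lc: "real L * c p \<le> real L * c p' + real L * a" if h: "p \<in> K" "p' \<in> K" "dist p p' < r / 2" for p p'
    proof -
      have "real L * c p \<le> real L * (c p' + a)" using cl[OF h] by (intro mult_left_mono) auto
      then show ?thesis by (simp add: algebra_simps)
    qed
    show ?thesis
    proof (intro exI[of _ "min (r / 2) r'"] conjI ballI impI)
      show "0 < min (r / 2) r'" using r \<open>r' > 0\<close> by simp
      fix x x' \<pi> assume x: "x \<in> K \<times> Y" "x' \<in> K \<times> Y" "dist x x' < min (r / 2) r'" and \<pi>: "\<pi> \<in> plans"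
      have h: "fst x \<in> K" "fst x' \<in> K" "snd x \<in> Y" "snd x' \<in> Y" using x by auto
      have d: "dist (fst x) (fst x') < r / 2" "dist (snd x) (snd x') < r'"
        using x(3) dist_fst_le[of x x'] dist_snd_le[of x x'] by auto
      have d': "dist (fst x') (fst x) < r / 2" "dist (snd x') (snd x) < r'" using d by (auto simp: dist_commute)
      show "\<bar>(total_reward L (\<Phi> (fst x)) (snd x) \<pi> - real L * c (fst x)) -
        (total_reward L (\<Phi> (fst x')) (snd x') \<pi> - real L * c (fst x'))\<bar> \<le> real L * (2 * a)"
        using tl[OF h(1,2) d(1) h(3,4) d(2) \<pi>] tl[OF h(2,1) d'(1) h(4,3) d'(2) \<pi>] Lc[OF h(1,2) d(1)] Lc[OF h(2,1) d'(1)]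
        by (simp add: abs_le_iff algebra_simps)
    qed
  qed
  obtain idx :: "'p \<times> 'y \<Rightarrow> nat" and \<rho> where idx: "idx \<in> borel \<rightarrow>\<^sub>M count_space UNIV" and \<rho>: "\<And>i. \<rho> i \<in> plans"
    and opt: "\<And>x. x \<in> K \<times> Y \<Longrightarrow> - (real L * (2 * a)) - real L * (2 * a) \<le>
      total_reward L (\<Phi> (fst x)) (snd x) (\<rho> (idx x)) - real L * c (fst x)"
  proof (rule finite_measurable_selection[where J = "\<lambda>x \<pi>. total_reward L (\<Phi> (fst x)) (snd x) \<pi> - real L * c (fst x)",
          OF compact_Times[OF K compact_Y] equi ex plans_nonempty])
    fix idx :: "'p \<times> 'y \<Rightarrow> nat" and \<rho>
    assume "idx \<in> borel \<rightarrow>\<^sub>M count_space UNIV" "\<And>i. \<rho> i \<in> plans" "\<And>x. x \<in> K \<times> Y \<Longrightarrow>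
      - (real L * (2 * a)) - real L * (2 * a) \<le> total_reward L (\<Phi> (fst x)) (snd x) (\<rho> (idx x)) - real L * c (fst x)"
    then show thesis by (rule that)
  qed
  show thesis
  proof (rule that[OF L idx \<rho>])
    fix p y \<gamma> assume h: "p \<in> K" "y \<in> Y" "stationary \<gamma>"
    have "real L * (\<integral>x. \<Phi> p x \<partial>\<gamma>) \<le> real L * c p" using cup[OF h(1,3)] by (intro mult_left_mono) auto
    then show "real L * ((\<integral>x. \<Phi> p x \<partial>\<gamma>) - e) \<le> total_reward L (\<Phi> p) y (\<rho> (idx (p, y)))"
      using opt[of "(p, y)"] h by (simp add: a_def algebra_simps)
  qed
qed

section \<open>The deviation over blocks and its second moment\<close>

text \<open>In the application \<open>\<zeta> i\<close> is \<open>zbar\<close> at the start of block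
  \<open>i\<close> and \<open>v i\<close> its increment over that block. Admitting arbitrary
  sequences keeps the approachability argument free of continuous time.\<close>

definition deviation ::
  "('z::euclidean_space \<times> 'y \<times> 'u \<Rightarrow> 'z) \<Rightarrow> real \<Rightarrow> nat \<Rightarrow> (nat \<Rightarrow> 'z) \<Rightarrow> (nat \<Rightarrow> 'z) \<Rightarrow> 'y \<Rightarrow>
    (nat \<Rightarrow> (nat \<Rightarrow> 's) \<Rightarrow> 'u) \<Rightarrow> nat \<Rightarrow> (nat \<Rightarrow> 's) \<Rightarrow> 'z" where
  "deviation g \<epsilon> L \<zeta> v y \<pi> k w =
    (\<Sum>i<k. \<epsilon> *\<^sub>R (\<Sum>r<L. g (\<zeta> i, state f y \<pi> w (i * L + r), control \<pi> w (i * L + r))) - v i)"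

lemma block_index_less: "i < k \<Longrightarrow> r < L \<Longrightarrow> i * L + r < k * (L::nat)"
  by (metis add.commute mult_Suc mult_le_mono1 nat_add_left_cancel_less order_less_le_trans Suc_leI)

text \<open>The deviation is known when block \<open>k\<close> begins, so the plan for that block
  may depend on it.\<close>

lemma deviation_cong:
  assumes "\<And>i. i < k * L \<Longrightarrow> w i = w' i"
  shows "deviation g \<epsilon> L \<zeta> v y \<pi> k w = deviation g \<epsilon> L \<zeta> v y \<pi> k w'"
  unfolding deviation_def
proof (intro sum.cong refl arg_cong2[where f = minus] arg_cong[where f = "scaleR \<epsilon>"])
  fix i r assume "i \<in> {..<k}" "r \<in> {..<L}"
  then have "i * L + r < k * L" by (auto intro: block_index_less)
  then have "\<And>j. j < i * L + r \<Longrightarrow> w j = w' j" using assms by auto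
  then show "g (\<zeta> i, state f y \<pi> w (i * L + r), control \<pi> w (i * L + r)) =
      g (\<zeta> i, state f y \<pi> w' (i * L + r), control \<pi> w' (i * L + r))"
    using state_cong[of "i * L + r" w w' y \<pi>] control_cong[of "i * L + r" w w' \<pi>] by simp
qed

lemma block_average_bound:
  fixes a :: "nat \<Rightarrow> 'z::real_normed_vector"
  assumes "\<And>r. r < L \<Longrightarrow> norm (a r) \<le> R" "norm v \<le> R * (\<epsilon> * real L)" "\<epsilon> \<ge> 0"
  shows "norm (\<epsilon> *\<^sub>R (\<Sum>r<L. a r) - v) \<le> 2 * R * (\<epsilon> * real L)"
proof -
  have "norm (\<Sum>r<L. a r) \<le> (\<Sum>r<L. R)" using assms(1) by (intro sum_norm_le) auto
  then have "\<epsilon> * norm (\<Sum>r<L. a r) \<le> \<epsilon> * (real L * R)" using assms(3) by (intro mult_left_mono) auto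
  then show ?thesis
    using assms(2,3) norm_triangle_ineq4[of "\<epsilon> *\<^sub>R (\<Sum>r<L. a r)" v] by (simp add: algebra_simps)
qed

text \<open>When all blocks together last at most unit time, this confines the deviation to
  \<open>cball 0 (2 * R)\<close>, the compact set of directions for which continuations are
  prepared.\<close>

lemma deviation_bound:
  assumes "\<pi> \<in> plans" "y \<in> Y" "\<epsilon> \<ge> 0" and \<zeta>: "\<And>i. i < k \<Longrightarrow> \<zeta> i \<in> Z"
    and v: "\<And>i. i < k \<Longrightarrow> norm (v i) \<le> R * (\<epsilon> * real L)"
    and gR: "\<And>z x. z \<in> Z \<Longrightarrow> x \<in> Y \<times> U \<Longrightarrow> norm (g (z, x)) \<le> R"
    and w: "\<And>i. i < k * L \<Longrightarrow> w i \<in> S"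
  shows "norm (deviation g \<epsilon> L \<zeta> v y \<pi> k w) \<le> real k * (2 * R * (\<epsilon> * real L))"
proof -
  have "norm (deviation g \<epsilon> L \<zeta> v y \<pi> k w) \<le> (\<Sum>i<k. 2 * R * (\<epsilon> * real L))"
    unfolding deviation_def
  proof (intro sum_norm_le block_average_bound v assms(3))
    fix i r assume i: "i \<in> {..<k}" and r: "r < L"
    then have lt: "i * L + r < k * L" by (auto intro: block_index_less)
    then have "\<And>j. j < i * L + r \<Longrightarrow> w j \<in> S" using w by auto
    then show "norm (g (\<zeta> i, state f y \<pi> w (i * L + r), control \<pi> w (i * L + r))) \<le> R"
      using i by (intro gR \<zeta> SigmaI state_in control_in assms) (use lt in auto)
  qed auto
  then show ?thesis by simp
qed

lemma deviation_measurable: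
  assumes "\<pi> \<in> plans" "y \<in> Y" "{..<k * L} \<subseteq> I" and g: "\<And>i. i < k \<Longrightarrow> continuous_on (Y \<times> U) (\<lambda>x. g (\<zeta> i, x))"
  shows "deviation g \<epsilon> L \<zeta> v y \<pi> k \<in> borel_measurable (history I)"
proof -
  have "(\<lambda>w. g (\<zeta> i, state f y \<pi> w (i * L + r), control \<pi> w (i * L + r))) \<in> borel_measurable (history I)"
    if "i < k" "r < L" for i r
    using block_index_less[OF that] assms(3) by (intro trajectory_measurable[OF assms(1,2) _ g[OF that(1)]]) force
  then show ?thesis unfolding deviation_def[abs_def]
    by (intro borel_measurable_sum borel_measurable_diff borel_measurable_scaleR borel_measurable_const) auto
qed

lemma deviation_concat_le:
  assumes "k \<le> N"
  shows "deviation g \<epsilon> L \<zeta> v y (concat_plan (N * L) \<pi> idx \<rho>) k w = deviation g \<epsilon> L \<zeta> v y \<pi> k w"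
  unfolding deviation_def
proof (intro sum.cong refl arg_cong2[where f = minus] arg_cong[where f = "scaleR \<epsilon>"])
  fix i r assume "i \<in> {..<k}" "r \<in> {..<L}"
  then have "i * L + r < N * L" using assms by (intro block_index_less) auto
  then show "g (\<zeta> i, state f y (concat_plan (N * L) \<pi> idx \<rho>) w (i * L + r), control (concat_plan (N * L) \<pi> idx \<rho>) w (i * L + r)) =
      g (\<zeta> i, state f y \<pi> w (i * L + r), control \<pi> w (i * L + r))"
    by (simp add: control_concat_less state_concat_le)
qed

text \<open>If \<open>A\<close> is the increment of \<open>D\<close> over a block, the squared norm
  of \<open>D + A\<close> contains the cross term \<open>2 * (D \<bullet> A)\<close>, which the plan
  makes nearly nonpositive in the mean, and a square of order \<open>h\<^sup>2\<close> with
  \<open>h = \<epsilon> * real L\<close>. The assumption \<open>vdir\<close> expresses through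
  support functions that \<open>v i\<close> divided by \<open>h\<close> is within
  \<open>\<delta>\<close> of the closed convex hull of the averaged velocities at
  \<open>\<zeta> i\<close>.\<close>

lemma tracking_plan:
  fixes g :: "'z::euclidean_space \<times> 'y \<times> 'u \<Rightarrow> 'z" and idx :: "('z \<times> 'z) \<times> 'y \<Rightarrow> nat"
  assumes L: "L \<ge> 1" and idx: "idx \<in> borel \<rightarrow>\<^sub>M count_space UNIV" and \<rho>: "\<And>i. \<rho> i \<in> plans"
    and opt: "\<And>p y \<gamma>. p \<in> cball 0 (2 * R) \<times> Z \<Longrightarrow> y \<in> Y \<Longrightarrow> stationary \<gamma> \<Longrightarrow>
      real L * ((\<integral>x. fst p \<bullet> g (snd p, x) \<partial>\<gamma>) - e) \<le>
        total_reward L (\<lambda>x. fst p \<bullet> g (snd p, x)) y (\<rho> (idx (p, y)))"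
    and Z: "compact Z" and g: "continuous_on (Z \<times> Y \<times> U) g"
    and gR: "\<And>z x. z \<in> Z \<Longrightarrow> x \<in> Y \<times> U \<Longrightarrow> norm (g (z, x)) \<le> R" and R: "R \<ge> 0"
    and y: "y \<in> Y" and \<epsilon>: "\<epsilon> > 0" and \<delta>: "\<delta> \<ge> 0"
    and N: "real N * (\<epsilon> * real L) \<le> 1"
    and \<zeta>: "\<And>i. i < N \<Longrightarrow> \<zeta> i \<in> Z"
    and v: "\<And>i. i < N \<Longrightarrow> norm (v i) \<le> R * (\<epsilon> * real L)"
    and vdir: "\<And>i l c. i < N \<Longrightarrow> (\<And>\<gamma>. stationary \<gamma> \<Longrightarrow> (\<integral>x. l \<bullet> g (\<zeta> i, x) \<partial>\<gamma>) \<le> c) \<Longrightarrow>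
      l \<bullet> v i \<le> (\<epsilon> * real L) * (c + norm l * \<delta>)"
  shows "\<exists>\<pi>\<in>plans. \<forall>k\<le>N. (\<integral>w. (norm (deviation g \<epsilon> L \<zeta> v y \<pi> k w))\<^sup>2 \<partial>P) \<le>
    real k * (\<epsilon> * real L * (2 * e + 4 * R * \<delta> + 4 * R\<^sup>2 * (\<epsilon> * real L)))"
proof -
  interpret PP: prob_space P by (rule prob_P)
  define h where "h = \<epsilon> * real L"
  have h: "h > 0" using \<epsilon> L by (simp add: h_def)
  \<comment> \<open>Twice the mean cross term, \<open>2 * h * (e + 2 * R * \<delta>)\<close>, plus
    the bound \<open>(2 * R * h)\<^sup>2\<close> of the squared increment.\<close>
  define b where "b = h * (2 * e + 4 * R * \<delta> + 4 * R\<^sup>2 * h)"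
  define D where "D = deviation g \<epsilon> L \<zeta> v y"
  have gc: "continuous_on (Y \<times> U) (\<lambda>x. g (z, x))" if "z \<in> Z" for z
    by (rule continuous_on_compose2[OF g]) (use that in \<open>auto intro!: continuous_intros\<close>)
  have gcl: "continuous_on (Y \<times> U) (\<lambda>x. l \<bullet> g (z, x))" if "z \<in> Z" for z l
    by (intro continuous_intros gc that)
  have Dm: "D \<pi> k \<in> borel_measurable (history I)" if "\<pi> \<in> plans" "k \<le> N" "{..<k * L} \<subseteq> I" for \<pi> k I
    unfolding D_def using that by (intro deviation_measurable y gc \<zeta>) auto
  have DmP: "D \<pi> k \<in> borel_measurable P" if "\<pi> \<in> plans" "k \<le> N" for \<pi> k
    unfolding measurable_P using that by (intro Dm) auto
  have Db: "norm (D \<pi> k w) \<le> 2 * R" if "\<pi> \<in> plans" "k \<le> N" "\<And>i. i < k * L \<Longrightarrow> w i \<in> S" for \<pi> k w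
  proof -
    have "norm (D \<pi> k w) \<le> real k * (2 * R * (\<epsilon> * real L))"
      unfolding D_def using that \<epsilon> by (intro deviation_bound[where Z = Z] y \<zeta> v gR) auto
    also have "\<dots> \<le> real N * (2 * R * (\<epsilon> * real L))" using that R \<epsilon> by (intro mult_right_mono) auto
    also have "\<dots> = 2 * R * (real N * (\<epsilon> * real L))" by simp
    also have "\<dots> \<le> 2 * R * 1" using R N by (intro mult_left_mono) auto
    finally show ?thesis by simp
  qed
  have DbP: "norm (D \<pi> k w) \<le> 2 * R" if "\<pi> \<in> plans" "k \<le> N" "w \<in> space P" for \<pi> k w
    using that by (intro Db) (auto simp: space_P)
  have Dsq: "(norm (D \<pi> k w))\<^sup>2 \<le> (2 * R)\<^sup>2" if "\<pi> \<in> plans" "k \<le> N" "w \<in> space P" for \<pi> k w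
    using DbP[OF that] by (intro power_mono) auto
  have Dint: "integrable P (\<lambda>w. (norm (D \<pi> k w))\<^sup>2)" if "\<pi> \<in> plans" "k \<le> N" for \<pi> k
  proof (rule PP.integrable_const_bound[where B = "(2 * R)\<^sup>2"])
    show "(\<lambda>w. (norm (D \<pi> k w))\<^sup>2) \<in> borel_measurable P"
      by (intro borel_measurable_power measurable_compose[OF DmP[OF that] borel_measurable_norm])
  qed (use Dsq[OF that] in auto)
  \<comment> \<open>Only the tail of the plan changes, so the bounds at earlier block ends survive
    and the induction yields one plan for all \<open>k\<close>.\<close>
  have step: "\<exists>\<pi>'\<in>plans. (\<forall>k\<le>n. \<forall>w. D \<pi>' k w = D \<pi> k w) \<and>
      (\<integral>w. (norm (D \<pi>' (Suc n) w))\<^sup>2 \<partial>P) \<le> (\<integral>w. (norm (D \<pi> n w))\<^sup>2 \<partial>P) + b"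
    if \<pi>: "\<pi> \<in> plans" and n: "Suc n \<le> N" for \<pi> n
  proof -
    \<comment> \<open>The first component is minus the deviation: a large mean of its inner product
      with \<open>g\<close> pushes the deviation back towards 0.\<close>
    define par where "par w = (- D \<pi> n w, \<zeta> n)" for w
    define i0 where "i0 w = idx (par w, state f y \<pi> w (n * L))" for w
    define \<pi>' where "\<pi>' = concat_plan (n * L) \<pi> i0 \<rho>"
    have nN: "n < N" "n \<le> N" using n by auto
    have parK: "par w \<in> cball 0 (2 * R) \<times> Z" if "\<And>i. i < n * L \<Longrightarrow> w i \<in> S" for w
      using Db[OF \<pi> nN(2) that] \<zeta>[OF nN(1)] by (auto simp: par_def)
    have parm: "par \<in> history {..<n * L} \<rightarrow>\<^sub>M borel_on (cball 0 (2 * R) \<times> Z)"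
    proof (rule measurable_restrict_space2)
      show "par \<in> space (history {..<n * L}) \<rightarrow> cball 0 (2 * R) \<times> Z"
        by (intro Pi_I parK) (auto simp: space_history PiE_iff)
      show "par \<in> borel_measurable (history {..<n * L})"
        unfolding par_def[abs_def] by (intro borel_measurable_Pair borel_measurable_uminus Dm \<pi> nN borel_measurable_const order_refl)
    qed
    have "(\<lambda>w. (par w, state f y \<pi> w (n * L))) \<in> history {..<n * L} \<rightarrow>\<^sub>M borel_on ((cball 0 (2 * R) \<times> Z) \<times> Y)"
      by (intro measurable_Pair_compact parm state_measurable \<pi> y order_refl compact_Times compact_cball Z compact_Y)
    then have "i0 \<in> history {..<n * L} \<rightarrow>\<^sub>M count_space UNIV"
      unfolding i0_def[abs_def] by (rule measurable_compose[OF _ measurable_restrict_space1[OF idx]])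
    then have \<pi>': "\<pi>' \<in> plans" unfolding \<pi>'_def by (intro concat_plan_in \<pi> \<rho>)
    have same: "D \<pi>' k w = D \<pi> k w" if "k \<le> n" for k w
      unfolding D_def \<pi>'_def by (rule deviation_concat_le[OF that])
    define F where "F w = (norm (D \<pi>' (Suc n) w))\<^sup>2" for w
    have Fm: "F \<in> borel_measurable P"
      unfolding F_def[abs_def] by (intro borel_measurable_power measurable_compose[OF DmP[OF \<pi>' n] borel_measurable_norm])
    have Fb: "\<bar>F w\<bar> \<le> (2 * R)\<^sup>2" if "w \<in> space P" for w
      using Dsq[OF \<pi>' n that] by (simp add: F_def)
    \<comment> \<open>With the past \<open>w\<close> frozen, the block is a control problem from the
      known state \<open>y'\<close>, with the prepared plan \<open>\<rho>'\<close> and fresh noise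
      \<open>w'\<close>.\<close>
    have inner: "(\<integral>w'. F (comb_seq (n * L) w w') \<partial>P) \<le> (norm (D \<pi> n w))\<^sup>2 + b" if w: "w \<in> space P" for w
    proof -
      define d where "d = D \<pi> n w"
      define y' where "y' = state f y \<pi> w (n * L)"
      define \<rho>' where "\<rho>' = \<rho> (idx (par w, y'))"
      define A where "A w' = \<epsilon> *\<^sub>R (\<Sum>r<L. g (\<zeta> n, state f y' \<rho>' w' r, control \<rho>' w' r)) - v n" for w'
      have wS: "w i \<in> S" for i using w by (auto simp: space_P)
      have y': "y' \<in> Y" unfolding y'_def by (intro state_in \<pi> y wS)
      have \<rho>': "\<rho>' \<in> plans" unfolding \<rho>'_def by (rule \<rho>)
      have p: "par w \<in> cball 0 (2 * R) \<times> Z" by (intro parK wS)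
      have eqD: "D \<pi>' (Suc n) (comb_seq (n * L) w w') = d + A w'" for w'
      proof -
        define c where "c = comb_seq (n * L) w w'"
        have cw: "c i = w i" if "i < n * L" for i using that by (simp add: c_def comb_seq_def)
        have sh: "(\<lambda>i. c (n * L + i)) = w'" by (auto simp: c_def comb_seq_def fun_eq_iff)
        have "D \<pi> n (restrict c {..<n * L}) = D \<pi> n w" unfolding D_def using cw by (intro deviation_cong) auto
        moreover have "state f y \<pi> (restrict c {..<n * L}) (n * L) = y'"
          unfolding y'_def using cw by (intro state_cong) auto
        ultimately have i: "\<rho> (i0 (restrict c {..<n * L})) = \<rho>'"
          by (simp add: i0_def par_def \<rho>'_def)
        have st: "state f y \<pi> c (n * L) = y'" unfolding y'_def using cw by (intro state_cong) auto
        have "state f y \<pi>' c (n * L + r) = state f y' \<rho>' w' r" "control \<pi>' c (n * L + r) = control \<rho>' w' r" for r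
          unfolding \<pi>'_def state_concat_add control_concat_add i sh st by simp_all
        moreover have "D \<pi> n c = D \<pi> n w" unfolding D_def using cw by (intro deviation_cong) auto
        then have "D \<pi>' n c = d" unfolding d_def by (subst same) auto
        ultimately show ?thesis unfolding c_def[symmetric]
          by (simp add: D_def deviation_def[of g \<epsilon> L \<zeta> v y \<pi>' "Suc n"] deviation_def[of g \<epsilon> L \<zeta> v y \<pi>' n] A_def)
      qed
      define \<phi> where "\<phi> = (\<lambda>x. fst (par w) \<bullet> g (snd (par w), x))"
      have \<phi>: "\<phi> x = - d \<bullet> g (\<zeta> n, x)" for x by (simp add: \<phi>_def par_def d_def)
      have \<phi>c: "continuous_on (Y \<times> U) \<phi>" unfolding \<phi>_def using p by (intro gcl) auto
      have pw: "F (comb_seq (n * L) w w') \<le> (norm d)\<^sup>2 + 2 * (- d \<bullet> v n) + (2 * R * h)\<^sup>2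
          + (- 2 * \<epsilon>) * (\<Sum>r<L. \<phi> (state f y' \<rho>' w' r, control \<rho>' w' r))" if w': "w' \<in> space P" for w'
      proof -
        have "norm (A w') \<le> 2 * R * h" unfolding A_def h_def
          using \<epsilon> \<zeta>[OF nN(1)] trajectory_in[OF \<rho>' y' w'] by (intro block_average_bound v nN gR) auto
        then have A2: "(norm (A w'))\<^sup>2 \<le> (2 * R * h)\<^sup>2" by (intro power_mono) auto
        have dA: "d \<bullet> A w' = - \<epsilon> * (\<Sum>r<L. \<phi> (state f y' \<rho>' w' r, control \<rho>' w' r)) - d \<bullet> v n"
          unfolding A_def \<phi> by (simp add: inner_diff_right inner_sum_right sum_negf)
        have "F (comb_seq (n * L) w w') = (norm d)\<^sup>2 + 2 * (d \<bullet> A w') + (norm (A w'))\<^sup>2"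
          unfolding F_def eqD by (simp add: power2_norm_eq_inner inner_add_left inner_add_right inner_commute)
        then show ?thesis using A2 dA by (simp add: algebra_simps)
      qed
      have Jint: "integrable P (\<lambda>w'. \<Sum>r<L. \<phi> (state f y' \<rho>' w' r, control \<rho>' w' r))"
        by (intro Bochner_Integration.integrable_sum trajectory_integrable \<rho>' y' \<phi>c)
      have Fint: "integrable P (\<lambda>w'. F (comb_seq (n * L) w w'))"
      proof (rule PP.integrable_const_bound[where B = "(2 * R)\<^sup>2"])
        have cs: "comb_seq (n * L) w w' \<in> space P" if "w' \<in> space P" for w'
          using that w by (auto simp: space_P comb_seq_def)
        show "AE w' in P. norm (F (comb_seq (n * L) w w')) \<le> (2 * R)\<^sup>2"
          using Fb cs by (intro AE_I2) auto
        show "(\<lambda>w'. F (comb_seq (n * L) w w')) \<in> borel_measurable P"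
          by (intro measurable_compose[OF _ Fm] measurable_comb_seq' measurable_const w measurable_ident_sets refl)
      qed
      have "(\<integral>w'. F (comb_seq (n * L) w w') \<partial>P) \<le> (\<integral>w'. ((norm d)\<^sup>2 + 2 * (- d \<bullet> v n) + (2 * R * h)\<^sup>2)
          + (- 2 * \<epsilon>) * (\<Sum>r<L. \<phi> (state f y' \<rho>' w' r, control \<rho>' w' r)) \<partial>P)"
        using Jint pw by (intro integral_mono Fint Bochner_Integration.integrable_add PP.integrable_const
            Bochner_Integration.integrable_mult_right) auto
      also have "\<dots> = (norm d)\<^sup>2 + 2 * (- d \<bullet> v n) + (2 * R * h)\<^sup>2 - 2 * \<epsilon> * total_reward L \<phi> y' \<rho>'"
        using Jint by (simp add: PP.prob_space total_reward_def)
      \<comment> \<open>By the choice of the continuation, all stationary means of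
        \<open>- d \<bullet> g\<close> are at most the achieved reward per step plus
        \<open>e\<close>, so \<open>vdir\<close> applies with that bound as \<open>c\<close>. As
        \<open>h = \<epsilon> * real L\<close>, the reward then cancels against the last term of the
        preceding line.\<close>
      also have "- d \<bullet> v n \<le> h * (total_reward L \<phi> y' \<rho>' / real L + e + norm (- d) * \<delta>)"
        unfolding h_def
      proof (rule vdir[OF nN(1)])
        fix \<gamma> assume \<gamma>: "stationary \<gamma>"
        have "real L * ((\<integral>x. \<phi> x \<partial>\<gamma>) - e) \<le> total_reward L \<phi> y' \<rho>'"
          unfolding \<phi>_def \<rho>'_def by (rule opt[OF p y' \<gamma>])
        then show "(\<integral>x. - d \<bullet> g (\<zeta> n, x) \<partial>\<gamma>) \<le> total_reward L \<phi> y' \<rho>' / real L + e"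
          using L unfolding \<phi> by (simp add: field_simps)
      qed
      also have "h * (total_reward L \<phi> y' \<rho>' / real L + e + norm (- d) * \<delta>) =
          \<epsilon> * total_reward L \<phi> y' \<rho>' + h * (e + norm d * \<delta>)"
        using L by (simp add: h_def field_simps)
      also have "norm d * \<delta> \<le> 2 * R * \<delta>"
        using DbP[OF \<pi> nN(2) w] \<delta> unfolding d_def by (intro mult_right_mono)
      finally show ?thesis using h by (simp add: b_def d_def[symmetric] power2_eq_square algebra_simps)
    qed
    have "(\<integral>w. F w \<partial>P) = (\<integral>w. \<integral>w'. F (comb_seq (n * L) w w') \<partial>P \<partial>P)"
      by (rule integral_P_split(2)[OF Fm Fb])
    also have "\<dots> \<le> (\<integral>w. (norm (D \<pi> n w))\<^sup>2 + b \<partial>P)"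
      by (intro integral_mono integral_P_split(1)[OF Fm Fb] Bochner_Integration.integrable_add Dint \<pi> nN
          PP.integrable_const inner)
    also have "\<dots> = (\<integral>w. (norm (D \<pi> n w))\<^sup>2 \<partial>P) + b" using Dint[OF \<pi> nN(2)] by (simp add: PP.prob_space)
    finally show ?thesis using \<pi>' same unfolding F_def by blast
  qed
  have "\<exists>\<pi>\<in>plans. \<forall>k\<le>n. (\<integral>w. (norm (D \<pi> k w))\<^sup>2 \<partial>P) \<le> real k * b" if "n \<le> N" for n
    using that
  proof (induction n)
    case 0
    then show ?case using plans_nonempty by (auto simp: D_def deviation_def)
  next
    case (Suc n)
    then obtain \<pi> where \<pi>: "\<pi> \<in> plans" and B: "\<And>k. k \<le> n \<Longrightarrow> (\<integral>w. (norm (D \<pi> k w))\<^sup>2 \<partial>P) \<le> real k * b"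
      by auto
    obtain \<pi>' where \<pi>': "\<pi>' \<in> plans" and same: "\<And>k w. k \<le> n \<Longrightarrow> D \<pi>' k w = D \<pi> k w"
      and new: "(\<integral>w. (norm (D \<pi>' (Suc n) w))\<^sup>2 \<partial>P) \<le> (\<integral>w. (norm (D \<pi> n w))\<^sup>2 \<partial>P) + b"
      using step[OF \<pi> Suc.prems] by blast
    have "(\<integral>w. (norm (D \<pi>' k w))\<^sup>2 \<partial>P) \<le> real k * b" if "k \<le> Suc n" for k
    proof (cases "k = Suc n")
      case True
      then show ?thesis using new B[of n] by (simp add: algebra_simps)
    next
      case False
      then show ?thesis using that B[of k] same[of k] by simp
    qed
    then show ?case using \<pi>' by blast
  qed
  from this[OF order_refl] show ?thesis unfolding D_def b_def h_def .
qed

subsection \<open>Comparison of trajectories\<close>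

lemma hybrid_path_estimate:
  fixes g :: "'z::euclidean_space \<times> 'y \<times> 'u \<Rightarrow> 'z"
  assumes hyb: "hybrid_solution f g y z0 \<epsilon> \<pi> w ze" and zeZ: "\<And>s. s \<in> {0..1} \<Longrightarrow> ze s \<in> Z"
    and zbZ: "\<And>s. s \<in> {0..1} \<Longrightarrow> zb s \<in> Z" and zb0: "zb 0 = z0"
    and zbL: "\<And>a b. 0 \<le> a \<Longrightarrow> a \<le> b \<Longrightarrow> b \<le> 1 \<Longrightarrow> norm (zb b - zb a) \<le> R * (b - a)"
    and lip: "\<And>z1 z2 x. z1 \<in> Z \<Longrightarrow> z2 \<in> Z \<Longrightarrow> x \<in> Y \<times> U \<Longrightarrow> norm (g (z1, x) - g (z2, x)) \<le> C * norm (z1 - z2)"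
    and gR: "\<And>z x. z \<in> Z \<Longrightarrow> x \<in> Y \<times> U \<Longrightarrow> norm (g (z, x)) \<le> R"
    and \<pi>: "\<pi> \<in> plans" and y: "y \<in> Y" and w: "w \<in> space P"
    and \<epsilon>: "\<epsilon> > 0" and L: "L \<ge> 1" and R: "R \<ge> 0" and C: "C \<ge> 0" and s: "s \<in> {0..1}"
    and h_def: "h = \<epsilon> * real L"
    and a_def: "\<And>i. a i = norm (deviation g \<epsilon> L (\<lambda>i. zb (real i * h))
        (\<lambda>i. zb (real (Suc i) * h) - zb (real i * h)) y \<pi> i w) + C * R * h"
  shows "norm (ze s - zb s) \<le>
    a (nat \<lfloor>s / h\<rfloor>) + C * h * ((1 + C * h) ^ nat \<lfloor>s / h\<rfloor> * (\<Sum>i<nat \<lfloor>s / h\<rfloor>. a i)) + 2 * R * h"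
proof -
  define x where "x t = (state f y \<pi> w t, control \<pi> w t)" for t
  have xin: "x t \<in> Y \<times> U" for t unfolding x_def by (rule trajectory_in[OF \<pi> y w])
  have h: "h > 0" using \<epsilon> L by (simp add: h_def)
  have ac: "absolutely_continuous_fun_on {0..1} ze" and ze0: "ze 0 = z0"
    and ae: "AE r in lborel. r \<in> {0..1} \<longrightarrow> (ze has_vector_derivative g (ze r, x (nat \<lfloor>r / \<epsilon>\<rfloor>))) (at r)"
    using hyb unfolding hybrid_solution_def inclusion_solution_def x_def by auto
  have zeL: "norm (ze b - ze a) \<le> R * (b - a)" if "0 \<le> a" "a \<le> b" "b \<le> 1" for a b
  proof -
    have "norm (ze b - ze a - (b - a) *\<^sub>R 0) \<le> R * (b - a)"
    proof (rule absolutely_continuous_norm_mean_value[OF ac _ that(2) R])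
      show "AE s in lborel. s \<in> {a<..<b} \<longrightarrow> (\<exists>v. norm (v - 0) \<le> R \<and> (ze has_vector_derivative v) (at s))"
        using ae
      proof eventually_elim
        case (elim r)
        then show ?case using that gR[OF zeZ xin] by (auto intro!: exI[of _ "g (ze r, x (nat \<lfloor>r / \<epsilon>\<rfloor>))"])
      qed
    qed (use that in auto)
    then show ?thesis by simp
  qed
  have micro: "norm (ze (\<epsilon> * real (Suc t)) - ze (\<epsilon> * real t) - \<epsilon> *\<^sub>R g (\<zeta>, x t)) \<le> \<epsilon> * (C * m)"
    if t: "\<epsilon> * real (Suc t) \<le> 1" and \<zeta>: "\<zeta> \<in> Z" and m: "m \<ge> 0"
      "\<And>r. r \<in> {\<epsilon> * real t..\<epsilon> * real (Suc t)} \<Longrightarrow> norm (ze r - \<zeta>) \<le> m" for t \<zeta> m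
  proof -
    have t0: "0 \<le> \<epsilon> * real t" using \<epsilon> by simp
    have le: "\<epsilon> * real t \<le> \<epsilon> * real (Suc t)" using \<epsilon> by simp
    have "norm (ze (\<epsilon> * real (Suc t)) - ze (\<epsilon> * real t) - (\<epsilon> * real (Suc t) - \<epsilon> * real t) *\<^sub>R g (\<zeta>, x t)) \<le>
        (C * m) * (\<epsilon> * real (Suc t) - \<epsilon> * real t)"
    proof (rule absolutely_continuous_norm_mean_value[OF ac _ le])
      show "{\<epsilon> * real t..\<epsilon> * real (Suc t)} \<subseteq> {0..1}" using t t0 by auto
      show "0 \<le> C * m" using C m by simp
      show "AE r in lborel. r \<in> {\<epsilon> * real t<..<\<epsilon> * real (Suc t)} \<longrightarrow>
          (\<exists>v. norm (v - g (\<zeta>, x t)) \<le> C * m \<and> (ze has_vector_derivative v) (at r))"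
        using ae
      proof eventually_elim
        case (elim r)
        show ?case
        proof
          assume r: "r \<in> {\<epsilon> * real t<..<\<epsilon> * real (Suc t)}"
          then have r01: "r \<in> {0..1}" using t t0 by auto
          have "\<lfloor>r / \<epsilon>\<rfloor> = int t" using r \<epsilon> by (intro floor_unique) (auto simp: field_simps)
          then have d: "(ze has_vector_derivative g (ze r, x t)) (at r)" using elim r01 by simp
          have "norm (g (ze r, x t) - g (\<zeta>, x t)) \<le> C * norm (ze r - \<zeta>)" by (intro lip zeZ r01 \<zeta> xin)
          also have "\<dots> \<le> C * m" using m(2)[of r] r C by (intro mult_left_mono) auto
          finally show "\<exists>v. norm (v - g (\<zeta>, x t)) \<le> C * m \<and> (ze has_vector_derivative v) (at r)" using d by blast
        qed
      qed
    qed
    moreover have "\<epsilon> * real (Suc t) - \<epsilon> * real t = \<epsilon>" by (simp add: algebra_simps)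
    ultimately show ?thesis by (simp add: mult.commute)
  qed
  define d where "d k = norm (ze (real k * h) - zb (real k * h))" for k
  define D where "D k = deviation g \<epsilon> L (\<lambda>i. zb (real i * h)) (\<lambda>i. zb (real (Suc i) * h) - zb (real i * h)) y \<pi> k w" for k
  have kh0: "0 \<le> real k * h" for k using h by simp
  have block: "norm (ze (real (Suc k) * h) - ze (real k * h) - \<epsilon> *\<^sub>R (\<Sum>r<L. g (zb (real k * h), x (k * L + r)))) \<le>
      C * h * d k + C * h * (R * h)" if k: "real (Suc k) * h \<le> 1" for k
  proof -
    have k1: "real k * h \<le> 1" using k h by (simp add: algebra_simps)
    have "ze (real (Suc k) * h) - ze (real k * h) = (\<Sum>r<L. ze (\<epsilon> * real (Suc (k * L + r))) - ze (\<epsilon> * real (k * L + r)))"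
      using sum_lessThan_telescope[of "\<lambda>r. ze (\<epsilon> * real (k * L + r))" L] by (simp add: h_def algebra_simps)
    then have "norm (ze (real (Suc k) * h) - ze (real k * h) - \<epsilon> *\<^sub>R (\<Sum>r<L. g (zb (real k * h), x (k * L + r)))) =
        norm (\<Sum>r<L. ze (\<epsilon> * real (Suc (k * L + r))) - ze (\<epsilon> * real (k * L + r)) - \<epsilon> *\<^sub>R g (zb (real k * h), x (k * L + r)))"
      by (simp add: sum_subtractf scaleR_sum_right)
    also have "\<dots> \<le> (\<Sum>r<L. \<epsilon> * (C * (d k + R * h)))"
    proof (intro sum_norm_le micro)
      fix r assume "r \<in> {..<L}"
      then have "real (k * L + Suc r) \<le> real (k * L + L)" by (intro of_nat_mono) auto
      then have "\<epsilon> * real (k * L + Suc r) \<le> \<epsilon> * real (k * L + L)" using \<epsilon> by (intro mult_left_mono) auto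
      also have "\<dots> = real (Suc k) * h" by (simp add: h_def algebra_simps)
      finally have up: "\<epsilon> * real (Suc (k * L + r)) \<le> real (Suc k) * h" by simp
      then show "\<epsilon> * real (Suc (k * L + r)) \<le> 1" using k by linarith
      show "zb (real k * h) \<in> Z" using kh0 k1 by (intro zbZ) auto
      show "0 \<le> d k + R * h" using R h by (simp add: d_def)
      fix q assume q: "q \<in> {\<epsilon> * real (k * L + r)..\<epsilon> * real (Suc (k * L + r))}"
      have "real k * h \<le> \<epsilon> * real (k * L + r)" using \<epsilon> by (simp add: h_def algebra_simps)
      then have q': "real k * h \<le> q" "q \<le> real (Suc k) * h" using q up by auto
      then have "norm (ze q - ze (real k * h)) \<le> R * (q - real k * h)" using kh0 k by (intro zeL) auto
      also have "\<dots> \<le> R * h" using q' R by (intro mult_left_mono) (auto simp: algebra_simps)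
      finally show "norm (ze q - zb (real k * h)) \<le> d k + R * h"
        using norm_triangle_ineq[of "ze q - ze (real k * h)" "ze (real k * h) - zb (real k * h)"] by (simp add: d_def)
    qed
    also have "\<dots> = C * h * d k + C * h * (R * h)" by (simp add: h_def algebra_simps)
    finally show ?thesis .
  qed
  have E: "norm (ze (real k * h) - zb (real k * h) - D k) \<le> (\<Sum>i<k. C * h * d i + C * h * (R * h))"
    if "real k * h \<le> 1" for k
    using that
  proof (induction k)
    case 0
    then show ?case by (simp add: ze0 zb0 D_def deviation_def)
  next
    case (Suc k)
    have "real k * h \<le> 1" using Suc.prems h by (simp add: algebra_simps)
    note IH = Suc.IH[OF this]
    have "D (Suc k) = D k + (\<epsilon> *\<^sub>R (\<Sum>r<L. g (zb (real k * h), x (k * L + r))) - (zb (real (Suc k) * h) - zb (real k * h)))"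
      by (simp add: D_def deviation_def x_def)
    then have eq: "ze (real (Suc k) * h) - zb (real (Suc k) * h) - D (Suc k) = (ze (real k * h) - zb (real k * h) - D k) +
      (ze (real (Suc k) * h) - ze (real k * h) - \<epsilon> *\<^sub>R (\<Sum>r<L. g (zb (real k * h), x (k * L + r))))"
      by simp
    show ?case
      unfolding eq sum.lessThan_Suc by (rule norm_triangle_le[OF add_mono[OF IH block[OF Suc.prems]]])
  qed
  have dk: "d k \<le> a k + (C * h) * (\<Sum>i<k. d i)" if k: "real k * h \<le> 1" for k
  proof -
    have "d k \<le> norm (D k) + norm (ze (real k * h) - zb (real k * h) - D k)"
      unfolding d_def using norm_triangle_ineq[of "D k" "ze (real k * h) - zb (real k * h) - D k"] by simp
    also have "\<dots> \<le> norm (D k) + (\<Sum>i<k. C * h * d i + C * h * (R * h))" using E[OF k] by simp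
    also have "\<dots> = norm (D k) + (C * h) * (\<Sum>i<k. d i) + (real k * h) * (C * R * h)"
      by (simp add: sum.distrib sum_distrib_left algebra_simps)
    \<comment> \<open>At most \<open>1 / h\<close> blocks contribute
      \<open>C * R * h\<^sup>2\<close> each, which explains the summand \<open>C * R * h\<close> of
      \<open>a\<close>.\<close>
    also have "(real k * h) * (C * R * h) \<le> 1 * (C * R * h)" using k C R h by (intro mult_right_mono) auto
    finally show ?thesis by (simp add: a_def D_def)
  qed
  define k where "k = nat \<lfloor>s / h\<rfloor>"
  have kf: "real k \<le> s / h" "s / h < real k + 1" using s h by (simp_all add: k_def)
  then have ks: "real k * h \<le> s" "s \<le> real k * h + h" using h by (simp_all add: field_simps)
  have "d k \<le> a k + C * h * ((1 + C * h) ^ k * (\<Sum>i<k. a i))"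
  proof (rule discrete_gronwall[where N = k])
    fix i assume "i \<le> k"
    then have "real i * h \<le> real k * h" using h by (intro mult_right_mono) auto
    then show "d i \<le> a i + C * h * (\<Sum>j<i. d j)" using ks s by (intro dk) auto
    show "0 \<le> a i" using C R h by (simp add: a_def)
  qed (use C h in auto)
  \<comment> \<open>The time \<open>s\<close> lies at most \<open>h\<close> beyond the last block
    end, and both paths have Lipschitz constant \<open>R\<close>.\<close>
  moreover have "norm (ze s - zb s) \<le> d k + 2 * R * h"
  proof -
    have "norm (ze s - ze (real k * h)) \<le> R * (s - real k * h)" "norm (zb s - zb (real k * h)) \<le> R * (s - real k * h)"
      using ks s kh0 by (auto intro!: zeL zbL)
    moreover have "R * (s - real k * h) \<le> R * h" using ks R by (intro mult_left_mono) auto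
    moreover have "norm (ze s - zb s) \<le> norm (ze s - ze (real k * h)) + d k + norm (zb s - zb (real k * h))"
      using norm_triangle_ineq4[of "(ze s - ze (real k * h)) + (ze (real k * h) - zb (real k * h))" "zb s - zb (real k * h)"]
        norm_triangle_ineq[of "ze s - ze (real k * h)" "ze (real k * h) - zb (real k * h)"]
      by (simp add: d_def)
    ultimately show ?thesis by linarith
  qed
  ultimately show ?thesis unfolding k_def by linarith
qed

lemma stationary_inner:
  fixes g :: "'z::euclidean_space \<times> 'y \<times> 'u \<Rightarrow> 'z"
  assumes "stationary \<gamma>" "continuous_on (Y \<times> U) (\<lambda>x. g (z, x))"
  shows "l \<bullet> (\<integral>(y, u). g (z, y, u) \<partial>\<gamma>) = (\<integral>x. l \<bullet> g (z, x) \<partial>\<gamma>)"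
proof -
  have "(\<lambda>(y, u). g (z, y, u)) = (\<lambda>x. g (z, x))" by auto
  then show ?thesis using stationary_integrable[OF assms] by simp
qed

text \<open>The second estimate freezes the velocity set at the left end: the measure that gives the
  velocity at \<open>s\<close> is kept while \<open>zb s\<close> is replaced by \<open>zb a\<close>,
  at the cost of the Lipschitz constant times the distance travelled. It supplies
  \<open>vdir\<close> of \<open>tracking_plan\<close>.\<close>

lemma inclusion_solution_estimates:
  fixes g :: "'z::euclidean_space \<times> 'y \<times> 'u \<Rightarrow> 'z"
  assumes zb: "inclusion_solution (\<lambda>_. averaged_velocities {\<gamma>. stationary \<gamma>} g) z0 zb"
    and zbZ: "\<And>s. s \<in> {0..1} \<Longrightarrow> zb s \<in> Z"
    and gc: "\<And>z. z \<in> Z \<Longrightarrow> continuous_on (Y \<times> U) (\<lambda>x. g (z, x))"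
    and lip: "\<And>z1 z2 x. z1 \<in> Z \<Longrightarrow> z2 \<in> Z \<Longrightarrow> x \<in> Y \<times> U \<Longrightarrow> norm (g (z1, x) - g (z2, x)) \<le> C * norm (z1 - z2)"
    and gR: "\<And>z x. z \<in> Z \<Longrightarrow> x \<in> Y \<times> U \<Longrightarrow> norm (g (z, x)) \<le> R"
    and R: "R \<ge> 0" and C: "C \<ge> 0" and ab: "0 \<le> a" "a \<le> b" "b \<le> 1"
  shows "norm (zb b - zb a) \<le> R * (b - a)"
    and "(\<And>\<gamma>. stationary \<gamma> \<Longrightarrow> (\<integral>x. l \<bullet> g (zb a, x) \<partial>\<gamma>) \<le> c) \<Longrightarrow>
      l \<bullet> (zb b - zb a) \<le> (b - a) * (c + norm l * (C * R * (b - a)))"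
proof -
  have ac: "absolutely_continuous_fun_on {0..1} zb"
    and ae: "AE s in lborel. s \<in> {0..1} \<longrightarrow> (\<exists>\<gamma>. stationary \<gamma> \<and>
      (zb has_vector_derivative (\<integral>(y, u). g (zb s, y, u) \<partial>\<gamma>)) (at s))"
    using zb unfolding inclusion_solution_def averaged_velocities_def by auto
  have nv: "norm (\<integral>(y, u). g (z, y, u) \<partial>\<gamma>) \<le> R" if \<gamma>: "stationary \<gamma>" and z: "z \<in> Z" for \<gamma> z
  proof -
    interpret g: prob_space \<gamma> using \<gamma> by (simp add: stationary_def)
    have eq: "(\<lambda>(y, u). g (z, y, u)) = (\<lambda>x. g (z, x))" by auto
    have "norm (\<integral>x. g (z, x) \<partial>\<gamma>) \<le> (\<integral>x. norm (g (z, x)) \<partial>\<gamma>)" by (rule integral_norm_bound)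
    also have "(\<integral>x. norm (g (z, x)) \<partial>\<gamma>) \<le> (\<integral>x. R \<partial>\<gamma>)"
      using gR[OF z] by (intro integral_mono integrable_norm stationary_integrable[OF \<gamma>] gc z continuous_on_const)
        (auto simp: stationary_space[OF \<gamma>])
    also have "\<dots> = R" by (simp add: g.prob_space)
    finally show ?thesis unfolding eq .
  qed
  have L: "norm (zb b - zb a) \<le> R * (b - a)" if "0 \<le> a" "a \<le> b" "b \<le> 1" for a b
  proof -
    have "norm (zb b - zb a - (b - a) *\<^sub>R 0) \<le> R * (b - a)"
    proof (rule absolutely_continuous_norm_mean_value[OF ac _ that(2) R])
      show "AE s in lborel. s \<in> {a<..<b} \<longrightarrow> (\<exists>v. norm (v - 0) \<le> R \<and> (zb has_vector_derivative v) (at s))"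
        using ae
      proof eventually_elim
        case (elim s)
        show ?case
        proof
          assume "s \<in> {a<..<b}"
          then have s: "s \<in> {0..1}" using that by auto
          then show "\<exists>v. norm (v - 0) \<le> R \<and> (zb has_vector_derivative v) (at s)"
            using elim nv[OF _ zbZ[OF s]] by auto
        qed
      qed
    qed (use that in auto)
    then show ?thesis by simp
  qed
  show "norm (zb b - zb a) \<le> R * (b - a)" by (rule L[OF ab])
  assume c: "\<And>\<gamma>. stationary \<gamma> \<Longrightarrow> (\<integral>x. l \<bullet> g (zb a, x) \<partial>\<gamma>) \<le> c"
  have aZ: "zb a \<in> Z" using ab by (intro zbZ) auto
  have "l \<bullet> (zb b - zb a - (b - a) *\<^sub>R 0) \<le> (c + norm l * (C * R * (b - a))) * (b - a)"
  proof (rule absolutely_continuous_inner_mean_value[OF ac _ ab(2)])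
    show "{a..b} \<subseteq> {0..1}" using ab by auto
    show "AE s in lborel. s \<in> {a<..<b} \<longrightarrow>
        (\<exists>v. l \<bullet> (v - 0) \<le> c + norm l * (C * R * (b - a)) \<and> (zb has_vector_derivative v) (at s))"
      using ae
    proof eventually_elim
      case (elim s)
      show ?case
      proof
        assume sab: "s \<in> {a<..<b}"
        then have s: "s \<in> {0..1}" using ab by auto
        then obtain \<gamma> where \<gamma>: "stationary \<gamma>"
          and der: "(zb has_vector_derivative (\<integral>(y, u). g (zb s, y, u) \<partial>\<gamma>)) (at s)" using elim by auto
        interpret g: prob_space \<gamma> using \<gamma> by (simp add: stationary_def)
        have gl: "continuous_on (Y \<times> U) (\<lambda>x. l \<bullet> g (z, x))" if "z \<in> Z" for z
          by (intro continuous_on_inner continuous_on_const gc that)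
        have le: "l \<bullet> g (zb s, x) \<le> l \<bullet> g (zb a, x) + norm l * (C * R * (b - a))" if x: "x \<in> Y \<times> U" for x
        proof -
          have "l \<bullet> g (zb s, x) - l \<bullet> g (zb a, x) \<le> norm l * norm (g (zb s, x) - g (zb a, x))"
            by (simp add: norm_cauchy_schwarz flip: inner_diff_right)
          also have "norm (g (zb s, x) - g (zb a, x)) \<le> C * norm (zb s - zb a)" by (intro lip zbZ s aZ x)
          also have "norm (zb s - zb a) \<le> R * (s - a)" using sab ab by (intro L) auto
          also have "R * (s - a) \<le> R * (b - a)" using sab R by (intro mult_left_mono) auto
          finally show ?thesis using C by (simp add: mult_left_mono mult.assoc)
        qed
        have "l \<bullet> (\<integral>(y, u). g (zb s, y, u) \<partial>\<gamma>) = (\<integral>x. l \<bullet> g (zb s, x) \<partial>\<gamma>)"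
          by (rule stationary_inner[OF \<gamma> gc[OF zbZ[OF s]]])
        also have "\<dots> \<le> (\<integral>x. l \<bullet> g (zb a, x) + norm l * (C * R * (b - a)) \<partial>\<gamma>)"
          using le by (intro integral_mono stationary_integrable[OF \<gamma>] gl zbZ s continuous_on_add aZ continuous_on_const)
            (auto simp: stationary_space[OF \<gamma>])
        also have "\<dots> = (\<integral>x. l \<bullet> g (zb a, x) \<partial>\<gamma>) + norm l * (C * R * (b - a))"
          using stationary_integrable[OF \<gamma> gl[OF aZ]] by (simp add: g.prob_space)
        also have "\<dots> \<le> c + norm l * (C * R * (b - a))" using c[OF \<gamma>] by simp
        finally show "\<exists>v. l \<bullet> (v - 0) \<le> c + norm l * (C * R * (b - a)) \<and> (zb has_vector_derivative v) (at s)"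
          using der by auto
      qed
    qed
  qed
  then show "l \<bullet> (zb b - zb a) \<le> (b - a) * (c + norm l * (C * R * (b - a)))" by (simp add: mult.commute)
qed

text \<open>The order of quantifiers carries the uniformity: \<open>\<epsilon>0\<close> is chosen
  before \<open>zb\<close>, and the plan after it. An integrable majorant \<open>X\<close> appears
  because nothing is assumed about measurability of the hybrid solution in the noise.\<close>

lemma uniform_tracking:
  fixes g :: "'z::euclidean_space \<times> 'y \<times> 'u \<Rightarrow> 'z"
  assumes q: "lipschitz_dense_sequence (Y \<times> U) q"
    and tr: "\<And>j. j \<ge> 1 \<Longrightarrow> \<exists>\<nu>. reward_transfer q j \<nu>"
    and W: "\<exists>\<gamma>. stationary \<gamma>"
    and Z: "compact Z" and g: "continuous_on (Z \<times> Y \<times> U) g"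
    and lip: "\<And>z1 z2 x. z1 \<in> Z \<Longrightarrow> z2 \<in> Z \<Longrightarrow> x \<in> Y \<times> U \<Longrightarrow> norm (g (z1, x) - g (z2, x)) \<le> C * norm (z1 - z2)"
    and C: "C \<ge> 0" and y: "y \<in> Y" and \<eta>: "\<eta> > 0"
  shows "\<exists>\<epsilon>0>0. \<forall>\<epsilon> zb. 0 < \<epsilon> \<longrightarrow> \<epsilon> < \<epsilon>0 \<longrightarrow>
    inclusion_solution (\<lambda>_. averaged_velocities {\<gamma>. stationary \<gamma>} g) z0 zb \<longrightarrow> (\<forall>s\<in>{0..1}. zb s \<in> Z) \<longrightarrow>
    (\<exists>\<pi>\<in>plans. \<forall>s\<in>{0..1}. \<exists>X. integrable P X \<and> integral\<^sup>L P X \<le> \<eta> \<and>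
      (\<forall>w\<in>space P. 0 \<le> X w \<and> (\<forall>ze. hybrid_solution f g y z0 \<epsilon> \<pi> w ze \<longrightarrow> (\<forall>r\<in>{0..1}. ze r \<in> Z) \<longrightarrow>
        norm (ze s - zb s) \<le> X w)))"
proof -
  interpret PP: prob_space P by (rule prob_P)
  have "compact (g ` (Z \<times> Y \<times> U))"
    by (intro compact_continuous_image g compact_Times Z compact_Y compact_U)
  then obtain R0 where R0: "\<And>z x. z \<in> Z \<Longrightarrow> x \<in> Y \<times> U \<Longrightarrow> norm (g (z, x)) \<le> R0"
    by (force dest!: compact_imp_bounded simp: bounded_iff)
  define R where "R = max 0 R0"
  have R: "R \<ge> 0" and gR: "\<And>z x. z \<in> Z \<Longrightarrow> x \<in> Y \<times> U \<Longrightarrow> norm (g (z, x)) \<le> R"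
    using R0 by (auto simp: R_def le_max_iff_disj)
  have gc: "continuous_on (Y \<times> U) (\<lambda>x. g (z, x))" if "z \<in> Z" for z
    by (rule continuous_on_compose2[OF g]) (use that in \<open>auto intro!: continuous_intros\<close>)
  \<comment> \<open>\<open>B\<close> bounds the Gronwall factor. The forcing terms will have mean at
    most \<open>2 * \<kappa>\<close>, so they contribute at most \<open>2 * \<kappa> * B\<close>,
    half of \<open>\<eta>\<close>. The choice of \<open>e\<close> makes \<open>2 * e\<close> half of
    the mean square \<open>\<kappa>\<^sup>2\<close> allowed for the deviation.\<close>
  define B where "B = 1 + C * exp C"
  have B: "B \<ge> 1" using C by (simp add: B_def)
  define \<kappa> where "\<kappa> = \<eta> / (4 * B)"
  have \<kappa>: "\<kappa> > 0" and \<kappa>B: "\<kappa> * B = \<eta> / 4" using \<eta> B by (simp_all add: \<kappa>_def)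
  define e where "e = \<kappa>\<^sup>2 / 4"
  have e: "e > 0" using \<kappa> by (simp add: e_def)
  have \<Phi>: "continuous_on ((cball 0 (2 * R) \<times> Z) \<times> Y \<times> U) (\<lambda>(p, x). fst p \<bullet> g (snd p, x))"
    unfolding case_prod_unfold
    by (intro continuous_intros continuous_on_compose2[OF g]) auto
  obtain L and idx :: "('z \<times> 'z) \<times> 'y \<Rightarrow> nat" and \<rho> where L: "L \<ge> 1"
    and idx: "idx \<in> borel \<rightarrow>\<^sub>M count_space UNIV" and \<rho>: "\<And>i. \<rho> i \<in> plans"
    and opt: "\<And>p y \<gamma>. p \<in> cball 0 (2 * R) \<times> Z \<Longrightarrow> y \<in> Y \<Longrightarrow> stationary \<gamma> \<Longrightarrow>
      real L * ((\<integral>x. fst p \<bullet> g (snd p, x) \<partial>\<gamma>) - e) \<le>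
        total_reward L (\<lambda>x. fst p \<bullet> g (snd p, x)) y (\<rho> (idx (p, y)))"
    by (rule uniform_reward_selection[OF q tr compact_Times[OF compact_cball Z] \<Phi> e W]) blast+
  \<comment> \<open>\<open>A\<close> dominates the coefficients of \<open>h\<close> in the estimates
    below, so one condition on \<open>h\<close> serves them all; the summand 1 keeps it
    positive.\<close>
  define A where "A = 1 + C * R + 2 * R + (4 * C * R\<^sup>2 + 4 * R\<^sup>2)"
  have A: "A \<ge> 1" using C R by (simp add: A_def)
  define h0 where "h0 = min \<kappa> (min (\<eta> / 4) (\<kappa>\<^sup>2 / 2)) / A"
  have h0: "h0 > 0" using \<kappa> \<eta> A by (simp add: h0_def)
  show ?thesis
  proof (intro exI[of _ "h0 / real L"] conjI allI impI)
    show "h0 / real L > 0" using h0 L by simp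
    fix \<epsilon> zb assume \<epsilon>: "0 < \<epsilon>" "\<epsilon> < h0 / real L"
      and zb: "inclusion_solution (\<lambda>_. averaged_velocities {\<gamma>. stationary \<gamma>} g) z0 zb"
      and zbZ': "\<forall>s\<in>{0..1}. zb s \<in> Z"
    have zbZ: "\<And>s. s \<in> {0..1} \<Longrightarrow> zb s \<in> Z" using zbZ' by blast
    define h where "h = \<epsilon> * real L"
    have h: "h > 0" using \<epsilon> L by (simp add: h_def)
    have "h < h0" using \<epsilon> L by (simp add: h_def field_simps)
    then have "A * h \<le> A * h0" using A by simp
    then have Ah: "A * h \<le> \<kappa>" "A * h \<le> \<eta> / 4" "A * h \<le> \<kappa>\<^sup>2 / 2" using A by (auto simp: h0_def)
    have parts: "C * R \<le> A" "2 * R \<le> A" "4 * C * R\<^sup>2 + 4 * R\<^sup>2 \<le> A" using C R by (simp_all add: A_def)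
    have h1: "C * R * h \<le> \<kappa>" "2 * R * h \<le> \<eta> / 4" "(4 * C * R\<^sup>2 + 4 * R\<^sup>2) * h \<le> \<kappa>\<^sup>2 / 2"
      using mult_right_mono[OF parts(1), of h] mult_right_mono[OF parts(2), of h] mult_right_mono[OF parts(3), of h] Ah h
      by linarith+
    define N where "N = nat \<lfloor>1 / h\<rfloor>"
    have N: "real N * h \<le> 1"
    proof -
      have "real N \<le> 1 / h" using h by (simp add: N_def)
      then show ?thesis using h by (simp add: field_simps)
    qed
    have ih: "real i * h \<le> 1" if "i \<le> N" for i
    proof -
      have "real i * h \<le> real N * h" using that h by (intro mult_right_mono) auto
      then show ?thesis using N by linarith
    qed
    have ih0: "0 \<le> real i * h" for i using h by simp
    have hs: "real (Suc i) * h - real i * h = h" for i by (simp add: algebra_simps)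
    have hle: "real i * h \<le> real (Suc i) * h" for i using h by simp
    define \<zeta> where "\<zeta> = (\<lambda>i. zb (real i * h))"
    define v where "v = (\<lambda>i. zb (real (Suc i) * h) - zb (real i * h))"
    have \<zeta>Z: "\<zeta> i \<in> Z" if "i < N" for i unfolding \<zeta>_def using ih[of i] ih0 that by (intro zbZ) auto
    have zbL: "norm (zb b - zb a) \<le> R * (b - a)" if "0 \<le> a" "a \<le> b" "b \<le> 1" for a b
      by (rule inclusion_solution_estimates(1)[OF zb zbZ gc lip gR R C that])
    have zbdir: "l \<bullet> (zb b - zb a) \<le> (b - a) * (c + norm l * (C * R * (b - a)))"
      if "0 \<le> a" "a \<le> b" "b \<le> 1" "\<And>\<gamma>. stationary \<gamma> \<Longrightarrow> (\<integral>x. l \<bullet> g (zb a, x) \<partial>\<gamma>) \<le> c" for a b l c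
      by (rule inclusion_solution_estimates(2)[OF zb zbZ gc lip gR R C that])
    have v: "norm (v i) \<le> R * (\<epsilon> * real L)" if "i < N" for i
      using zbL[OF ih0[of i] hle ih[of "Suc i"]] that unfolding v_def hs h_def[symmetric] by simp
    have vdir: "l \<bullet> v i \<le> (\<epsilon> * real L) * (c + norm l * (C * R * h))"
      if "i < N" "\<And>\<gamma>. stationary \<gamma> \<Longrightarrow> (\<integral>x. l \<bullet> g (\<zeta> i, x) \<partial>\<gamma>) \<le> c" for i l c
      using zbdir[OF ih0[of i] hle ih[of "Suc i"], of l c] that
      unfolding v_def \<zeta>_def hs h_def[symmetric] by simp
    have \<delta>: "0 \<le> C * R * h" using C R h by simp
    obtain \<pi> where \<pi>: "\<pi> \<in> plans"
      and track: "\<And>k. k \<le> N \<Longrightarrow> (\<integral>w. (norm (deviation g \<epsilon> L \<zeta> v y \<pi> k w))\<^sup>2 \<partial>P) \<le>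
        real k * (\<epsilon> * real L * (2 * e + 4 * R * (C * R * h) + 4 * R\<^sup>2 * (\<epsilon> * real L)))"
    proof -
      have "\<exists>\<pi>\<in>plans. \<forall>k\<le>N. (\<integral>w. (norm (deviation g \<epsilon> L \<zeta> v y \<pi> k w))\<^sup>2 \<partial>P) \<le>
        real k * (\<epsilon> * real L * (2 * e + 4 * R * (C * R * h) + 4 * R\<^sup>2 * (\<epsilon> * real L)))"
        by (rule tracking_plan[OF L idx \<rho> _ Z g _ R y \<epsilon>(1) \<delta> N[unfolded h_def]]) (fact opt gR \<zeta>Z v vdir)+
      then show thesis using that by blast
    qed
    define D where "D = deviation g \<epsilon> L \<zeta> v y \<pi>"
    have Dm: "D k \<in> borel_measurable P" if "k \<le> N" for k
      unfolding D_def measurable_P using that by (intro deviation_measurable \<pi> y gc \<zeta>Z) auto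
    have Db: "norm (D k w) \<le> real k * (2 * R * (\<epsilon> * real L))" if "k \<le> N" "w \<in> space P" for k w
      unfolding D_def using that \<epsilon> by (intro deviation_bound[where Z = Z] \<pi> y \<zeta>Z v gR) (auto simp: space_P)
    have Dint: "integrable P (\<lambda>w. norm (D k w))" if "k \<le> N" for k
      using Db[OF that] by (intro PP.integrable_const_bound[where B = "real k * (2 * R * (\<epsilon> * real L))"]
          measurable_compose[OF Dm[OF that] borel_measurable_norm] AE_I2) auto
    have Dint2: "integrable P (\<lambda>w. (norm (D k w))\<^sup>2)" if "k \<le> N" for k
      using power_mono[OF Db[OF that], of _ 2]
      by (intro PP.integrable_const_bound[where B = "(real k * (2 * R * (\<epsilon> * real L)))\<^sup>2"] borel_measurable_power
          measurable_compose[OF Dm[OF that] borel_measurable_norm] AE_I2) auto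
    have ED: "(\<integral>w. norm (D k w) \<partial>P) \<le> \<kappa>" if k: "k \<le> N" for k
    proof -
      have nn: "0 \<le> 2 * e + (4 * C * R\<^sup>2 + 4 * R\<^sup>2) * h" using e C h by simp
      \<comment> \<open>Nonnegativity of the variance bounds the square of the mean by the mean of
        the square.\<close>
      have "(\<integral>w. norm (D k w) \<partial>P)\<^sup>2 \<le> (\<integral>w. (norm (D k w))\<^sup>2 \<partial>P)"
        using PP.variance_eq[OF Dint[OF k] Dint2[OF k]] PP.variance_positive[of "\<lambda>w. norm (D k w)"] by simp
      also have "\<dots> \<le> real k * (\<epsilon> * real L * (2 * e + 4 * R * (C * R * h) + 4 * R\<^sup>2 * (\<epsilon> * real L)))"
        unfolding D_def by (rule track[OF k])
      also have "\<dots> = (real k * h) * (2 * e + (4 * C * R\<^sup>2 + 4 * R\<^sup>2) * h)"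
        unfolding h_def[symmetric] by (simp add: power2_eq_square algebra_simps)
      also have "\<dots> \<le> 1 * (2 * e + (4 * C * R\<^sup>2 + 4 * R\<^sup>2) * h)" by (rule mult_right_mono[OF ih[OF k] nn])
      also have "\<dots> \<le> \<kappa>\<^sup>2" using h1(3) by (simp add: e_def)
      finally show ?thesis using \<kappa> by (auto intro: power2_le_imp_le)
    qed
    show "\<exists>\<pi>\<in>plans. \<forall>s\<in>{0..1}. \<exists>X. integrable P X \<and> integral\<^sup>L P X \<le> \<eta> \<and>
      (\<forall>w\<in>space P. 0 \<le> X w \<and> (\<forall>ze. hybrid_solution f g y z0 \<epsilon> \<pi> w ze \<longrightarrow> (\<forall>r\<in>{0..1}. ze r \<in> Z) \<longrightarrow>
        norm (ze s - zb s) \<le> X w))"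
    proof (intro bexI[OF _ \<pi>] ballI)
      fix s :: real assume s: "s \<in> {0..1}"
      define k where "k = nat \<lfloor>s / h\<rfloor>"
      have kN: "k \<le> N" unfolding k_def N_def using s h by (intro nat_mono floor_mono divide_right_mono) auto
      define a where "a i w = norm (D i w) + C * R * h" for i w
      define c where "c = C * h * (1 + C * h) ^ k"
      define X where "X w = a k w + c * (\<Sum>i<k. a i w) + 2 * R * h" for w
      have c0: "c \<ge> 0" using C h by (simp add: c_def)
      have a0: "0 \<le> a i w" for i w using \<delta> by (simp add: a_def)
      have aint: "integrable P (a i)" if "i \<le> N" for i
        unfolding a_def by (intro Bochner_Integration.integrable_add Dint that PP.integrable_const)
      have Ea: "(\<integral>w. a i w \<partial>P) \<le> 2 * \<kappa>" if "i \<le> N" for i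
        unfolding a_def using ED[OF that] Dint[OF that] h1(1) by (simp add: PP.prob_space)
      have asum: "integrable P (\<lambda>w. \<Sum>i<k. a i w)"
        using kN by (intro Bochner_Integration.integrable_sum aint) auto
      have Xint: "integrable P X"
        unfolding X_def by (intro Bochner_Integration.integrable_add aint kN Bochner_Integration.integrable_mult_right
            asum PP.integrable_const)
      \<comment> \<open>Since \<open>real k * h \<le> 1\<close>, the power of
        \<open>1 + C * h\<close> stays below \<open>exp C\<close>, and the factor \<open>h\<close>
        in \<open>c\<close> absorbs the number of blocks.\<close>
      have "c * real k \<le> C * exp C"
      proof -
        have "(1 + C * h) ^ k \<le> exp (C * h) ^ k" using C h by (intro power_mono) (auto simp: exp_ge_add_one_self)
        also have "\<dots> = exp (real k * (C * h))" by (simp add: exp_of_nat_mult)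
        also have "real k * (C * h) = C * (real k * h)" by simp
        also have "exp (C * (real k * h)) \<le> exp C" using C ih[OF kN] by (simp add: mult_left_le)
        finally have "(1 + C * h) ^ k * (real k * h) \<le> exp C * 1"
          using ih[OF kN] ih0 by (intro mult_mono) auto
        then have "C * ((1 + C * h) ^ k * (real k * h)) \<le> C * (exp C * 1)" using C by (intro mult_left_mono)
        then show ?thesis by (simp add: c_def mult_ac)
      qed
      then have ck: "(1 + c * real k) * (2 * \<kappa>) \<le> B * (2 * \<kappa>)"
        using \<kappa> by (intro mult_right_mono) (auto simp: B_def)
      have "integral\<^sup>L P X = (\<integral>w. a k w \<partial>P) + c * (\<Sum>i<k. \<integral>w. a i w \<partial>P) + 2 * R * h"
        unfolding X_def using aint kN asum
        by (simp add: PP.prob_space Bochner_Integration.integral_sum)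
      also have "\<dots> \<le> 2 * \<kappa> + c * (\<Sum>i<k. 2 * \<kappa>) + \<eta> / 4"
        using kN c0 h1(2) by (intro add_mono mult_left_mono sum_mono Ea) auto
      also have "\<dots> = (1 + c * real k) * (2 * \<kappa>) + \<eta> / 4" by (simp add: algebra_simps)
      also have "\<dots> \<le> \<eta>" using ck \<kappa>B \<eta> by (simp add: mult.commute)
      finally have XE: "integral\<^sup>L P X \<le> \<eta>" .
      show "\<exists>X. integrable P X \<and> integral\<^sup>L P X \<le> \<eta> \<and>
          (\<forall>w\<in>space P. 0 \<le> X w \<and> (\<forall>ze. hybrid_solution f g y z0 \<epsilon> \<pi> w ze \<longrightarrow> (\<forall>r\<in>{0..1}. ze r \<in> Z) \<longrightarrow>
            norm (ze s - zb s) \<le> X w))"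
      proof (intro exI[of _ X] conjI Xint XE ballI allI impI)
        fix w assume w: "w \<in> space P"
        show "0 \<le> X w" unfolding X_def using a0 c0 R h by (intro add_nonneg_nonneg mult_nonneg_nonneg sum_nonneg) auto
        fix ze assume ze: "hybrid_solution f g y z0 \<epsilon> \<pi> w ze" "\<forall>r\<in>{0..1}. ze r \<in> Z"
        have zb0: "zb 0 = z0" using zb by (simp add: inclusion_solution_def)
        have "norm (ze s - zb s) \<le> a k w + C * h * ((1 + C * h) ^ k * (\<Sum>i<k. a i w)) + 2 * R * h"
          unfolding k_def
        proof (rule hybrid_path_estimate[OF ze(1) _ zbZ zb0 zbL lip gR \<pi> y w \<epsilon>(1) L R C s h_def])
          show "a i w = norm (deviation g \<epsilon> L (\<lambda>i. zb (real i * h)) (\<lambda>i. zb (real (Suc i) * h) - zb (real i * h)) y \<pi> i w) + C * R * h" for i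
            by (simp only: a_def D_def \<zeta>_def v_def)
        qed (use ze in auto)
        then show "norm (ze s - zb s) \<le> X w" by (simp add: X_def c_def mult.assoc)
      qed
    qed
  qed
qed

end

section \<open>Transfer to the given noise and conclusion\<close>

theorem theorem7p1:
  fixes Y :: "(real ^ 'm) set" and U :: "'u::metric_space set" and S :: "'s::metric_space set"
    and f :: "(real ^ 'm) \<times> 'u \<times> 's \<Rightarrow> real ^ 'm"
    and M :: "'w measure" and \<sigma> :: "nat \<Rightarrow> 'w \<Rightarrow> 's"
    and q :: "nat \<Rightarrow> (real ^ 'm) \<times> 'u \<Rightarrow> real"
    and g :: "(real ^ 'n) \<times> (real ^ 'm) \<times> 'u \<Rightarrow> real ^ 'n"
    and y0 :: "real ^ 'm" and z0 :: "real ^ 'n" and Z :: "(real ^ 'n) set" and C :: real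
    and z\<^sub>h :: "real \<Rightarrow> (nat \<Rightarrow> (nat \<Rightarrow> 's) \<Rightarrow> 'u) \<Rightarrow> 'w \<Rightarrow> real \<Rightarrow> real ^ 'n"
  defines "W \<equiv> stationary_measures M (\<sigma> 0) Y U f"
  defines "V \<equiv> averaged_velocities W g"
  assumes compact: "compact Y" "compact U" "compact S"
    and f_cont: "continuous_on (Y \<times> U \<times> S) f"
    and f_invariant: "\<And>y u s. y \<in> Y \<Longrightarrow> u \<in> U \<Longrightarrow> s \<in> S \<Longrightarrow> f (y, u, s) \<in> Y"
    and prob: "prob_space M"
    and noise_indep: "prob_space.indep_vars M (\<lambda>_. borel_on S) \<sigma> UNIV"
    and noise_ident: "\<And>t. distr M (borel_on S) (\<sigma> t) = distr M (borel_on S) (\<sigma> 0)"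
    and y0: "y0 \<in> Y"
    and q: "lipschitz_dense_sequence (Y \<times> U) q"
    and g_cont: "continuous_on (UNIV \<times> Y \<times> U) g"
    and Z_compact: "compact Z"
    and C_pos: "C > 0"
    and g_lipschitz: "\<And>z1 z2 y u. z1 \<in> Z \<Longrightarrow> z2 \<in> Z \<Longrightarrow> y \<in> Y \<Longrightarrow> u \<in> U \<Longrightarrow>
            norm (g (z1, y, u) - g (z2, y, u)) \<le> C * norm (z1 - z2)"
    and hybrid: "\<And>\<epsilon> \<pi> \<omega>. \<epsilon> > 0 \<Longrightarrow> \<pi> \<in> hybrid_plans U S \<epsilon> \<Longrightarrow> \<omega> \<in> space M \<Longrightarrow>
            hybrid_solution f g y0 z0 \<epsilon> \<pi> (\<lambda>k. \<sigma> k \<omega>) (z\<^sub>h \<epsilon> \<pi> \<omega>)"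
    and Z_hybrid: "\<And>\<epsilon> \<pi> \<omega> s. \<epsilon> > 0 \<Longrightarrow> \<pi> \<in> hybrid_plans U S \<epsilon> \<Longrightarrow> \<omega> \<in> space M \<Longrightarrow>
            s \<in> {0..1} \<Longrightarrow> z\<^sub>h \<epsilon> \<pi> \<omega> s \<in> interior Z"
    and Z_inclusion: "\<And>z s. inclusion_solution (\<lambda>_. V) z0 z \<Longrightarrow> s \<in> {0..1} \<Longrightarrow> z s \<in> interior Z"
    and strong_approx: "\<And>j. j \<ge> 1 \<Longrightarrow> strong_approximation M \<sigma> Y U S f j q"
  shows "\<exists>\<psi> :: real \<Rightarrow> real. (\<psi> \<longlongrightarrow> 0) (at_right 0) \<and>
           (\<forall>zbar. inclusion_solution (\<lambda>_. V) z0 zbar \<longrightarrow>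
             (\<forall>\<epsilon>>0. \<exists>\<pi>\<in>hybrid_plans U S \<epsilon>.
               \<forall>s\<in>{0..1}. (\<integral>\<omega>. norm (z\<^sub>h \<epsilon> \<pi> \<omega> s - zbar s) \<partial>M) \<le> \<psi> \<epsilon>))"
proof (cases "W = {}")
  case True
  then have V: "V = (\<lambda>_. {})" by (auto simp: V_def averaged_velocities_def)
  show ?thesis
    using empty_inclusion_has_no_solution unfolding V by (intro exI[of _ "\<lambda>_. 0"]) auto
next
  case False
  then obtain \<gamma>0 where \<gamma>0: "\<gamma>0 \<in> W" by auto
  interpret M: prob_space M by (rule prob)
  \<comment> \<open>A stationary measure is a probability measure on \<open>Y \<times> U\<close>, so
    \<open>U\<close> cannot be empty.\<close>
  have U_ne: "U \<noteq> {}"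
  proof
    assume "U = {}"
    then have "sets \<gamma>0 = sets (borel_on ({} :: ((real ^ 'm) \<times> 'u) set))" "prob_space \<gamma>0"
      using \<gamma>0 by (auto simp: W_def stationary_measures_def)
    then show False
      using sets_eq_imp_space_eq[of \<gamma>0 "borel_on {}"] prob_space.not_empty[of \<gamma>0] by (simp add: space_restrict_space)
  qed
  have \<sigma>m: "\<sigma> t \<in> M \<rightarrow>\<^sub>M borel_on S" for t
    using noise_indep by (simp add: M.indep_vars_def2)
  define \<mu> where "\<mu> = distr M (borel_on S) (\<sigma> 0)"
  interpret controlled_system Y U S f \<mu>
    using compact U_ne f_cont f_invariant M.prob_space_distr[OF \<sigma>m]
    by (intro controlled_system.intro) (auto simp: \<mu>_def)
  define \<Sigma> where "\<Sigma> = (\<lambda>\<omega> k. \<sigma> k \<omega>)"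
  \<comment> \<open>Independence and identical laws together say that the noise sequence has law
    \<open>P\<close>.\<close>
  have distr: "distr M P \<Sigma> = P"
  proof -
    have "distr M P \<Sigma> = distr M (history UNIV) \<Sigma>" by (rule distr_cong) (auto simp: sets_P)
    also have "\<dots> = distr M (history UNIV) (\<lambda>\<omega>. \<lambda>i\<in>UNIV. \<sigma> i \<omega>)" by (simp add: \<Sigma>_def restrict_def)
    also have "\<dots> = PiM UNIV (\<lambda>i. distr M (borel_on S) (\<sigma> i))"
      using noise_indep M.indep_vars_iff_distr_eq_PiM'[where I = UNIV and M' = "\<lambda>_. borel_on S" and X = \<sigma>] \<sigma>m by simp
    also have "\<dots> = P" unfolding \<mu>_def by (intro PiM_cong refl noise_ident)
    finally show ?thesis .
  qed
  have \<Sigma>m: "\<Sigma> \<in> M \<rightarrow>\<^sub>M P"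
    unfolding \<Sigma>_def measurable_cong_sets[OF refl sets_P]
    using measurable_space[OF \<sigma>m] by (intro measurable_PiM_single' \<sigma>m) (auto simp: space_restrict_space)
  have transfer: "(\<integral>\<omega>. F (\<Sigma> \<omega>) \<partial>M) = integral\<^sup>L P F" if "F \<in> borel_measurable P" for F :: "(nat \<Rightarrow> 's) \<Rightarrow> real"
    using integral_distr[OF \<Sigma>m that] distr by simp
  have WS: "W = {\<gamma>. stationary \<gamma>}"
  proof -
    have "(\<integral>(y, u). (\<integral>\<omega>. \<phi> (f (y, u, \<sigma> 0 \<omega>)) \<partial>M) - \<phi> y \<partial>\<gamma>) = (\<integral>(y, u). (\<integral>s. \<phi> (f (y, u, s)) \<partial>\<mu>) - \<phi> y \<partial>\<gamma>)"
      if \<gamma>: "sets \<gamma> = sets (borel_on (Y \<times> U))" and \<phi>: "continuous_on Y \<phi>" for \<gamma> and \<phi> :: "real ^ 'm \<Rightarrow> real"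
    proof (rule Bochner_Integration.integral_cong[OF refl], clarify)
      fix y u assume "(y, u) \<in> space \<gamma>"
      then have "y \<in> Y" "u \<in> U" using sets_eq_imp_space_eq[OF \<gamma>] by (auto simp: space_restrict_space)
      from borel_measurable_integrable[OF expected_next_integrable[OF \<phi> this]]
      have "(\<lambda>s. \<phi> (f (y, u, s))) \<in> borel_measurable (borel_on S)" by (simp add: measurable_cong_sets[OF sets_mu refl])
      then show "(\<integral>\<omega>. \<phi> (f (y, u, \<sigma> 0 \<omega>)) \<partial>M) - \<phi> y = (\<integral>s. \<phi> (f (y, u, s)) \<partial>\<mu>) - \<phi> y"
        unfolding \<mu>_def by (subst integral_distr[OF \<sigma>m]) auto
    qed
    then show ?thesis unfolding W_def stationary_measures_def stationary_def by auto
  qed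
  have qc: "continuous_on (Y \<times> U) (q i)" for i
    using q lipschitz_on_continuous_on unfolding lipschitz_dense_sequence_def by metis
  have tr: "\<exists>\<nu>. reward_transfer q j \<nu>" if j: "j \<ge> 1" for j
  proof -
    obtain \<nu> where \<nu>: "(\<nu> \<longlongrightarrow> 0) at_top" and sa: "\<And>T y' y'' \<pi>'. T \<ge> 1 \<Longrightarrow> y' \<in> Y \<Longrightarrow> y'' \<in> Y \<Longrightarrow> \<pi>' \<in> plans \<Longrightarrow>
      \<exists>\<pi>''\<in>plans. (\<integral>\<omega>. L2_set (\<lambda>i.
                 (1 / real T) * (\<Sum>t=0..T. q i (state f y' \<pi>' (\<lambda>k. \<sigma> k \<omega>) t, control \<pi>' (\<lambda>k. \<sigma> k \<omega>) t))
               - (1 / real T) * (\<Sum>t=0..T. q i (state f y'' \<pi>'' (\<lambda>k. \<sigma> k \<omega>) t, control \<pi>'' (\<lambda>k. \<sigma> k \<omega>) t))) {..<j} \<partial>M)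
           \<le> \<nu> (real T)"
      using strong_approx[OF j] unfolding strong_approximation_def by blast
    show ?thesis unfolding reward_transfer_def
    proof (intro exI[of _ \<nu>] conjI \<nu> allI impI ballI)
      fix T :: nat and y' y'' \<pi>' assume T: "T \<ge> 1" and y': "y' \<in> Y" and y'': "y'' \<in> Y" and \<pi>': "\<pi>' \<in> plans"
      define d where "d \<pi>'' i w = (1 / real T) * (\<Sum>t=0..T. q i (state f y' \<pi>' w t, control \<pi>' w t))
               - (1 / real T) * (\<Sum>t=0..T. q i (state f y'' \<pi>'' w t, control \<pi>'' w t))" for \<pi>'' i w
      obtain \<pi>'' where \<pi>'': "\<pi>'' \<in> plans" and le: "(\<integral>\<omega>. L2_set (\<lambda>i. d \<pi>'' i (\<Sigma> \<omega>)) {..<j} \<partial>M) \<le> \<nu> (real T)"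
        using sa[OF T y' y'' \<pi>'] unfolding d_def \<Sigma>_def by blast
      have ints: "integrable P (\<lambda>w. \<Sum>t=0..T. q i (state f y \<pi> w t, control \<pi> w t))" if "y \<in> Y" "\<pi> \<in> plans" for y \<pi> i
        by (intro Bochner_Integration.integrable_sum trajectory_integrable qc that)
      have dint: "integrable P (d \<pi>'' i)" for i
        unfolding d_def by (intro Bochner_Integration.integrable_diff integrable_mult_right ints y' y'' \<pi>' \<pi>'')
      have [measurable]: "d \<pi>'' i \<in> borel_measurable P" for i by (rule borel_measurable_integrable[OF dint])
      have L2m: "(\<lambda>w. L2_set (\<lambda>i. d \<pi>'' i w) {..<j}) \<in> borel_measurable P" unfolding L2_set_def by measurable
      have L2int: "integrable P (\<lambda>w. L2_set (\<lambda>i. d \<pi>'' i w) {..<j})"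
      proof (rule Bochner_Integration.integrable_bound[OF _ L2m AE_I2])
        show "integrable P (\<lambda>w. \<Sum>i<j. \<bar>d \<pi>'' i w\<bar>)" using dint by (intro Bochner_Integration.integrable_sum integrable_abs)
        show "norm (L2_set (\<lambda>i. d \<pi>'' i w) {..<j}) \<le> norm (\<Sum>i<j. \<bar>d \<pi>'' i w\<bar>)" for w
          using L2_set_le_sum_abs[of "\<lambda>i. d \<pi>'' i w" "{..<j}"] by (simp add: L2_set_nonneg sum_nonneg)
      qed
      show "\<exists>\<pi>''\<in>plans. \<forall>i<j. total_reward (Suc T) (q i) y' \<pi>' \<le> total_reward (Suc T) (q i) y'' \<pi>'' + real T * \<nu> (real T)"
      proof (intro bexI[OF _ \<pi>''] allI impI)
        fix i assume i: "i < j"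
        \<comment> \<open>A component is at most the Euclidean norm; this keeps only the one-sided
          comparison of expectations.\<close>
        have "integral\<^sup>L P (d \<pi>'' i) \<le> (\<integral>w. L2_set (\<lambda>i. d \<pi>'' i w) {..<j} \<partial>P)"
          using i by (intro integral_mono dint L2int member_le_L2_set) auto
        also have "\<dots> \<le> \<nu> (real T)" using le transfer[OF L2m] by simp
        finally have "real T * integral\<^sup>L P (d \<pi>'' i) \<le> real T * \<nu> (real T)" by (intro mult_left_mono) auto
        moreover have "integral\<^sup>L P (d \<pi>'' i) =
            (1 / real T) * total_reward (Suc T) (q i) y' \<pi>' - (1 / real T) * total_reward (Suc T) (q i) y'' \<pi>''"
          unfolding d_def total_reward_def lessThan_Suc_atMost atLeast0AtMost[symmetric]
          using ints[OF y' \<pi>', of i] ints[OF y'' \<pi>'', of i]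
          by (subst Bochner_Integration.integral_diff) (auto intro!: integrable_mult_right)
        ultimately show "total_reward (Suc T) (q i) y' \<pi>' \<le> total_reward (Suc T) (q i) y'' \<pi>'' + real T * \<nu> (real T)"
          using T by (simp add: algebra_simps)
      qed
    qed
  qed
  \<comment> \<open>An infinite-horizon plan is also a plan for every \<open>\<epsilon>\<close>, so
    the plans constructed above serve without truncation.\<close>
  have hp: "plans \<subseteq> hybrid_plans U S \<epsilon>" for \<epsilon> by (auto simp: hybrid_plans_def control_plans_def)
  have zhZ: "z\<^sub>h \<epsilon> \<pi> \<omega> s \<in> Z" if "\<epsilon> > 0" "\<pi> \<in> plans" "\<omega> \<in> space M" "s \<in> {0..1}" for \<epsilon> \<pi> \<omega> s
    using Z_hybrid[OF that(1) _ that(3,4)] hp that(2) interior_subset by blast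
  have zbZ: "zb s \<in> Z" if "inclusion_solution (\<lambda>_. V) z0 zb" "s \<in> {0..1}" for zb s
    using Z_inclusion[OF that] interior_subset by blast
  define good where "good \<epsilon> b \<longleftrightarrow> (\<forall>zbar. inclusion_solution (\<lambda>_. V) z0 zbar \<longrightarrow>
    (\<exists>\<pi>\<in>hybrid_plans U S \<epsilon>. \<forall>s\<in>{0..1}. (\<integral>\<omega>. norm (z\<^sub>h \<epsilon> \<pi> \<omega> s - zbar s) \<partial>M) \<le> b))" for \<epsilon> b
  have "\<exists>\<psi>. (\<psi> \<longlongrightarrow> 0) (at_right 0) \<and> (\<forall>\<epsilon>>0. good \<epsilon> (\<psi> \<epsilon>))"
  proof (rule limit_envelope)
    fix \<epsilon> :: real assume \<epsilon>: "\<epsilon> > 0"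
    obtain b where b: "\<And>z. z \<in> Z \<Longrightarrow> norm z \<le> b"
      using compact_imp_bounded[OF Z_compact] by (auto simp: bounded_iff)
    obtain \<pi> where \<pi>: "\<pi> \<in> plans" using plans_nonempty by auto
    \<comment> \<open>A crude bound for every \<open>\<epsilon>\<close>, attained by any plan: both
      paths stay in the bounded set \<open>Z\<close>.\<close>
    have "good \<epsilon> (max 0 (2 * b))"
      unfolding good_def
    proof (intro allI impI bexI[of _ \<pi>] ballI)
      fix zbar s assume zb: "inclusion_solution (\<lambda>_. V) z0 zbar" and s: "s \<in> {0..1::real}"
      have "(\<integral>\<omega>. norm (z\<^sub>h \<epsilon> \<pi> \<omega> s - zbar s) \<partial>M) \<le> (\<integral>\<omega>. max 0 (2 * b) \<partial>M)"
      proof (rule integral_mono')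
        fix \<omega> assume "\<omega> \<in> space M"
        then show "norm (z\<^sub>h \<epsilon> \<pi> \<omega> s - zbar s) \<le> max 0 (2 * b)"
          using b[OF zhZ[OF \<epsilon> \<pi> _ s]] b[OF zbZ[OF zb s]] norm_triangle_ineq4[of "z\<^sub>h \<epsilon> \<pi> \<omega> s" "zbar s"] by force
      qed auto
      then show "(\<integral>\<omega>. norm (z\<^sub>h \<epsilon> \<pi> \<omega> s - zbar s) \<partial>M) \<le> max 0 (2 * b)" by (simp add: M.prob_space)
    qed (use \<pi> hp in auto)
    then show "\<exists>b\<ge>0. good \<epsilon> b" by (intro exI[of _ "max 0 (2 * b)"]) auto
  next
    fix \<eta> :: real assume \<eta>: "\<eta> > 0"
    have gZ: "continuous_on (Z \<times> Y \<times> U) g" by (rule continuous_on_subset[OF g_cont]) auto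
    have lip: "norm (g (z1, x) - g (z2, x)) \<le> C * norm (z1 - z2)" if "z1 \<in> Z" "z2 \<in> Z" "x \<in> Y \<times> U" for z1 z2 x
      using that g_lipschitz by auto
    obtain \<epsilon>0 where \<epsilon>0: "\<epsilon>0 > 0" and trk: "\<And>\<epsilon> zb. 0 < \<epsilon> \<Longrightarrow> \<epsilon> < \<epsilon>0 \<Longrightarrow>
      inclusion_solution (\<lambda>_. averaged_velocities {\<gamma>. stationary \<gamma>} g) z0 zb \<Longrightarrow> (\<forall>s\<in>{0..1}. zb s \<in> Z) \<Longrightarrow>
      (\<exists>\<pi>\<in>plans. \<forall>s\<in>{0..1}. \<exists>X. integrable P X \<and> integral\<^sup>L P X \<le> \<eta> \<and>
        (\<forall>w\<in>space P. 0 \<le> X w \<and> (\<forall>ze. hybrid_solution f g y0 z0 \<epsilon> \<pi> w ze \<longrightarrow> (\<forall>r\<in>{0..1}. ze r \<in> Z) \<longrightarrow>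
          norm (ze s - zb s) \<le> X w)))"
      using uniform_tracking[OF q tr _ Z_compact gZ lip less_imp_le[OF C_pos] y0 \<eta>, of z0] \<gamma>0 WS by blast
    have "good \<epsilon> \<eta>" if \<epsilon>: "0 < \<epsilon>" "\<epsilon> < \<epsilon>0" for \<epsilon>
      unfolding good_def
    proof (intro allI impI)
      fix zb assume zb: "inclusion_solution (\<lambda>_. V) z0 zb"
      obtain \<pi> where \<pi>: "\<pi> \<in> plans" and X: "\<And>s. s \<in> {0..1} \<Longrightarrow> \<exists>X. integrable P X \<and> integral\<^sup>L P X \<le> \<eta> \<and>
        (\<forall>w\<in>space P. 0 \<le> X w \<and> (\<forall>ze. hybrid_solution f g y0 z0 \<epsilon> \<pi> w ze \<longrightarrow> (\<forall>r\<in>{0..1}. ze r \<in> Z) \<longrightarrow>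
          norm (ze s - zb s) \<le> X w))"
        using trk[OF \<epsilon> zb[unfolded V_def WS]] zbZ[OF zb] by blast
      have "(\<integral>\<omega>. norm (z\<^sub>h \<epsilon> \<pi> \<omega> s - zb s) \<partial>M) \<le> \<eta>" if s: "s \<in> {0..1}" for s
      proof -
        obtain X where Xi: "integrable P X" "integral\<^sup>L P X \<le> \<eta>"
          and Xw: "\<And>w. w \<in> space P \<Longrightarrow> 0 \<le> X w" "\<And>w ze. w \<in> space P \<Longrightarrow> hybrid_solution f g y0 z0 \<epsilon> \<pi> w ze \<Longrightarrow>
            (\<forall>r\<in>{0..1}. ze r \<in> Z) \<Longrightarrow> norm (ze s - zb s) \<le> X w"
          using X[OF s] by blast
        \<comment> \<open>The left integrand may fail to be measurable, and its integral is then 0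
          by convention; nonnegativity of \<open>X\<close> covers that case.\<close>
        have "(\<integral>\<omega>. norm (z\<^sub>h \<epsilon> \<pi> \<omega> s - zb s) \<partial>M) \<le> (\<integral>\<omega>. X (\<Sigma> \<omega>) \<partial>M)"
        proof (rule integral_mono')
          show "integrable M (\<lambda>\<omega>. X (\<Sigma> \<omega>))"
            using integrable_distr[OF \<Sigma>m] Xi(1) distr by simp
          fix \<omega> assume \<omega>: "\<omega> \<in> space M"
          have sp: "\<Sigma> \<omega> \<in> space P" by (rule measurable_space[OF \<Sigma>m \<omega>])
          show "0 \<le> X (\<Sigma> \<omega>)" by (rule Xw(1)[OF sp])
          have "hybrid_solution f g y0 z0 \<epsilon> \<pi> (\<Sigma> \<omega>) (z\<^sub>h \<epsilon> \<pi> \<omega>)"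
            unfolding \<Sigma>_def using hybrid[OF \<epsilon>(1) _ \<omega>] \<pi> hp by blast
          then show "norm (z\<^sub>h \<epsilon> \<pi> \<omega> s - zb s) \<le> X (\<Sigma> \<omega>)"
            using zhZ[OF \<epsilon>(1) \<pi> \<omega>] by (intro Xw(2)[OF sp]) auto
        qed
        also have "\<dots> = integral\<^sup>L P X" by (rule transfer[OF borel_measurable_integrable[OF Xi(1)]])
        finally show ?thesis using Xi(2) by simp
      qed
      then show "\<exists>\<pi>\<in>hybrid_plans U S \<epsilon>. \<forall>s\<in>{0..1}. (\<integral>\<omega>. norm (z\<^sub>h \<epsilon> \<pi> \<omega> s - zb s) \<partial>M) \<le> \<eta>"
        using \<pi> hp by blast
    qed
    then show "\<exists>\<epsilon>0>0. \<forall>\<epsilon>. 0 < \<epsilon> \<and> \<epsilon> < \<epsilon>0 \<longrightarrow> good \<epsilon> \<eta>" using \<epsilon>0 by blast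
  next
    fix \<epsilon> b b' assume "good \<epsilon> b" "b \<le> b'"
    then show "good \<epsilon> b'" unfolding good_def by (meson order_trans)
  qed
  then show ?thesis unfolding good_def by blast
qed

end
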